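(* The category $\mathbf{SOAT}$ of second-order algebraic theories and second-order algebraic translations and the category $\mathbf{SOEP}$ of second-order equational presentations and second-order syntactic translations are equivalent.
   Context: Signatures and terms. A second-order signature $\Sigma=(\Omega,|-|)$ is a set $\Omega$ of operators with an arity function $|-|:\Omega\to\mathbb{N}^*$ (finite sequences); write $\omega:(n_1,\dots,n_k)$ if $|\omega|=(n_1,\dots,n_k)$ (the operator takes $k$ arguments and binds $n_i$ variables in the $i$-th). A context $\Theta\triangleright\Gamma$ consists of a list $\Theta=\mathsf{m}_1:[m_1],\dots,\mathsf{m}_k:[m_k]$ of distinct metavariables with meta-arities $m_i\in\mathbb{N}$ and a list $\Gamma=x_1,\dots,x_n$ of distinct variables ($-$ denotes the empty list). Terms are generated by: $\Theta\triangleright\Gamma\vdash x$ for $x\in\Gamma$; for $(\mathsf{m}:[m])\in\Theta$, if $\Theta\triangleright\Gamma\vdash t_i$ ($1\le i\le m$) then $\Theta\triangleright\Gamma\vdash\mathsf{m}[t_1,\dots,t_m]$; for $\omega:(n_1,\dots,n_k)$, if $\Theta\triangleright\Gamma,\vec{x}_i\vdash t_i$ with $\vec{x}_i=x^{(i)}_1,\dots,x^{(i)}_{n_i}$ ($1\le i\le k$) then $\Theta\triangleright\Gamma\vdash\omega((\vec{x}_1)t_1,\dots,(\vec{x}_k)t_k)$, where $\vec{x}_i$ is bound in $t_i$; terms are taken up to $\alpha$-equivalence. Terms containing no operators are called elementary. Substitution $t\{x_i:=t_i\}$ is capture-avoiding simultaneous substitution for variables. Metasubstitution maps a term $\mathsf{m}_1:[m_1],\dots,\mathsf{m}_k:[m_k]\triangleright\Gamma\vdash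 t$ and terms $\Theta\triangleright\Gamma,\vec{x}_i\vdash t_i$ (with $|\vec{x}_i|=m_i$) to $\Theta\triangleright\Gamma\vdash t\{\mathsf{m}_i:=(\vec{x}_i)t_i\}_{1\le i\le k}$; it fixes variables, commutes with operators (avoiding capture), and sends $\mathsf{m}_l[s_1,\dots,s_{m_l}]$ to $t_l\{x^{(l)}_j:=s'_j\}_j$, where $s'_j$ is the metasubstituted $s_j$. Equational presentations. An equation $\Theta\triangleright\Gamma\vdash s\equiv t$ is a pair of terms in the same context. A second-order equational presentation $\mathcal{E}=(\Sigma,E)$ is a signature $\Sigma$ with a set $E$ of equations (axioms). Derivability from $E$ (Second-Order Equational Logic) is generated by the axioms; reflexivity, symmetry, transitivity; and extended metasubstitution: from $\mathsf{m}_1:[m_1],\dots,\mathsf{m}_k:[m_k]\triangleright\Gamma\vdash s\equiv t$ and $\Theta\triangleright\Delta,\vec{x}_i\vdash s_i\equiv t_i$ ($1\le i\le k$) infer $\Theta\triangleright\Gamma,\Delta\vdash s\{\mathsf{m}_i:=(\vec{x}_i)s_i\}_i\equiv t\{\mathsf{m}_i:=(\vec{x}_i)t_i\}_i$. The category $\mathbf{SOEP}$. Objects are second-order equational presentations. A syntactic translation of signatures $\tau:\Sigma\to\Sigma'$ is a mapping assigning to each operator $\omega:(m_1,\dots,m_k)$ of $\Sigma$ a term $\mathsf{m}_1:[m_1],\dots,\mathsf{m}_k:[m_k]\triangleright-\vdash\tau_\omega$ over $\Sigma'$. It extends to terms by $\tau(x)=x$, $\tau(\mathsf{m}[t_1,\dots,t_m])=\mathsf{m}[\tau(t_1),\dots,\tau(t_m)]$,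 $\tau(\omega((\vec{x}_1)t_1,\dots,(\vec{x}_k)t_k))=\tau_\omega\{\mathsf{m}_i:=(\vec{x}_i)\tau(t_i)\}_{1\le i\le k}$. A syntactic translation $\tau:(\Sigma,E)\to(\Sigma',E')$ of presentations is a syntactic translation $\Sigma\to\Sigma'$ of signatures such that for each axiom $\Theta\triangleright\Gamma\vdash s\equiv t$ of $E$, the equation $\Theta\triangleright\Gamma\vdash\tau(s)\equiv\tau(t)$ is derivable from $E'$. Morphisms of $\mathbf{SOEP}$ are syntactic translations of presentations. The composite $\tau'\circ\tau$ sends $\omega$ to $\tau'(\tau_\omega)$; the identity sends $\omega:(m_1,\dots,m_k)$ to $\omega((\vec{x}_1)\mathsf{m}_1[\vec{x}_1],\dots,(\vec{x}_k)\mathsf{m}_k[\vec{x}_k])$. The category $\mathbb{M}$. Objects are sequences $(m_1,\dots,m_k)\in\mathbb{N}^*$; a morphism $(m_1,\dots,m_k)\to(n_1,\dots,n_l)$ is a tuple $\langle\mathsf{m}_1:[m_1],\dots,\mathsf{m}_k:[m_k]\triangleright x_1,\dots,x_{n_i}\vdash t_i\rangle_{1\le i\le l}$ of elementary terms (names in contexts are immaterial). The identity is $\langle\mathsf{m}_i[x_1,\dots,x_{m_i}]\rangle_i$, and the composite of $\langle s_p\rangle_p$ followed by $\langle t_q\rangle_q$ is $\langle t_q\{\mathsf{m}_p:=(x_1,\dots,x_{m_p})s_p\}_p\rangle_q$. It has strict finite products given by concatenation (terminal object $()$, projections $\langle\mathsf{m}_i[x_1,\dots,x_{m_i}]\rangle$),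 and $(0)$ is exponentiable: $(0)\Rightarrow(m_1,\dots,m_k)=(m_1+1,\dots,m_k+1)$ with evaluation $\langle\mathsf{m}_1:[m_1+1],\dots,\mathsf{m}_k:[m_k+1],\mathsf{n}:[0]\triangleright x_1,\dots,x_{m_i}\vdash\mathsf{m}_i[x_1,\dots,x_{m_i},\mathsf{n}[]]\rangle_i$. The category $\mathbf{SOAT}$. A cartesian category is a category with finite products; a cartesian functor preserves them (strictly, for a strict cartesian functor). A second-order algebraic theory is a small cartesian category $\mathcal{M}$ with a strict cartesian identity-on-objects functor $M:\mathbb{M}\to\mathcal{M}$ that preserves the exponentiable object $(0)$, i.e. $(0)$ is exponentiable in $\mathcal{M}$ and $M$ maps each exponential $(0)\Rightarrow(m_1,\dots,m_k)$ with its evaluation map to an exponential with its evaluation map in $\mathcal{M}$. A second-order algebraic translation from $M:\mathbb{M}\to\mathcal{M}$ to $M':\mathbb{M}\to\mathcal{M}'$ is a cartesian functor $F:\mathcal{M}\to\mathcal{M}'$ with $F\circ M=M'$. Identities and composition are the evident ones.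
   Formalization: Parallel syntactic translations are identified when the target presentation proves their values on every operator equal; without this SOEP has no terminal object while SOAT has one. Smallness is relative to an arbitrary infinite universe of operators and arrows. *)

theory Defs
  imports "HOL-Library.FuncSet"
begin

section \<open>Categories\<close>

text \<open>
  Only the values on the carriers \<open>Obj\<close>, \<open>Arr\<close> and on composable pairs matter; elsewhere the
  record fields hold junk. Functors, in contrast, are required to be extensional, so that
  equality of functor records is equality of functors.
\<close>

record ('o, 'a) cat =
  Obj :: "'o set"
  Arr :: "'a set"
  Dom :: "'a \<Rightarrow> 'o"
  Cod :: "'a \<Rightarrow> 'o"
  Ide :: "'o \<Rightarrow> 'a"
  Comp :: "'a \<Rightarrow> 'a \<Rightarrow> 'a"  \<comment> \<open>\<open>Comp C g f\<close> is \<open>g\<close> after \<open>f\<close>\<close>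

definition Hom :: "('o, 'a, 'z) cat_scheme \<Rightarrow> 'o \<Rightarrow> 'o \<Rightarrow> 'a set" where
  "Hom C a b = {f \<in> Arr C. Dom C f = a \<and> Cod C f = b}"

locale category =
  fixes C :: "('o, 'a, 'z) cat_scheme"
  assumes dom_obj: "f \<in> Arr C \<Longrightarrow> Dom C f \<in> Obj C"
    and cod_obj: "f \<in> Arr C \<Longrightarrow> Cod C f \<in> Obj C"
    and ide_hom: "a \<in> Obj C \<Longrightarrow> Ide C a \<in> Hom C a a"
    and comp_hom: "f \<in> Hom C a b \<Longrightarrow> g \<in> Hom C b c \<Longrightarrow> Comp C g f \<in> Hom C a c"
    and comp_ide_right: "f \<in> Hom C a b \<Longrightarrow> Comp C f (Ide C a) = f"
    and comp_ide_left: "f \<in> Hom C a b \<Longrightarrow> Comp C (Ide C b) f = f"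
    and comp_assoc: "f \<in> Hom C a b \<Longrightarrow> g \<in> Hom C b c \<Longrightarrow> h \<in> Hom C c d \<Longrightarrow>
      Comp C h (Comp C g f) = Comp C (Comp C h g) f"

record ('o, 'a, 'p, 'b) ftr =
  OMap :: "'o \<Rightarrow> 'p"
  AMap :: "'a \<Rightarrow> 'b"

definition is_functor ::
  "('o, 'a, 'y) cat_scheme \<Rightarrow> ('p, 'b, 'z) cat_scheme \<Rightarrow> ('o, 'a, 'p, 'b) ftr \<Rightarrow> bool" where
  "is_functor C D F \<longleftrightarrow>
     category C \<and> category D \<and>
     OMap F \<in> Obj C \<rightarrow>\<^sub>E Obj D \<and> AMap F \<in> Arr C \<rightarrow>\<^sub>E Arr D \<and>
     (\<forall>f\<in>Arr C. Dom D (AMap F f) = OMap F (Dom C f) \<and> Cod D (AMap F f) = OMap F (Cod C f)) \<and>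
     (\<forall>a\<in>Obj C. AMap F (Ide C a) = Ide D (OMap F a)) \<and>
     (\<forall>f\<in>Arr C. \<forall>g\<in>Arr C. Cod C f = Dom C g \<longrightarrow>
        AMap F (Comp C g f) = Comp D (AMap F g) (AMap F f))"

definition id_ftr :: "('o, 'a, 'z) cat_scheme \<Rightarrow> ('o, 'a, 'o, 'a) ftr" where
  "id_ftr C = \<lparr>OMap = (\<lambda>a\<in>Obj C. a), AMap = (\<lambda>f\<in>Arr C. f)\<rparr>"

definition comp_ftr ::
  "('o, 'a, 'z) cat_scheme \<Rightarrow> ('p, 'b, 'q, 'c) ftr \<Rightarrow> ('o, 'a, 'p, 'b) ftr \<Rightarrow> ('o, 'a, 'q, 'c) ftr"
  where
  "comp_ftr C G F =
     \<lparr>OMap = compose (Obj C) (OMap G) (OMap F), AMap = compose (Arr C) (AMap G) (AMap F)\<rparr>"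

definition is_iso :: "('o, 'a, 'z) cat_scheme \<Rightarrow> 'o \<Rightarrow> 'o \<Rightarrow> 'a \<Rightarrow> bool" where
  "is_iso C a b f \<longleftrightarrow>
     f \<in> Hom C a b \<and> (\<exists>g\<in>Hom C b a. Comp C g f = Ide C a \<and> Comp C f g = Ide C b)"

definition naturally_isomorphic ::
  "('o, 'a, 'y) cat_scheme \<Rightarrow> ('p, 'b, 'z) cat_scheme \<Rightarrow>
   ('o, 'a, 'p, 'b) ftr \<Rightarrow> ('o, 'a, 'p, 'b) ftr \<Rightarrow> bool" where
  "naturally_isomorphic C D F G \<longleftrightarrow>
     (\<exists>\<eta>. (\<forall>a\<in>Obj C. is_iso D (OMap F a) (OMap G a) (\<eta> a)) \<and>
          (\<forall>f\<in>Arr C. Comp D (\<eta> (Cod C f)) (AMap F f) = Comp D (AMap G f) (\<eta> (Dom C f))))"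

definition equivalent_categories ::
  "('o, 'a, 'y) cat_scheme \<Rightarrow> ('p, 'b, 'z) cat_scheme \<Rightarrow> bool" where
  "equivalent_categories C D \<longleftrightarrow>
     category C \<and> category D \<and>
     (\<exists>F G. is_functor C D F \<and> is_functor D C G \<and>
        naturally_isomorphic C C (comp_ftr C G F) (id_ftr C) \<and>
        naturally_isomorphic D D (comp_ftr D F G) (id_ftr D))"


section \<open>Cartesian categories and exponentials\<close>

record ('o, 'a) cart_cat = "('o, 'a) cat" +
  One :: "'o"
  Prod :: "'o \<Rightarrow> 'o \<Rightarrow> 'o"
  Fst :: "'o \<Rightarrow> 'o \<Rightarrow> 'a"
  Snd :: "'o \<Rightarrow> 'o \<Rightarrow> 'a"

definition is_terminal :: "('o, 'a, 'z) cat_scheme \<Rightarrow> 'o \<Rightarrow> bool" where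
  "is_terminal C t \<longleftrightarrow> t \<in> Obj C \<and> (\<forall>a\<in>Obj C. \<exists>!f. f \<in> Hom C a t)"

definition is_product ::
  "('o, 'a, 'z) cat_scheme \<Rightarrow> 'o \<Rightarrow> 'o \<Rightarrow> 'o \<Rightarrow> 'a \<Rightarrow> 'a \<Rightarrow> bool" where
  "is_product C a b p \<pi>\<^sub>1 \<pi>\<^sub>2 \<longleftrightarrow>
     a \<in> Obj C \<and> b \<in> Obj C \<and> p \<in> Obj C \<and> \<pi>\<^sub>1 \<in> Hom C p a \<and> \<pi>\<^sub>2 \<in> Hom C p b \<and>
     (\<forall>c\<in>Obj C. \<forall>f\<in>Hom C c a. \<forall>g\<in>Hom C c b.
        \<exists>!h. h \<in> Hom C c p \<and> Comp C \<pi>\<^sub>1 h = f \<and> Comp C \<pi>\<^sub>2 h = g)"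

definition cartesian :: "('o, 'a, 'z) cart_cat_scheme \<Rightarrow> bool" where
  "cartesian C \<longleftrightarrow>
     category C \<and> is_terminal C (One C) \<and>
     (\<forall>a\<in>Obj C. \<forall>b\<in>Obj C. is_product C a b (Prod C a b) (Fst C a b) (Snd C a b))"

definition cartesian_functor ::
  "('o, 'a, 'y) cart_cat_scheme \<Rightarrow> ('p, 'b, 'z) cart_cat_scheme \<Rightarrow> ('o, 'a, 'p, 'b) ftr \<Rightarrow> bool"
  where
  "cartesian_functor C D F \<longleftrightarrow>
     cartesian C \<and> cartesian D \<and> is_functor C D F \<and>
     is_terminal D (OMap F (One C)) \<and>
     (\<forall>a\<in>Obj C. \<forall>b\<in>Obj C.
        is_product D (OMap F a) (OMap F b) (OMap F (Prod C a b))
          (AMap F (Fst C a b)) (AMap F (Snd C a b)))"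

definition strict_cartesian_functor ::
  "('o, 'a, 'y) cart_cat_scheme \<Rightarrow> ('p, 'b, 'z) cart_cat_scheme \<Rightarrow> ('o, 'a, 'p, 'b) ftr \<Rightarrow> bool"
  where
  "strict_cartesian_functor C D F \<longleftrightarrow>
     cartesian C \<and> cartesian D \<and> is_functor C D F \<and>
     OMap F (One C) = One D \<and>
     (\<forall>a\<in>Obj C. \<forall>b\<in>Obj C.
        OMap F (Prod C a b) = Prod D (OMap F a) (OMap F b) \<and>
        AMap F (Fst C a b) = Fst D (OMap F a) (OMap F b) \<and>
        AMap F (Snd C a b) = Snd D (OMap F a) (OMap F b))"

definition prod_arr :: "('o, 'a, 'z) cart_cat_scheme \<Rightarrow> 'a \<Rightarrow> 'a \<Rightarrow> 'a" where
  "prod_arr C f g =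
     (THE h. h \<in> Hom C (Prod C (Dom C f) (Dom C g)) (Prod C (Cod C f) (Cod C g)) \<and>
        Comp C (Fst C (Cod C f) (Cod C g)) h = Comp C f (Fst C (Dom C f) (Dom C g)) \<and>
        Comp C (Snd C (Cod C f) (Cod C g)) h = Comp C g (Snd C (Dom C f) (Dom C g)))"

text \<open>\<open>e\<close> with \<open>ev : e \<times> a \<rightarrow> b\<close> is an exponential \<open>a \<Rightarrow> b\<close>.\<close>

definition is_exponential ::
  "('o, 'a, 'z) cart_cat_scheme \<Rightarrow> 'o \<Rightarrow> 'o \<Rightarrow> 'o \<Rightarrow> 'a \<Rightarrow> bool" where
  "is_exponential C a b e ev \<longleftrightarrow>
     a \<in> Obj C \<and> b \<in> Obj C \<and> e \<in> Obj C \<and> ev \<in> Hom C (Prod C e a) b \<and>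
     (\<forall>c\<in>Obj C. \<forall>f\<in>Hom C (Prod C c a) b.
        \<exists>!g. g \<in> Hom C c e \<and> Comp C ev (prod_arr C g (Ide C a)) = f)"

definition exponentiable :: "('o, 'a, 'z) cart_cat_scheme \<Rightarrow> 'o \<Rightarrow> bool" where
  "exponentiable C a \<longleftrightarrow> a \<in> Obj C \<and> (\<forall>b\<in>Obj C. \<exists>e ev. is_exponential C a b e ev)"


section \<open>Second-order terms\<close>

text \<open>
  Terms up to \<open>\<alpha>\<close>-equivalence are represented by de Bruijn indices, so names in contexts are
  immaterial: the metavariable context \<open>\<Theta>\<close> is the list of its meta-arities, and \<open>MVar i ts\<close> is
  the \<open>i\<close>-th metavariable (from \<open>0\<close>) applied to \<open>ts\<close>; the variable context
  \<open>\<Gamma> = x\<^sub>1, \<dots>, x\<^sub>n\<close> is its length \<open>n\<close>, and \<open>Var (j - 1)\<close> is \<open>x\<^sub>j\<close>.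
  In the context \<open>\<Gamma>, x\<^sub>1, \<dots>, x\<^sub>k\<close> of the body of a \<open>k\<close>-fold abstraction the bound
  variables \<open>x\<^sub>1, \<dots>, x\<^sub>k\<close> have the indices \<open>0, \<dots>, k - 1\<close>, and the indices of
  the variables of \<open>\<Gamma>\<close> are raised by \<open>k\<close>. An abstraction \<open>(x\<^sub>1, \<dots>, x\<^sub>k) t\<close> is the
  pair \<open>(k, t)\<close>.
\<close>

datatype 'u trm =
    Var nat
  | MVar nat "'u trm list"
  | Op 'u "(nat \<times> 'u trm) list"

type_synonym 'u abs = "nat \<times> 'u trm"

text \<open>A signature is a partial map; its domain is the set of operators.\<close>

type_synonym 'u signature = "'u \<Rightarrow> nat list option"

text \<open>\<open>is_trm \<Sigma> \<Theta> n t\<close> means \<open>\<Theta> \<triangleright> x\<^sub>1, \<dots>, x\<^sub>n \<turnstile> t\<close>.\<close>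

inductive is_trm :: "'u signature \<Rightarrow> nat list \<Rightarrow> nat \<Rightarrow> 'u trm \<Rightarrow> bool"
  for \<Sigma> :: "'u signature" and \<Theta> :: "nat list" where
  var: "i < n \<Longrightarrow> is_trm \<Sigma> \<Theta> n (Var i)"
| mvar: "i < length \<Theta> \<Longrightarrow> length ts = \<Theta> ! i \<Longrightarrow> (\<And>t. t \<in> set ts \<Longrightarrow> is_trm \<Sigma> \<Theta> n t) \<Longrightarrow>
    is_trm \<Sigma> \<Theta> n (MVar i ts)"
| op: "\<Sigma> \<omega> = Some (map fst as) \<Longrightarrow> (\<And>k t. (k, t) \<in> set as \<Longrightarrow> is_trm \<Sigma> \<Theta> (k + n) t) \<Longrightarrow>
    is_trm \<Sigma> \<Theta> n (Op \<omega> as)"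

text \<open>An elementary term contains no operators, i.e. it is a term over the empty signature.\<close>

abbreviation elementary :: "nat list \<Rightarrow> nat \<Rightarrow> 'u trm \<Rightarrow> bool" where
  "elementary \<equiv> is_trm Map.empty"

fun rename :: "(nat \<Rightarrow> nat) \<Rightarrow> 'u trm \<Rightarrow> 'u trm" where
  "rename \<rho> (Var i) = Var (\<rho> i)"
| "rename \<rho> (MVar i ts) = MVar i (map (rename \<rho>) ts)"
| "rename \<rho> (Op \<omega> as) =
     Op \<omega> (map (\<lambda>(k, t). (k, rename (\<lambda>i. if i < k then i else \<rho> (i - k) + k) t)) as)"

text \<open>Capture-avoiding simultaneous substitution \<open>t{x\<^sub>i := \<sigma> i}\<close>.\<close>

fun subst :: "(nat \<Rightarrow> 'u trm) \<Rightarrow> 'u trm \<Rightarrow> 'u trm" where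
  "subst \<sigma> (Var i) = \<sigma> i"
| "subst \<sigma> (MVar i ts) = MVar i (map (subst \<sigma>) ts)"
| "subst \<sigma> (Op \<omega> as) =
     Op \<omega> (map (\<lambda>(k, t). (k, subst (\<lambda>i. if i < k then Var i else rename (\<lambda>j. j + k) (\<sigma> (i - k))) t)) as)"

text \<open>Insert \<open>n\<close> new variables at the front of the indices of the free variables.\<close>

fun shift_abs :: "nat \<Rightarrow> 'u abs \<Rightarrow> 'u abs" where
  "shift_abs n (k, t) = (k, rename (\<lambda>i. if i < k then i else i + n) t)"

text \<open>
  Replace the \<open>k\<close> abstracted variables by the arguments \<open>ts\<close> (with \<open>length ts = k\<close>).
\<close>

fun apply_abs :: "'u abs \<Rightarrow> 'u trm list \<Rightarrow> 'u trm" where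
  "apply_abs (k, t) ts = subst (\<lambda>i. if i < k then ts ! i else Var (i - k)) t"

text \<open>
  Metasubstitution: \<open>msubst \<theta> t\<close> replaces the \<open>i\<close>-th metavariable by the abstraction \<open>\<theta> ! i\<close>.
  The free variables of \<open>t\<close> and of the abstractions live in the same context.
\<close>

fun msubst :: "'u abs list \<Rightarrow> 'u trm \<Rightarrow> 'u trm" where
  "msubst \<theta> (Var i) = Var i"
| "msubst \<theta> (MVar i ts) = apply_abs (\<theta> ! i) (map (msubst \<theta>) ts)"
| "msubst \<theta> (Op \<omega> as) = Op \<omega> (map (\<lambda>(k, t). (k, msubst (map (shift_abs k) \<theta>) t)) as)"

text \<open>The generic application \<open>\<m>\<^sub>i[x\<^sub>1, \<dots>, x\<^sub>m]\<close>.\<close>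

definition generic :: "nat \<Rightarrow> nat \<Rightarrow> 'u trm" where
  "generic i m = MVar i (map Var [0..<m])"


section \<open>Second-order equational presentations\<close>

text \<open>\<open>(\<Theta>, n, s, t)\<close> is the equation \<open>\<Theta> \<triangleright> x\<^sub>1, \<dots>, x\<^sub>n \<turnstile> s \<equiv> t\<close>.\<close>

type_synonym 'u equation = "nat list \<times> nat \<times> 'u trm \<times> 'u trm"

text \<open>
  Second-order equational logic. In the rule of extended metasubstitution the variables of
  \<open>\<Gamma>, \<Delta>\<close> are numbered with those of \<open>\<Gamma>\<close> first, so \<open>s\<close> and \<open>t\<close> need no weakening, and the
  abstractions are shifted past \<open>\<Gamma>\<close>.
\<close>

inductive derivable ::
  "'u signature \<Rightarrow> 'u equation set \<Rightarrow> nat list \<Rightarrow> nat \<Rightarrow> 'u trm \<Rightarrow> 'u trm \<Rightarrow> bool"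
  for \<Sigma> :: "'u signature" and E :: "'u equation set" where
  axiom: "(\<Theta>, n, s, t) \<in> E \<Longrightarrow> derivable \<Sigma> E \<Theta> n s t"
| refl: "is_trm \<Sigma> \<Theta> n t \<Longrightarrow> derivable \<Sigma> E \<Theta> n t t"
| sym: "derivable \<Sigma> E \<Theta> n s t \<Longrightarrow> derivable \<Sigma> E \<Theta> n t s"
| trans: "derivable \<Sigma> E \<Theta> n s t \<Longrightarrow> derivable \<Sigma> E \<Theta> n t u \<Longrightarrow> derivable \<Sigma> E \<Theta> n s u"
| msubst: "derivable \<Sigma> E ms n s t \<Longrightarrow>
    length ss = length ms \<Longrightarrow> length ts = length ms \<Longrightarrow>
    (\<And>i. i < length ms \<Longrightarrow> derivable \<Sigma> E \<Theta> (ms ! i + d) (ss ! i) (ts ! i)) \<Longrightarrow>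
    derivable \<Sigma> E \<Theta> (n + d)
      (msubst (map (shift_abs n) (zip ms ss)) s)
      (msubst (map (shift_abs n) (zip ms ts)) t)"

record 'u presentation =
  sig :: "'u signature"
  axs :: "'u equation set"

definition is_presentation :: "'u presentation \<Rightarrow> bool" where
  "is_presentation P \<longleftrightarrow>
     (\<forall>(\<Theta>, n, s, t)\<in>axs P. is_trm (sig P) \<Theta> n s \<and> is_trm (sig P) \<Theta> n t)"

definition is_sig_translation :: "'u signature \<Rightarrow> 'u signature \<Rightarrow> ('u \<Rightarrow> 'u trm) \<Rightarrow> bool" where
  "is_sig_translation \<Sigma> \<Sigma>' \<tau> \<longleftrightarrow>
     \<tau> \<in> extensional (dom \<Sigma>) \<and> (\<forall>\<omega> ms. \<Sigma> \<omega> = Some ms \<longrightarrow> is_trm \<Sigma>' ms 0 (\<tau> \<omega>))"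

fun translate :: "('u \<Rightarrow> 'u trm) \<Rightarrow> 'u trm \<Rightarrow> 'u trm" where
  "translate \<tau> (Var i) = Var i"
| "translate \<tau> (MVar i ts) = MVar i (map (translate \<tau>) ts)"
| "translate \<tau> (Op \<omega> as) = msubst (map (\<lambda>(k, t). (k, translate \<tau> t)) as) (\<tau> \<omega>)"

definition is_translation :: "'u presentation \<Rightarrow> 'u presentation \<Rightarrow> ('u \<Rightarrow> 'u trm) \<Rightarrow> bool" where
  "is_translation P Q \<tau> \<longleftrightarrow>
     is_sig_translation (sig P) (sig Q) \<tau> \<and>
     (\<forall>(\<Theta>, n, s, t)\<in>axs P. derivable (sig Q) (axs Q) \<Theta> n (translate \<tau> s) (translate \<tau> t))"

definition id_translation :: "'u presentation \<Rightarrow> 'u \<Rightarrow> 'u trm" where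
  "id_translation P =
     (\<lambda>\<omega>\<in>dom (sig P).
        let ms = the (sig P \<omega>) in Op \<omega> (map (\<lambda>i. (ms ! i, generic i (ms ! i))) [0..<length ms]))"

definition comp_translation ::
  "'u presentation \<Rightarrow> ('u \<Rightarrow> 'u trm) \<Rightarrow> ('u \<Rightarrow> 'u trm) \<Rightarrow> 'u \<Rightarrow> 'u trm" where
  "comp_translation P \<tau>' \<tau> = (\<lambda>\<omega>\<in>dom (sig P). translate \<tau>' (\<tau> \<omega>))"

text \<open>
  Parallel translations are identified when the target presentation proves their values on every
  operator equal. Without this identification the category of presentations is not equivalent to
  that of theories: the theory with exactly one arrow between any two objects is terminal, whereas
  no presentation \<open>T\<close> would be terminal (if \<open>T\<close> has a closed term \<open>t\<close>, then \<open>t\<close> and \<open>\<m>[]\<close> are two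
  translations into \<open>T\<close> of a single operator of arity \<open>(0)\<close>; if it has none, there is no translation
  into \<open>T\<close> of a single operator of arity \<open>()\<close>).
\<close>

definition translation_rel ::
  "'u presentation \<Rightarrow> 'u presentation \<Rightarrow> (('u \<Rightarrow> 'u trm) \<times> ('u \<Rightarrow> 'u trm)) set" where
  "translation_rel P Q =
     {(\<tau>, \<tau>'). is_translation P Q \<tau> \<and> is_translation P Q \<tau>' \<and>
        (\<forall>\<omega> ms. sig P \<omega> = Some ms \<longrightarrow> derivable (sig Q) (axs Q) ms 0 (\<tau> \<omega>) (\<tau>' \<omega>))}"

text \<open>
  In the following two categories of presentations and theories, smallness is with respect to the
  type \<open>'u\<close>: the set of operators of a presentation and the set of arrows of a theory are arbitrary
  subsets of \<open>'u\<close>.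
\<close>

type_synonym 'u pres_arrow = "'u presentation \<times> ('u \<Rightarrow> 'u trm) set \<times> 'u presentation"

definition SOEP :: "('u presentation, 'u pres_arrow) cat" where
  "SOEP =
     \<lparr>Obj = {P. is_presentation P},
      Arr = {(P, A, Q). is_presentation P \<and> is_presentation Q \<and>
               A \<in> {\<tau>. is_translation P Q \<tau>} // translation_rel P Q},
      Dom = (\<lambda>(P, A, Q). P),
      Cod = (\<lambda>(P, A, Q). Q),
      Ide = (\<lambda>P. (P, translation_rel P P `` {id_translation P}, P)),
      Comp = (\<lambda>(Q', B, R) (P, A, Q).
        (P, \<Union>\<tau>\<in>A. \<Union>\<tau>'\<in>B. translation_rel P R `` {comp_translation P \<tau>' \<tau>}, R))\<rparr>"


section \<open>The category of arities\<close>

text \<open>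
  The type parameter \<open>'u\<close> of elementary terms is a phantom, as these contain no operators.
\<close>

type_synonym 'u arity_arrow = "nat list \<times> 'u trm list \<times> nat list"

definition arity_cat :: "(nat list, 'u arity_arrow) cart_cat"  ("\<bbbM>") where
  "\<bbbM> =
     \<lparr>Obj = UNIV,
      Arr = {(ms, ts, ns). list_all2 (\<lambda>n t. elementary ms n t) ns ts},
      Dom = (\<lambda>(ms, ts, ns). ms),
      Cod = (\<lambda>(ms, ts, ns). ns),
      Ide = (\<lambda>ms. (ms, map (\<lambda>i. generic i (ms ! i)) [0..<length ms], ms)),
      Comp = (\<lambda>(ns, ts, ls) (ms, ss, ns'). (ms, map (msubst (zip ns ss)) ts, ls)),
      One = [],
      Prod = (@),
      Fst = (\<lambda>ms ns. (ms @ ns, map (\<lambda>i. generic i (ms ! i)) [0..<length ms], ms)),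
      Snd = (\<lambda>ms ns. (ms @ ns, map (\<lambda>i. generic (length ms + i) (ns ! i)) [0..<length ns], ns))\<rparr>"

text \<open>The exponential \<open>(0) \<Rightarrow> (m\<^sub>1, \<dots>, m\<^sub>k)\<close> in \<open>\<bbbM>\<close> and its evaluation map.\<close>

definition arity_exp :: "nat list \<Rightarrow> nat list" where
  "arity_exp ms = map Suc ms"

definition arity_eval :: "nat list \<Rightarrow> 'u arity_arrow" where
  "arity_eval ms =
     (arity_exp ms @ [0],
      map (\<lambda>i. MVar i (map Var [0..<ms ! i] @ [MVar (length ms) []])) [0..<length ms],
      ms)"


section \<open>Second-order algebraic theories\<close>

record 'u alg_theory = "(nat list, 'u) cart_cat" +
  Emb :: "(nat list, 'u arity_arrow, nat list, 'u) ftr"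

definition is_alg_theory :: "'u alg_theory \<Rightarrow> bool" where
  "is_alg_theory T \<longleftrightarrow>
     cartesian T \<and> strict_cartesian_functor \<bbbM> T (Emb T) \<and>
     Obj T = Obj (\<bbbM> :: (nat list, 'u arity_arrow) cart_cat) \<and>
     (\<forall>ms\<in>Obj T. OMap (Emb T) ms = ms) \<and>
     exponentiable T [0] \<and>
     (\<forall>ms. is_exponential T (OMap (Emb T) [0]) (OMap (Emb T) ms)
             (OMap (Emb T) (arity_exp ms)) (AMap (Emb T) (arity_eval ms)))"

definition is_alg_translation ::
  "'u alg_theory \<Rightarrow> 'u alg_theory \<Rightarrow> (nat list, 'u, nat list, 'u) ftr \<Rightarrow> bool" where
  "is_alg_translation T T' F \<longleftrightarrow> cartesian_functor T T' F \<and> comp_ftr \<bbbM> F (Emb T) = Emb T'"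

type_synonym 'u theory_arrow = "'u alg_theory \<times> (nat list, 'u, nat list, 'u) ftr \<times> 'u alg_theory"

definition SOAT :: "('u alg_theory, 'u theory_arrow) cat" where
  "SOAT =
     \<lparr>Obj = {T. is_alg_theory T},
      Arr = {(T, F, T'). is_alg_theory T \<and> is_alg_theory T' \<and> is_alg_translation T T' F},
      Dom = (\<lambda>(T, F, T'). T),
      Cod = (\<lambda>(T, F, T'). T'),
      Ide = (\<lambda>T. (T, id_ftr T, T)),
      Comp = (\<lambda>(T', G, T'') (T, F, S). (T, comp_ftr T G F, T''))\<rparr>"

end

theory Submission
  imports Defs
begin

text \<open>
  A theory has an internal language: its operators of arity \<open>ms\<close> are the arrows
  \<open>ms \<rightarrow> (0)\<close>, and its axioms are the equations between terms over these operators
  that hold in the theory (\<open>pres_of\<close>). Passing to the internal language is a functor from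
  theories to presentations, and the equivalence follows once this functor is seen to be full,
  faithful and essentially surjective.

  Everything rests on one interpretation of terms. Over a theory, a term in context
  \<open>\<Theta> \<triangleright> n\<close> receives a value \<open>val I h vs t : c \<rightarrow> (0)\<close> for every arrow
  \<open>h : c \<rightarrow> \<Theta>\<close> and all \<open>n\<close> elements \<open>vs : c \<rightarrow> (0)\<close>, as if arrows out of
  \<open>c\<close> were elements of sets. Binders are dealt with by the exponentials: an arrow
  \<open>c \<rightarrow> (d)\<close> is the same thing as an operation that sends \<open>d\<close> elements over any
  \<open>r : c' \<rightarrow> c\<close> to an element, naturally in \<open>c'\<close> (\<open>lam_ex\<close>, \<open>app_ext\<close>).
  With this reading, substitution and metasubstitution are interpreted by changing the
  environment (\<open>val_subst\<close>, \<open>val_msubst\<close>), which yields the soundness of second-order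
  equational logic (\<open>derivable_sound\<close>), the interpretation of translated terms
  (\<open>val_translate\<close>) and the compatibility with algebraic translations (\<open>H_val\<close>).

  \<^item> Faithfulness: every arrow is built by tupling and exponential transposition from arrows into
    \<open>(0)\<close>, so an algebraic translation is determined by its values on these
    (\<open>H_determined\<close>).

  \<^item> Fullness: every arrow of a theory is denoted by a tuple of terms over its internal language
    (\<open>sem_arrow_trm\<close>). A translation between internal languages preserves all true equations,
    hence its action on terms is well defined on the arrows they denote; composition is preserved
    since it is metasubstitution (\<open>interpretation_between\<close>).

  \<^item> Essential surjectivity: the terms over a presentation modulo derivability form a theory
    (\<open>is_alg_theory_Syn\<close>) in which each term denotes its own class (\<open>sem_can\<close>). Hence
    the equations that hold in it are exactly the derivable ones, and its internal language is
    isomorphic to the given presentation. As the arrows of a theory are elements of \<open>'u\<close>, the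
    classes are coded in \<open>'u\<close>; this is where \<open>'u\<close> has to be infinite.

  The completeness statement \<open>sem_can\<close> also replaces most of the syntactic work for the category
  of presentations: an equation between terms is derivable as soon as both sides have the same
  denotation in the syntactic theory, and denotations of iterated translations are easy to compare.
\<close>

section \<open>A criterion for equivalence of categories\<close>

lemma HomI: "f \<in> Arr C \<Longrightarrow> Dom C f = a \<Longrightarrow> Cod C f = b \<Longrightarrow> f \<in> Hom C a b"
  by (simp add: Hom_def)

lemma HomD: "f \<in> Hom C a b \<Longrightarrow> f \<in> Arr C" "f \<in> Hom C a b \<Longrightarrow> Dom C f = a"
  "f \<in> Hom C a b \<Longrightarrow> Cod C f = b"
  by (simp_all add: Hom_def)

lemma is_functor_Hom:
  "is_functor C D F \<Longrightarrow> f \<in> Hom C a b \<Longrightarrow> AMap F f \<in> Hom D (OMap F a) (OMap F b)"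
  by (auto simp: is_functor_def Hom_def)

lemma is_functor_Comp:
  "is_functor C D F \<Longrightarrow> f \<in> Hom C a b \<Longrightarrow> g \<in> Hom C b c \<Longrightarrow>
    AMap F (Comp C g f) = Comp D (AMap F g) (AMap F f)"
  by (auto simp: is_functor_def Hom_def)

lemma is_functor_Ide: "is_functor C D F \<Longrightarrow> a \<in> Obj C \<Longrightarrow> AMap F (Ide C a) = Ide D (OMap F a)"
  by (auto simp: is_functor_def)

lemma is_functor_Obj: "is_functor C D F \<Longrightarrow> a \<in> Obj C \<Longrightarrow> OMap F a \<in> Obj D"
  by (auto simp: is_functor_def)

text \<open>
  The inverse functor chooses for each object of \<open>D\<close> a preimage up to isomorphism, and for each arrow
  the unique lift of its conjugate by the chosen isomorphisms.
\<close>

lemma equivalent_categories_if_full_faithful_ess_surj: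
  assumes F: "is_functor C D F"
    and full: "\<And>a b g. a \<in> Obj C \<Longrightarrow> b \<in> Obj C \<Longrightarrow> g \<in> Hom D (OMap F a) (OMap F b) \<Longrightarrow>
      \<exists>f\<in>Hom C a b. AMap F f = g"
    and faithful: "\<And>a b f f'. f \<in> Hom C a b \<Longrightarrow> f' \<in> Hom C a b \<Longrightarrow> AMap F f = AMap F f' \<Longrightarrow> f = f'"
    and ess_surj: "\<And>d. d \<in> Obj D \<Longrightarrow> \<exists>c\<in>Obj C. \<exists>i. is_iso D (OMap F c) d i"
  shows "equivalent_categories C D"
proof -
  interpret C: category C using F by (simp add: is_functor_def)
  interpret D: category D using F by (simp add: is_functor_def)
  obtain R where R: "\<And>d. d \<in> Obj D \<Longrightarrow> R d \<in> Obj C \<and> (\<exists>i. is_iso D (OMap F (R d)) d i)"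
    using ess_surj by metis
  then obtain e where e: "\<And>d. d \<in> Obj D \<Longrightarrow> is_iso D (OMap F (R d)) d (e d)" by metis
  then have e_hom: "\<And>d. d \<in> Obj D \<Longrightarrow> e d \<in> Hom D (OMap F (R d)) d" by (simp add: is_iso_def)
  from e obtain e' where e'_hom: "\<And>d. d \<in> Obj D \<Longrightarrow> e' d \<in> Hom D d (OMap F (R d))"
    and e'e: "\<And>d. d \<in> Obj D \<Longrightarrow> Comp D (e' d) (e d) = Ide D (OMap F (R d))"
    and ee': "\<And>d. d \<in> Obj D \<Longrightarrow> Comp D (e d) (e' d) = Ide D d"
    unfolding is_iso_def by metis
  have RO: "R d \<in> Obj C" if "d \<in> Obj D" for d using R that by blast
  note FO = is_functor_Obj[OF F] and FH = is_functor_Hom[OF F]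
  \<comment> \<open>the inverse functor conjugates an arrow by the chosen isomorphisms and lifts it along \<open>F\<close>\<close>
  define conj where "conj g = Comp D (e' (Cod D g)) (Comp D g (e (Dom D g)))" for g
  have conj_hom: "conj g \<in> Hom D (OMap F (R a)) (OMap F (R b))"
    if g: "g \<in> Hom D a b" for g a b
  proof -
    have ab: "a \<in> Obj D" "b \<in> Obj D" using g D.dom_obj D.cod_obj by (auto simp: Hom_def)
    show ?thesis unfolding conj_def HomD(2,3)[OF g]
      by (rule D.comp_hom[OF D.comp_hom[OF e_hom[OF ab(1)] g] e'_hom[OF ab(2)]])
  qed
  have e_conj: "Comp D (e b) (conj g) = Comp D g (e a)" if g: "g \<in> Hom D a b" for g a b
  proof -
    have ab: "a \<in> Obj D" "b \<in> Obj D" using g D.dom_obj D.cod_obj by (auto simp: Hom_def)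
    have ge: "Comp D g (e a) \<in> Hom D (OMap F (R a)) b" by (rule D.comp_hom[OF e_hom[OF ab(1)] g])
    show ?thesis unfolding conj_def HomD(2,3)[OF g]
      using D.comp_assoc[OF ge e'_hom[OF ab(2)] e_hom[OF ab(2)]] ee'[OF ab(2)]
        D.comp_ide_left[OF ge] by simp
  qed
  have conj_unique: "h = conj g" if g: "g \<in> Hom D a b"
    and h: "h \<in> Hom D (OMap F (R a)) (OMap F (R b))" "Comp D (e b) h = Comp D g (e a)" for g h a b
  proof -
    have ab: "a \<in> Obj D" "b \<in> Obj D" using g D.dom_obj D.cod_obj by (auto simp: Hom_def)
    have "h = Comp D (Comp D (e' b) (e b)) h" by (simp add: e'e ab D.comp_ide_left[OF h(1)])
    also have "\<dots> = Comp D (e' b) (Comp D (e b) h)"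
      by (rule D.comp_assoc[OF h(1) e_hom e'_hom, symmetric]) (use ab in auto)
    finally show ?thesis unfolding conj_def h(2) HomD(2,3)[OF g] .
  qed
  have "\<exists>f. g \<in> Arr D \<longrightarrow> f \<in> Hom C (R (Dom D g)) (R (Cod D g)) \<and> AMap F f = conj g" for g
    using full[OF RO RO conj_hom, of "Dom D g" "Cod D g" g] D.dom_obj[of g] D.cod_obj[of g]
    by (auto simp: Hom_def)
  then obtain L where L: "\<And>g. g \<in> Arr D \<Longrightarrow> L g \<in> Hom C (R (Dom D g)) (R (Cod D g))"
    "\<And>g. g \<in> Arr D \<Longrightarrow> AMap F (L g) = conj g" by metis
  have LH: "L g \<in> Hom C (R a) (R b)" "AMap F (L g) = conj g" if "g \<in> Hom D a b" for g a b
    using L[of g] that by (auto simp: Hom_def)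
  have L_unique: "L g = f" if "g \<in> Hom D a b" "f \<in> Hom C (R a) (R b)"
    "Comp D (e b) (AMap F f) = Comp D g (e a)" for g f a b
    by (rule faithful[OF LH(1)[OF that(1)] that(2)])
      (simp add: LH(2)[OF that(1)] conj_unique[OF that(1) FH[OF that(2)] that(3)])
  define G where "G = \<lparr>OMap = restrict R (Obj D), AMap = restrict L (Arr D)\<rparr>"
  have G: "is_functor D C G"
    unfolding is_functor_def
  proof (intro conjI ballI impI)
    fix a assume a: "a \<in> Obj D"
    have "L (Ide D a) = Ide C (R a)"
    proof (rule L_unique[OF D.ide_hom[OF a] C.ide_hom[OF RO[OF a]]])
      show "Comp D (e a) (AMap F (Ide C (R a))) = Comp D (Ide D a) (e a)"
        using a RO[OF a] by (simp add: is_functor_Ide[OF F] D.comp_ide_right[OF e_hom]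
            D.comp_ide_left[OF e_hom])
    qed
    then show "AMap G (Ide D a) = Ide C (OMap G a)"
      using a D.ide_hom[OF a] by (simp add: G_def Hom_def)
  next
    fix f g assume fg: "f \<in> Arr D" "g \<in> Arr D" "Cod D f = Dom D g"
    let ?a = "Dom D f" and ?b = "Dom D g" and ?c = "Cod D g"
    have f: "f \<in> Hom D ?a ?b" and g: "g \<in> Hom D ?b ?c" using fg by (auto simp: Hom_def)
    have ob: "?a \<in> Obj D" "?b \<in> Obj D" "?c \<in> Obj D" using fg D.dom_obj D.cod_obj by auto
    have "L (Comp D g f) = Comp C (L g) (L f)"
    proof (rule L_unique[OF D.comp_hom[OF f g] C.comp_hom[OF LH(1)[OF f] LH(1)[OF g]]])
      have "Comp D (e ?c) (AMap F (Comp C (L g) (L f))) =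
          Comp D (e ?c) (Comp D (conj g) (conj f))"
        by (simp add: is_functor_Comp[OF F LH(1)[OF f] LH(1)[OF g]] LH(2)[OF f] LH(2)[OF g])
      also have "\<dots> = Comp D (Comp D g (e ?b)) (conj f)"
        by (simp add: D.comp_assoc[OF conj_hom[OF f] conj_hom[OF g] e_hom[OF ob(3)]] e_conj[OF g])
      also have "\<dots> = Comp D g (Comp D f (e ?a))"
        by (simp add: D.comp_assoc[OF conj_hom[OF f] e_hom[OF ob(2)] g, symmetric] e_conj[OF f])
      also have "\<dots> = Comp D (Comp D g f) (e ?a)"
        by (rule D.comp_assoc[OF e_hom[OF ob(1)] f g])
      finally show "Comp D (e ?c) (AMap F (Comp C (L g) (L f))) = Comp D (Comp D g f) (e ?a)" .
    qed
    then show "AMap G (Comp D g f) = Comp C (AMap G g) (AMap G f)"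
      using fg D.comp_hom[OF f g] by (simp add: G_def Hom_def)
  qed (use C.category_axioms D.category_axioms L RO D.dom_obj D.cod_obj in
      \<open>auto simp: G_def Hom_def\<close>)
  have FG: "naturally_isomorphic D D (comp_ftr D F G) (id_ftr D)"
    unfolding naturally_isomorphic_def
  proof (intro exI[of _ e] conjI ballI)
    fix a assume "a \<in> Obj D"
    then show "is_iso D (OMap (comp_ftr D F G) a) (OMap (id_ftr D) a) (e a)"
      by (simp add: comp_ftr_def id_ftr_def compose_def G_def e)
  next
    fix f assume f: "f \<in> Arr D"
    then show "Comp D (e (Cod D f)) (AMap (comp_ftr D F G) f) =
        Comp D (AMap (id_ftr D) f) (e (Dom D f))"
      using e_conj[OF HomI[OF f HOL.refl HOL.refl]] by (simp add: comp_ftr_def id_ftr_def compose_def G_def L)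
  qed
  \<comment> \<open>the unit is the lift along \<open>F\<close> of the counit at \<open>F a\<close>\<close>
  have "\<exists>u. a \<in> Obj C \<longrightarrow> u \<in> Hom C (R (OMap F a)) a \<and> AMap F u = e (OMap F a)" for a
    using full[OF RO[OF FO] _ e_hom[OF FO]] by blast
  then obtain u where u: "\<And>a. a \<in> Obj C \<Longrightarrow> u a \<in> Hom C (R (OMap F a)) a"
    "\<And>a. a \<in> Obj C \<Longrightarrow> AMap F (u a) = e (OMap F a)" by metis
  have GF: "naturally_isomorphic C C (comp_ftr C G F) (id_ftr C)"
    unfolding naturally_isomorphic_def
  proof (intro exI[of _ u] conjI ballI)
    fix a assume a: "a \<in> Obj C"
    note Fa = FO[OF a]
    obtain v where v: "v \<in> Hom C a (R (OMap F a))" "AMap F v = e' (OMap F a)"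
      using full[OF a RO[OF Fa] e'_hom[OF Fa]] by blast
    have "Comp C v (u a) = Ide C (R (OMap F a))"
      by (rule faithful[OF C.comp_hom[OF u(1)[OF a] v(1)] C.ide_hom[OF RO[OF Fa]]])
        (simp add: is_functor_Comp[OF F u(1)[OF a] v(1)] u v e'e Fa a is_functor_Ide[OF F] RO)
    moreover have "Comp C (u a) v = Ide C a"
      by (rule faithful[OF C.comp_hom[OF v(1) u(1)[OF a]] C.ide_hom[OF a]])
        (simp add: is_functor_Comp[OF F v(1) u(1)[OF a]] u v ee' Fa a is_functor_Ide[OF F])
    ultimately show "is_iso C (OMap (comp_ftr C G F) a) (OMap (id_ftr C) a) (u a)"
      using a Fa u v by (auto simp: is_iso_def comp_ftr_def id_ftr_def compose_def G_def)
  next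
    fix f assume f': "f \<in> Arr C"
    let ?a = "Dom C f" and ?b = "Cod C f"
    have f: "f \<in> Hom C ?a ?b" using f' by (simp add: Hom_def)
    have ab: "?a \<in> Obj C" "?b \<in> Obj C" using f' C.dom_obj C.cod_obj by auto
    note Lf = LH[OF FH[OF f]]
    have "Comp C (u ?b) (L (AMap F f)) = Comp C f (u ?a)"
    proof (rule faithful[OF C.comp_hom[OF Lf(1) u(1)[OF ab(2)]] C.comp_hom[OF u(1)[OF ab(1)] f]])
      show "AMap F (Comp C (u ?b) (L (AMap F f))) = AMap F (Comp C f (u ?a))"
        by (simp add: is_functor_Comp[OF F Lf(1) u(1)[OF ab(2)]]
            is_functor_Comp[OF F u(1)[OF ab(1)] f] Lf(2) u(2) ab e_conj[OF FH[OF f]])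
    qed
    then show "Comp C (u ?b) (AMap (comp_ftr C G F) f) = Comp C (AMap (id_ftr C) f) (u ?a)"
      using f' FH[OF f] by (simp add: comp_ftr_def id_ftr_def compose_def G_def Hom_def)
  qed
  show ?thesis
    unfolding equivalent_categories_def
    using F G FG GF C.category_axioms D.category_axioms by blast
qed

section \<open>Substitution and metasubstitution of terms\<close>

lemma trm_induct [case_names Var MVar Op]:
  assumes "\<And>i. P (Var i)"
    and "\<And>i ts. (\<And>t. t \<in> set ts \<Longrightarrow> P t) \<Longrightarrow> P (MVar i ts)"
    and "\<And>\<omega> as. (\<And>k t. (k, t) \<in> set as \<Longrightarrow> P t) \<Longrightarrow> P (Op \<omega> as)"
  shows "P t"
proof (induction t)
  case (Op \<omega> as)
  then show ?case by (intro assms(3)) force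
qed (use assms in auto)

text \<open>
  The renaming, respectively substitution, that acts under a binder of \<open>k\<close> variables. Naming these
  functions allows the composition laws below to be reduced to equations between them.
\<close>

definition lift_ren :: "nat \<Rightarrow> (nat \<Rightarrow> nat) \<Rightarrow> nat \<Rightarrow> nat" where
  "lift_ren k \<rho> = (\<lambda>i. if i < k then i else \<rho> (i - k) + k)"

definition lift :: "nat \<Rightarrow> (nat \<Rightarrow> 'u trm) \<Rightarrow> nat \<Rightarrow> 'u trm" where
  "lift k \<sigma> = (\<lambda>i. if i < k then Var i else rename (\<lambda>j. j + k) (\<sigma> (i - k)))"

lemma rename_Op: "rename \<rho> (Op \<omega> as) = Op \<omega> (map (\<lambda>(k, t). (k, rename (lift_ren k \<rho>) t)) as)"
  by (simp add: lift_ren_def)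

lemma subst_Op: "subst \<sigma> (Op \<omega> as) = Op \<omega> (map (\<lambda>(k, t). (k, subst (lift k \<sigma>) t)) as)"
  by (simp add: lift_def)

declare rename.simps(3) [simp del] subst.simps(3) [simp del]
declare rename_Op [simp] subst_Op [simp]

lemma lift_Var_ren: "lift k (\<lambda>i. Var (\<rho> i)) = (\<lambda>i. Var (lift_ren k \<rho> i))"
  by (auto simp: lift_def lift_ren_def fun_eq_iff)

lemma lift_Var: "lift k Var = Var"
  by (auto simp: lift_def fun_eq_iff)

lemma rename_as_subst: "rename \<rho> t = subst (\<lambda>i. Var (\<rho> i)) t"
proof (induction t arbitrary: \<rho> rule: trm_induct)
  case (Op \<omega> as)
  then show ?case by (auto simp: lift_Var_ren)
qed auto

lemma subst_Var_id [simp]: "subst Var t = t"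
  by (induction t rule: trm_induct) (auto simp: lift_Var intro!: map_idI)

lemma subst_rename: "subst \<sigma> (rename \<rho> t) = subst (\<lambda>i. \<sigma> (\<rho> i)) t"
proof (induction t arbitrary: \<rho> \<sigma> rule: trm_induct)
  case (Op \<omega> as)
  have "(\<lambda>i. lift k \<sigma> (lift_ren k \<rho> i)) = lift k (\<lambda>i. \<sigma> (\<rho> i))" for k
    by (auto simp: lift_def lift_ren_def fun_eq_iff)
  then show ?case using Op by auto
qed auto

lemma rename_rename: "rename \<rho>' (rename \<rho> t) = rename (\<lambda>i. \<rho>' (\<rho> i)) t"
  by (simp add: rename_as_subst[of \<rho>'] subst_rename) (simp add: rename_as_subst)

lemma rename_subst: "rename \<rho> (subst \<sigma> t) = subst (\<lambda>i. rename \<rho> (\<sigma> i)) t"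
proof (induction t arbitrary: \<rho> \<sigma> rule: trm_induct)
  case (Op \<omega> as)
  have "(\<lambda>i. rename (lift_ren k \<rho>) (lift k \<sigma> i)) = lift k (\<lambda>i. rename \<rho> (\<sigma> i))" for k
    by (auto simp: lift_def lift_ren_def fun_eq_iff rename_rename)
  then show ?case using Op by auto
qed auto

lemma subst_subst: "subst \<sigma>' (subst \<sigma> t) = subst (\<lambda>i. subst \<sigma>' (\<sigma> i)) t"
proof (induction t arbitrary: \<sigma>' \<sigma> rule: trm_induct)
  case (Op \<omega> as)
  have "(\<lambda>i. subst (lift k \<sigma>') (lift k \<sigma> i)) = lift k (\<lambda>i. subst \<sigma>' (\<sigma> i))" for k
    by (auto simp: lift_def fun_eq_iff rename_subst subst_rename)
  then show ?case using Op by auto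
qed auto

lemma is_trm_Var [simp]: "is_trm \<Sigma> \<Theta> n (Var i) \<longleftrightarrow> i < n"
  by (subst is_trm.simps) auto

lemma is_trm_MVar [simp]:
  "is_trm \<Sigma> \<Theta> n (MVar i ts) \<longleftrightarrow>
     i < length \<Theta> \<and> length ts = \<Theta> ! i \<and> (\<forall>t\<in>set ts. is_trm \<Sigma> \<Theta> n t)"
  by (subst is_trm.simps) auto

lemma is_trm_Op:
  "is_trm \<Sigma> \<Theta> n (Op \<omega> as) \<longleftrightarrow>
     \<Sigma> \<omega> = Some (map fst as) \<and> (\<forall>(k, t)\<in>set as. is_trm \<Sigma> \<Theta> (k + n) t)"
  by (subst is_trm.simps) auto

lemma is_trm_mono: "is_trm \<Sigma> \<Theta> n t \<Longrightarrow> n \<le> n' \<Longrightarrow> is_trm \<Sigma> \<Theta> n' t"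
proof (induction arbitrary: n' rule: is_trm.induct)
  case (op \<omega> as n)
  then show ?case by (auto simp: is_trm_Op)
qed auto

lemma is_trm_append: "is_trm \<Sigma> \<Theta> n t \<Longrightarrow> is_trm \<Sigma> (\<Theta> @ \<Theta>') n t"
  by (induction rule: is_trm.induct) (auto simp: nth_append is_trm_Op)

lemma elementary_is_trm: "elementary \<Theta> n t \<Longrightarrow> is_trm \<Sigma> \<Theta> n t"
  by (induction rule: is_trm.induct) auto

lemma is_trm_subst:
  "is_trm \<Sigma> \<Theta> n t \<Longrightarrow> (\<And>i. i < n \<Longrightarrow> is_trm \<Sigma> \<Theta> n' (\<sigma> i)) \<Longrightarrow> is_trm \<Sigma> \<Theta> n' (subst \<sigma> t)"
proof -
  have ren: "is_trm \<Sigma> \<Theta> n t \<Longrightarrow> (\<And>i. i < n \<Longrightarrow> \<rho> i < n') \<Longrightarrow> is_trm \<Sigma> \<Theta> n' (rename \<rho> t)"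
    for n n' t \<rho>
  proof (induction arbitrary: n' \<rho> rule: is_trm.induct)
    case (op \<omega> as n)
    have "is_trm \<Sigma> \<Theta> (k + n') (rename (lift_ren k \<rho>) t)" if "(k, t) \<in> set as" for k t
      using op.IH[OF that, of "lift_ren k \<rho>" "k + n'"] op.prems
      by (auto simp: lift_ren_def add.commute)
    then show ?case using op.hyps by (auto simp: is_trm_Op)
  qed auto
  show "is_trm \<Sigma> \<Theta> n t \<Longrightarrow> (\<And>i. i < n \<Longrightarrow> is_trm \<Sigma> \<Theta> n' (\<sigma> i)) \<Longrightarrow> is_trm \<Sigma> \<Theta> n' (subst \<sigma> t)"
  proof (induction arbitrary: n' \<sigma> rule: is_trm.induct)
    case (op \<omega> as n)
    have "is_trm \<Sigma> \<Theta> (k + n') (subst (lift k \<sigma>) t)" if "(k, t) \<in> set as" for k t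
    proof (rule op.IH[OF that])
      show "is_trm \<Sigma> \<Theta> (k + n') (lift k \<sigma> i)" if "i < k + n" for i
        using op.prems[of "i - k"] that by (auto simp: lift_def intro!: ren[of n'])
    qed
    then show ?case using op.hyps by (auto simp: is_trm_Op)
  qed auto
qed

lemma is_trm_rename:
  "is_trm \<Sigma> \<Theta> n t \<Longrightarrow> (\<And>i. i < n \<Longrightarrow> \<rho> i < n') \<Longrightarrow> is_trm \<Sigma> \<Theta> n' (rename \<rho> t)"
  unfolding rename_as_subst by (rule is_trm_subst) auto

lemma subst_cong:
  "is_trm \<Sigma> \<Theta> n t \<Longrightarrow> (\<And>i. i < n \<Longrightarrow> \<sigma> i = \<sigma>' i) \<Longrightarrow> subst \<sigma> t = subst \<sigma>' t"
proof (induction arbitrary: \<sigma> \<sigma>' rule: is_trm.induct)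
  case (mvar i ts n)
  have "subst \<sigma> t = subst \<sigma>' t" if "t \<in> set ts" for t
    using mvar.IH[OF that] mvar.prems by blast
  then show ?case by simp
next
  case (op \<omega> as n)
  have "subst (lift k \<sigma>) t = subst (lift k \<sigma>') t" if "(k, t) \<in> set as" for k t
    by (rule op.IH[OF that]) (use op.prems in \<open>auto simp: lift_def\<close>)
  then show ?case by auto
qed simp

lemma subst_id: "is_trm \<Sigma> \<Theta> n t \<Longrightarrow> (\<And>i. i < n \<Longrightarrow> \<sigma> i = Var i) \<Longrightarrow> subst \<sigma> t = t"
proof -
  assume "is_trm \<Sigma> \<Theta> n t" "\<And>i. i < n \<Longrightarrow> \<sigma> i = Var i"
  then have "subst \<sigma> t = subst Var t" by (rule subst_cong)
  then show ?thesis by simp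
qed

lemma rename_id: "is_trm \<Sigma> \<Theta> n t \<Longrightarrow> (\<And>i. i < n \<Longrightarrow> \<rho> i = i) \<Longrightarrow> rename \<rho> t = t"
  unfolding rename_as_subst by (rule subst_id) auto

text \<open>
  Metasubstitution takes a term and abstractions over one and the same context, so a substitution
  acting on that context acts on the abstractions too, and fixes their bound variables.
\<close>

fun subst_abs :: "(nat \<Rightarrow> 'u trm) \<Rightarrow> 'u abs \<Rightarrow> 'u abs" where
  "subst_abs \<sigma> (k, t) = (k, subst (lift k \<sigma>) t)"

lemma fst_subst_abs [simp]: "fst (subst_abs \<sigma> a) = fst a"
  by (cases a) simp

lemma fst_shift_abs [simp]: "fst (shift_abs n a) = fst a"
  by (cases a) simp

lemma shift_abs_as_subst_abs: "shift_abs n a = subst_abs (\<lambda>i. Var (i + n)) a"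
proof (cases a)
  case (Pair k t)
  have "lift_ren k (\<lambda>i. i + n) = (\<lambda>i. if i < k then i else i + n)"
    by (auto simp: lift_ren_def)
  then show ?thesis
    using Pair by (simp add: rename_as_subst lift_Var_ren)
qed

lemma subst_abs_subst_abs: "subst_abs \<sigma>' (subst_abs \<sigma> a) = subst_abs (\<lambda>i. subst \<sigma>' (\<sigma> i)) a"
proof (cases a)
  case (Pair k t)
  have "(\<lambda>i. subst (lift k \<sigma>') (lift k \<sigma> i)) = lift k (\<lambda>i. subst \<sigma>' (\<sigma> i))"
    by (auto simp: lift_def fun_eq_iff rename_subst subst_rename)
  then show ?thesis by (simp add: Pair subst_subst)
qed

lemma subst_abs_Var [simp]: "subst_abs Var a = a"
  by (cases a) (simp add: lift_Var)

lemma shift_abs_subst_abs: "shift_abs k (subst_abs \<sigma> a) = subst_abs (lift k \<sigma>) (shift_abs k a)"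
  by (simp add: shift_abs_as_subst_abs subst_abs_subst_abs lift_def rename_as_subst)

lemma shift_abs_shift_abs: "shift_abs k (shift_abs n a) = shift_abs (k + n) a"
  by (simp add: shift_abs_as_subst_abs subst_abs_subst_abs add_ac)

lemma subst_apply_abs:
  assumes "length us = fst a"
  shows "subst \<sigma> (apply_abs a us) = apply_abs (subst_abs \<sigma> a) (map (subst \<sigma>) us)"
proof (cases a)
  case (Pair k t)
  have "subst \<sigma> (if i < k then us ! i else Var (i - k)) =
    subst (\<lambda>i. if i < k then map (subst \<sigma>) us ! i else Var (i - k)) (lift k \<sigma> i)" for i
    using assms by (auto simp: Pair lift_def subst_rename)
  then show ?thesis by (simp add: Pair subst_subst)
qed

lemma shift_abs_id: "is_trm \<Sigma> \<Theta> k t \<Longrightarrow> shift_abs n (k, t) = (k, t)"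
  using rename_id[of \<Sigma> \<Theta> k t "\<lambda>i. if i < k then i else i + n"] by simp

text \<open>\<open>abs_ok \<Sigma> \<Theta> ms d \<theta>\<close>: the abstractions \<open>\<theta>\<close> may replace metavariables of meta-arities \<open>ms\<close>
  in a context with \<open>d\<close> variables.\<close>

definition abs_ok :: "'u signature \<Rightarrow> nat list \<Rightarrow> nat list \<Rightarrow> nat \<Rightarrow> 'u abs list \<Rightarrow> bool" where
  "abs_ok \<Sigma> \<Theta> ms d \<theta> \<longleftrightarrow> map fst \<theta> = ms \<and> (\<forall>(k, t)\<in>set \<theta>. is_trm \<Sigma> \<Theta> (k + d) t)"

lemma abs_ok_length: "abs_ok \<Sigma> \<Theta> ms d \<theta> \<Longrightarrow> length \<theta> = length ms"
  by (auto simp: abs_ok_def)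

lemma abs_ok_nth: "abs_ok \<Sigma> \<Theta> ms d \<theta> \<Longrightarrow> i < length ms \<Longrightarrow>
    \<exists>t. \<theta> ! i = (ms ! i, t) \<and> is_trm \<Sigma> \<Theta> (ms ! i + d) t"
proof -
  assume ok: "abs_ok \<Sigma> \<Theta> ms d \<theta>" and i: "i < length ms"
  then have "\<theta> ! i \<in> set \<theta>" "fst (\<theta> ! i) = ms ! i" by (auto simp: abs_ok_def)
  then show ?thesis using ok unfolding abs_ok_def by (metis (no_types, lifting) case_prodD prod.collapse)
qed

lemma abs_ok_fst_nth: "abs_ok \<Sigma> \<Theta> ms d \<theta> \<Longrightarrow> i < length ms \<Longrightarrow> fst (\<theta> ! i) = ms ! i"
  using abs_ok_nth by fastforce

lemma abs_ok_zip: "length ts = length ms \<Longrightarrow>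
    (\<And>i. i < length ms \<Longrightarrow> is_trm \<Sigma> \<Theta> (ms ! i + d) (ts ! i)) \<Longrightarrow> abs_ok \<Sigma> \<Theta> ms d (zip ms ts)"
  by (auto simp: abs_ok_def in_set_zip)

lemma abs_ok_zip_list_all2: "list_all2 (is_trm \<Sigma> \<Theta>) ms ss \<Longrightarrow> abs_ok \<Sigma> \<Theta> ms d (zip ms ss)"
  by (rule abs_ok_zip) (auto simp: list_all2_conv_all_nth intro: is_trm_mono[OF _ le_add1])

lemma abs_ok_shift: "abs_ok \<Sigma> \<Theta> ms d \<theta> \<Longrightarrow> abs_ok \<Sigma> \<Theta> ms (n + d) (map (shift_abs n) \<theta>)"
proof -
  assume ok: "abs_ok \<Sigma> \<Theta> ms d \<theta>"
  have "is_trm \<Sigma> \<Theta> (k + (n + d)) (rename (\<lambda>i. if i < k then i else i + n) t)"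
    if "(k, t) \<in> set \<theta>" for k t
    by (rule is_trm_rename[of _ _ "k + d"]) (use ok that in \<open>auto simp: abs_ok_def\<close>)
  then show ?thesis using ok by (auto simp: abs_ok_def)
qed

lemma is_trm_apply_abs:
  assumes "is_trm \<Sigma> \<Theta> (k + n) t" "length us = k" "\<And>u. u \<in> set us \<Longrightarrow> is_trm \<Sigma> \<Theta> n u"
  shows "is_trm \<Sigma> \<Theta> n (apply_abs (k, t) us)"
  using assms by (auto intro!: is_trm_subst)

lemma is_trm_msubst:
  "is_trm \<Sigma> ms n t \<Longrightarrow> abs_ok \<Sigma> \<Theta> ms n \<theta> \<Longrightarrow> is_trm \<Sigma> \<Theta> n (msubst \<theta> t)"
proof (induction arbitrary: \<theta> rule: is_trm.induct)
  case (mvar i ts n)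
  then obtain t where "\<theta> ! i = (ms ! i, t)" "is_trm \<Sigma> \<Theta> (ms ! i + n) t"
    using abs_ok_nth by blast
  then show ?case using mvar by (auto simp del: apply_abs.simps intro!: is_trm_apply_abs)
next
  case (op \<omega> as n)
  have "is_trm \<Sigma> \<Theta> (k + n) (msubst (map (shift_abs k) \<theta>) t)" if "(k, t) \<in> set as" for k t
    using op.IH[OF that abs_ok_shift[OF op.prems]] .
  then show ?case using op.hyps by (auto simp: is_trm_Op)
qed auto

text \<open>
  Metasubstitution into a renamed term, and below into a substituted term, can be postponed past
  the renaming. The hypothesis says that \<open>\<theta>\<close> is \<open>\<theta>'\<close> carried along the renaming;
  in this form it persists under binders, where both sides are shifted. The case of renamings comes
  first since a substitution is renamed when it passes a binder.
\<close>

lemma msubst_rename: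
  assumes "is_trm \<Sigma> ms n t" "\<And>i. i < length ms \<Longrightarrow> fst (\<theta>' ! i) = ms ! i"
    "\<And>i. i < length ms \<Longrightarrow> \<theta> ! i = subst_abs (\<lambda>j. Var (\<rho> j)) (\<theta>' ! i)"
    "length \<theta> = length ms" "length \<theta>' = length ms"
  shows "msubst \<theta> (rename \<rho> t) = rename \<rho> (msubst \<theta>' t)"
  using assms
proof (induction arbitrary: \<rho> \<theta> \<theta>' rule: is_trm.induct)
  case (mvar i ts n)
  have "msubst \<theta> (rename \<rho> t) = rename \<rho> (msubst \<theta>' t)" if "t \<in> set ts" for t
    using mvar.IH[OF that mvar.prems] .
  then have "map (msubst \<theta>) (map (rename \<rho>) ts) = map (rename \<rho>) (map (msubst \<theta>') ts)"
    by simp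
  moreover have "rename \<rho> (apply_abs (\<theta>' ! i) (map (msubst \<theta>') ts)) =
      apply_abs (\<theta> ! i) (map (rename \<rho>) (map (msubst \<theta>') ts))"
    using mvar.hyps mvar.prems(1,2)[OF mvar.hyps(1)]
    by (simp only: rename_as_subst subst_apply_abs length_map)
      (simp add: rename_as_subst[abs_def])
  ultimately show ?case by (simp only: rename.simps(2) subst.simps(2) msubst.simps(2))
next
  case (op \<omega> as n)
  have "msubst (map (shift_abs k) \<theta>) (rename (lift_ren k \<rho>) t) =
    rename (lift_ren k \<rho>) (msubst (map (shift_abs k) \<theta>') t)" if "(k, t) \<in> set as" for k t
  proof (rule op.IH[OF that])
    fix i assume "i < length ms"
    then show "map (shift_abs k) \<theta> ! i =
        subst_abs (\<lambda>j. Var (lift_ren k \<rho> j)) (map (shift_abs k) \<theta>' ! i)"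
      using op.prems by (simp add: shift_abs_subst_abs lift_Var_ren)
  qed (use op.prems in simp_all)
  then show ?case by auto
qed auto

lemma msubst_subst:
  assumes "is_trm \<Sigma> ms n t" "\<And>i. i < length ms \<Longrightarrow> fst (\<theta>' ! i) = ms ! i"
    "\<And>i. i < length ms \<Longrightarrow> \<theta> ! i = subst_abs \<sigma>' (\<theta>' ! i)"
    "length \<theta> = length ms" "length \<theta>' = length ms"
    "\<And>i. i < n \<Longrightarrow> \<sigma>' i = msubst \<theta> (\<sigma> i)" "\<And>i. i < n \<Longrightarrow> is_trm \<Sigma> ms m (\<sigma> i)"
  shows "msubst \<theta> (subst \<sigma> t) = subst \<sigma>' (msubst \<theta>' t)"
  using assms
proof (induction arbitrary: \<sigma> \<sigma>' \<theta> \<theta>' m rule: is_trm.induct)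
  case (mvar i ts n)
  have "msubst \<theta> (subst \<sigma> t) = subst \<sigma>' (msubst \<theta>' t)" if "t \<in> set ts" for t
    using mvar.IH[OF that mvar.prems] .
  then have "map (msubst \<theta>) (map (subst \<sigma>) ts) = map (subst \<sigma>') (map (msubst \<theta>') ts)"
    by simp
  moreover have "subst \<sigma>' (apply_abs (\<theta>' ! i) (map (msubst \<theta>') ts)) =
      apply_abs (\<theta> ! i) (map (subst \<sigma>') (map (msubst \<theta>') ts))"
    using mvar.hyps mvar.prems(1,2)[OF mvar.hyps(1)] by (simp only: subst_apply_abs length_map)
  ultimately show ?case by (simp only: rename.simps(2) subst.simps(2) msubst.simps(2))
next
  case (op \<omega> as n)
  have "msubst (map (shift_abs k) \<theta>) (subst (lift k \<sigma>) t) =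
    subst (lift k \<sigma>') (msubst (map (shift_abs k) \<theta>') t)" if "(k, t) \<in> set as" for k t
  proof (rule op.IH[OF that])
    fix i assume i: "i < k + n"
    show "is_trm \<Sigma> ms (k + m) (lift k \<sigma> i)"
      using op.prems(6)[of "i - k"] i by (auto simp: lift_def intro!: is_trm_rename[of _ _ m])
    show "lift k \<sigma>' i = msubst (map (shift_abs k) \<theta>) (lift k \<sigma> i)"
    proof (cases "i < k")
      case False
      then have "i - k < n" using i by simp
      then show ?thesis
        using False op.prems msubst_rename[OF op.prems(6), of "i - k" \<theta> "map (shift_abs k) \<theta>" "\<lambda>i. i + k"]
        by (simp add: lift_def shift_abs_as_subst_abs)
    qed (simp add: lift_def)
  qed (use op.prems in \<open>simp_all add: shift_abs_subst_abs\<close>)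
  then show ?case by auto
qed auto

text \<open>
  This is the associativity of composition in categories of terms. At a metavariable the inner
  metasubstitution turns into a substitution, which is then exchanged with the outer one by
  \<open>msubst_subst\<close>.
\<close>

lemma msubst_msubst:
  assumes "is_trm \<Sigma> ls n t" "abs_ok \<Sigma> ms ls n \<phi>" "abs_ok \<Sigma> \<Theta> ms n \<theta>"
  shows "msubst \<theta> (msubst \<phi> t) =
    msubst (map (\<lambda>(k, s). (k, msubst (map (shift_abs k) \<theta>) s)) \<phi>) t"
  using assms
proof (induction arbitrary: \<phi> \<theta> rule: is_trm.induct)
  case (mvar i ts n)
  then obtain s where s: "\<phi> ! i = (ls ! i, s)" "is_trm \<Sigma> ms (ls ! i + n) s"
    using abs_ok_nth by blast
  let ?k = "ls ! i" let ?us = "map (msubst \<phi>) ts"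
  have *: "msubst \<theta> (subst (\<lambda>i. if i < ?k then ?us ! i else Var (i - ?k)) s) =
    subst (\<lambda>i. if i < ?k then map (msubst \<theta>) ?us ! i else Var (i - ?k))
      (msubst (map (shift_abs ?k) \<theta>) s)"
  proof (rule msubst_subst[OF s(2), of _ _ _ _ n])
    fix i assume "i < length ms"
    then show "\<theta> ! i = subst_abs
        (\<lambda>j. if j < ?k then map (msubst \<theta>) ?us ! j else Var (j - ?k)) (map (shift_abs ?k) \<theta> ! i)"
      using mvar.prems by (simp add: abs_ok_length shift_abs_as_subst_abs subst_abs_subst_abs)
  next
    fix i assume "i < ?k + n"
    then show "is_trm \<Sigma> ms n (if i < ?k then ?us ! i else Var (i - ?k))"
      using mvar by (auto intro!: is_trm_msubst)
  qed (use mvar in \<open>auto simp: abs_ok_length abs_ok_fst_nth\<close>)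
  have "msubst \<theta> (msubst \<phi> t) =
      msubst (map (\<lambda>(k, s). (k, msubst (map (shift_abs k) \<theta>) s)) \<phi>) t" if "t \<in> set ts" for t
    using mvar.IH[OF that mvar.prems] .
  then have us: "map (msubst \<theta>) ?us =
      map (msubst (map (\<lambda>(k, s). (k, msubst (map (shift_abs k) \<theta>) s)) \<phi>)) ts"
    by simp
  show ?case
    using * s(1) mvar.hyps(1) abs_ok_length[OF mvar.prems(1)] unfolding us by simp
next
  case (op \<omega> as n)
  have "msubst (map (shift_abs k) \<theta>) (msubst (map (shift_abs k) \<phi>) t) =
    msubst (map (shift_abs k) (map (\<lambda>(k, s). (k, msubst (map (shift_abs k) \<theta>) s)) \<phi>)) t"
    if kt: "(k, t) \<in> set as" for k t
  proof -
    \<comment> \<open>shifting the abstractions of \<open>\<phi>\<close> past the binder commutes with metasubstituting into them\<close>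
    have "(\<lambda>(k', s). (k', msubst (map (shift_abs k') (map (shift_abs k) \<theta>)) s)) (shift_abs k (l, s)) =
      shift_abs k ((\<lambda>(k, s). (k, msubst (map (shift_abs k) \<theta>) s)) (l, s))" if "(l, s) \<in> set \<phi>" for l s
    proof -
      have *: "is_trm \<Sigma> ms (l + n) s" using op.prems(1) that by (auto simp: abs_ok_def)
      have "msubst (map (shift_abs (l + k)) \<theta>) (rename (\<lambda>i. if i < l then i else i + k) s) =
        rename (\<lambda>i. if i < l then i else i + k) (msubst (map (shift_abs l) \<theta>) s)"
      proof (rule msubst_rename[OF *])
        fix i assume "i < length ms"
        then show "map (shift_abs (l + k)) \<theta> ! i = subst_abs
           (\<lambda>j. Var (if j < l then j else j + k)) (map (shift_abs l) \<theta> ! i)"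
          using op.prems
          by (simp add: shift_abs_as_subst_abs subst_abs_subst_abs abs_ok_length add_ac)
      qed (use op.prems in \<open>auto simp: abs_ok_length abs_ok_fst_nth\<close>)
      then show ?thesis by (simp add: comp_def shift_abs_shift_abs del: shift_abs.simps(1))
         (simp add: comp_def)
    qed
    then have eq: "map (\<lambda>(k', s). (k', msubst (map (shift_abs k') (map (shift_abs k) \<theta>)) s))
        (map (shift_abs k) \<phi>) =
      map (shift_abs k) (map (\<lambda>(k, s). (k, msubst (map (shift_abs k) \<theta>) s)) \<phi>)"
      by (auto simp del: shift_abs.simps)
    show ?thesis
      using op.IH[OF kt abs_ok_shift[OF op.prems(1)] abs_ok_shift[OF op.prems(2)]]
      unfolding eq by simp
  qed
  then show ?case by auto
qed auto

text \<open>
  The generic applications of all metavariables of a context form the identity arrow on it.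
\<close>

definition generics :: "nat list \<Rightarrow> 'u trm list" where
  "generics ms = map (\<lambda>i. generic i (ms ! i)) [0..<length ms]"

lemma length_generics [simp]: "length (generics ms) = length ms"
  by (simp add: generics_def)

lemma nth_generics [simp]: "i < length ms \<Longrightarrow> generics ms ! i = generic i (ms ! i)"
  by (simp add: generics_def)

lemma is_trm_generic: "i < length \<Theta> \<Longrightarrow> m = \<Theta> ! i \<Longrightarrow> m \<le> n \<Longrightarrow> is_trm \<Sigma> \<Theta> n (generic i m)"
  by (auto simp: generic_def)

lemma shift_abs_generic [simp]: "shift_abs k (m, generic i m) = (m, generic i m)"
  by (simp add: generic_def)

lemma trms_generics: "list_all2 (is_trm \<Sigma> ms) ms (generics ms)"
  by (auto simp: list_all2_conv_all_nth is_trm_generic)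

lemma trms_generics_append: "list_all2 (is_trm \<Sigma> (a @ b)) a (generics a)"
  by (auto simp: list_all2_conv_all_nth is_trm_generic nth_append)

lemma trms_Snd:
  "list_all2 (is_trm \<Sigma> (a @ b)) b (map (\<lambda>i. generic (length a + i) (b ! i)) [0..<length b])"
  by (auto simp: list_all2_conv_all_nth is_trm_generic nth_append)

lemma msubst_generics:
  "is_trm \<Sigma> ms n t \<Longrightarrow> map fst \<theta> = ms \<Longrightarrow>
    (\<And>i. i < length ms \<Longrightarrow> snd (\<theta> ! i) = generic i (ms ! i)) \<Longrightarrow> msubst \<theta> t = t"
proof (induction arbitrary: \<theta> rule: is_trm.induct)
  case (mvar i ts n)
  have "\<theta> ! i = (ms ! i, generic i (ms ! i))"
    using mvar.hyps(1) mvar.prems by (metis length_map nth_map prod.collapse)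
  moreover have "msubst \<theta> t = t" if "t \<in> set ts" for t
    using mvar.IH[OF that mvar.prems] .
  then have "map (msubst \<theta>) ts = ts" by (simp add: map_idI)
  ultimately show ?case
    using mvar.hyps(2) by (auto simp: generic_def intro!: nth_equalityI)
next
  case (op \<omega> as n)
  have "msubst (map (shift_abs k) \<theta>) t = t" if "(k, t) \<in> set as" for k t
  proof (rule op.IH[OF that])
    fix i assume i: "i < length ms"
    moreover from i have "\<theta> ! i = (ms ! i, generic i (ms ! i))"
      using op.prems by (metis length_map nth_map prod.collapse)
    ultimately show "snd (map (shift_abs k) \<theta> ! i) = generic i (ms ! i)"
      using length_map[of fst \<theta>] op.prems(1) by (simp del: shift_abs.simps)
  qed (use op.prems in \<open>simp add: comp_def\<close>)
  then show ?case by (auto intro!: map_idI)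
qed auto

lemma msubst_generic:
  assumes "\<theta> ! i = (m, s)" "is_trm \<Sigma> \<Theta> m s"
  shows "msubst \<theta> (generic i m) = s"
  using assms by (auto simp: generic_def intro!: subst_id)

lemma is_trm_translate:
  assumes "is_trm \<Sigma> \<Theta> n t" "is_sig_translation \<Sigma> \<Sigma>' \<tau>"
  shows "is_trm \<Sigma>' \<Theta> n (translate \<tau> t)"
  using assms(1)
proof (induction rule: is_trm.induct)
  case (op \<omega> as n)
  have "is_trm \<Sigma>' (map fst as) 0 (\<tau> \<omega>)"
    using assms(2) op.hyps by (auto simp: is_sig_translation_def)
  moreover have "abs_ok \<Sigma>' \<Theta> (map fst as) n (map (\<lambda>(k, t). (k, translate \<tau> t)) as)"
    using op.IH by (auto simp: abs_ok_def)
  ultimately show ?case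
    by (auto intro!: is_trm_msubst intro: is_trm_mono)
qed auto

lemma derivable_is_trm:
  assumes "derivable \<Sigma> Ax \<Theta> n s t"
    and "\<And>\<Theta> n s t. (\<Theta>, n, s, t) \<in> Ax \<Longrightarrow> is_trm \<Sigma> \<Theta> n s \<and> is_trm \<Sigma> \<Theta> n t"
  shows "is_trm \<Sigma> \<Theta> n s \<and> is_trm \<Sigma> \<Theta> n t"
  using assms(1)
proof (induction rule: derivable.induct)
  case (msubst ms n s t ss ts \<Theta> d)
  then show ?case
    by (auto intro!: is_trm_msubst abs_ok_shift abs_ok_zip intro: is_trm_mono)
qed (use assms(2) in auto)

section \<open>Tuples and generalized elements in a theory\<close>

notation Comp (infixl "\<cdot>\<index>" 70)

text \<open>
  The objects of a theory are the arities, with concatenation as product, and its product projections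
  and evaluation maps are images of elementary arrows. Hence the structure of a theory is accessible
  through the images \<open>E ms ts ns\<close> of tuples of elementary terms.
\<close>

locale second_order_theory =
  fixes T :: "'u alg_theory" (structure)
  assumes alg_theory: "is_alg_theory T"
begin

abbreviation E :: "nat list \<Rightarrow> 'u trm list \<Rightarrow> nat list \<Rightarrow> 'u" where
  "E ms ts ns \<equiv> AMap (Emb T) (ms, ts, ns)"

definition proj :: "nat list \<Rightarrow> nat \<Rightarrow> 'u" where
  "proj ms i = E ms [generic i (ms ! i)] [ms ! i]"

lemma Obj_T [simp]: "a \<in> Obj T"
  using alg_theory by (simp add: is_alg_theory_def arity_cat_def)

lemma OMap_Emb [simp]: "OMap (Emb T) a = a"
  using alg_theory by (simp add: is_alg_theory_def arity_cat_def)

lemma strict_cartesian_Emb: "strict_cartesian_functor \<bbbM> T (Emb T)"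
  using alg_theory by (simp add: is_alg_theory_def)

lemma functor_Emb: "is_functor \<bbbM> T (Emb T)"
  using strict_cartesian_Emb by (simp add: strict_cartesian_functor_def)

lemma cartesian_T: "cartesian T"
  using alg_theory by (simp add: is_alg_theory_def)

sublocale category T
  using cartesian_T by (simp add: cartesian_def)

lemma One_T [simp]: "One T = []"
  using strict_cartesian_Emb by (simp add: strict_cartesian_functor_def arity_cat_def)

lemma Prod_T [simp]: "Prod T a b = a @ b"
  using strict_cartesian_Emb by (simp add: strict_cartesian_functor_def arity_cat_def)

lemma Fst_T: "Fst T a b = E (a @ b) (generics a) a"
  using strict_cartesian_Emb
  by (simp add: strict_cartesian_functor_def arity_cat_def generics_def)

lemma Snd_T: "Snd T a b = E (a @ b) (map (\<lambda>i. generic (length a + i) (b ! i)) [0..<length b]) b"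
  using strict_cartesian_Emb
  by (simp add: strict_cartesian_functor_def arity_cat_def)

lemma E_hom: "list_all2 (elementary ms) ns ts \<Longrightarrow> E ms ts ns \<in> Hom T ms ns"
  using is_functor_Hom[OF functor_Emb, of "(ms, ts, ns)" ms ns]
  by (simp add: Hom_def arity_cat_def)

lemma E_comp:
  "list_all2 (elementary ms) ns ss \<Longrightarrow> list_all2 (elementary ns) ls ts \<Longrightarrow>
    E ns ts ls \<cdot> E ms ss ns = E ms (map (msubst (zip ns ss)) ts) ls"
  using is_functor_Comp[OF functor_Emb, of "(ms, ss, ns)" ms ns "(ns, ts, ls)" ls]
  by (simp add: Hom_def arity_cat_def)

lemma E_ide: "E ms (generics ms) ms = Ide T ms"
  using is_functor_Ide[OF functor_Emb, of ms] by (simp add: arity_cat_def generics_def)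

lemma is_product_T: "is_product T a b (a @ b) (Fst T a b) (Snd T a b)"
  using cartesian_T Obj_T unfolding cartesian_def Prod_T[symmetric] by blast

lemma Fst_hom: "Fst T a b \<in> Hom T (a @ b) a" and Snd_hom: "Snd T a b \<in> Hom T (a @ b) b"
  using is_product_T by (simp_all add: is_product_def)

lemma pair_ex1:
  "f \<in> Hom T c a \<Longrightarrow> g \<in> Hom T c b \<Longrightarrow>
    \<exists>!h. h \<in> Hom T c (a @ b) \<and> Fst T a b \<cdot> h = f \<and> Snd T a b \<cdot> h = g"
  using is_product_T[of a b] by (simp add: is_product_def)

lemma comp_assoc_right: "h \<in> Hom T c d \<Longrightarrow> g \<in> Hom T b c \<Longrightarrow> f \<in> Hom T a b \<Longrightarrow>
    (h \<cdot> g) \<cdot> f = h \<cdot> (g \<cdot> f)"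
  using comp_assoc by auto

lemma proj_hom: "i < length ms \<Longrightarrow> proj ms i \<in> Hom T ms [ms ! i]"
  unfolding proj_def by (rule E_hom) (simp add: is_trm_generic)

lemma proj_E:
  assumes "list_all2 (elementary ms) ns ts" "i < length ns"
  shows "proj ns i \<cdot> E ms ts ns = E ms [ts ! i] [ns ! i]"
  unfolding proj_def using assms
  by (subst E_comp)
    (auto simp: is_trm_generic list_all2_conv_all_nth intro!: arg_cong[where f = "\<lambda>t. E ms [t] _"] msubst_generic)

lemma proj_append1: "i < length a \<Longrightarrow> proj (a @ b) i = proj a i \<cdot> Fst T a b"
  unfolding Fst_T by (subst proj_E)
    (auto simp: list_all2_conv_all_nth is_trm_generic nth_append proj_def)

lemma proj_append2: "i < length b \<Longrightarrow> proj (a @ b) (length a + i) = proj b i \<cdot> Snd T a b"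
  unfolding Snd_T by (subst proj_E)
    (auto simp: list_all2_conv_all_nth is_trm_generic nth_append proj_def)

definition tuple :: "nat list \<Rightarrow> nat list \<Rightarrow> 'u list \<Rightarrow> bool" where
  "tuple c ns fs \<longleftrightarrow> length fs = length ns \<and> (\<forall>i<length ns. fs ! i \<in> Hom T c [ns ! i])"

text \<open>
  As \<open>n # ns\<close> is the product of \<open>[n]\<close> and \<open>ns\<close>, the binary products make every arity
  the product of its entries.
\<close>

lemma tup_ex1:
  "tuple c ns fs \<Longrightarrow> \<exists>!h. h \<in> Hom T c ns \<and> (\<forall>i<length ns. proj ns i \<cdot> h = fs ! i)"
proof (induction ns arbitrary: fs)
  case Nil
  have "is_terminal T []" using cartesian_T by (simp add: cartesian_def)
  then show ?case by (simp add: is_terminal_def)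
next
  case (Cons n ns)
  then obtain f fs' where fs: "fs = f # fs'" by (cases fs) (auto simp: tuple_def)
  have f: "f \<in> Hom T c [n]" and fs': "tuple c ns fs'"
    using Cons.prems unfolding fs tuple_def by (auto simp: All_less_Suc2)
  obtain k where k: "k \<in> Hom T c ns" "\<forall>i<length ns. proj ns i \<cdot> k = fs' ! i"
    and k_uni: "\<And>k'. k' \<in> Hom T c ns \<Longrightarrow> \<forall>i<length ns. proj ns i \<cdot> k' = fs' ! i \<Longrightarrow> k' = k"
    using Cons.IH[OF fs'] by metis
  have p0: "proj (n # ns) 0 = Fst T [n] ns"
    by (simp add: proj_def Fst_T generics_def)
  have pS: "proj (n # ns) (Suc i) \<cdot> h = proj ns i \<cdot> (Snd T [n] ns \<cdot> h)"
    if "i < length ns" "h \<in> Hom T c (n # ns)" for i h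
    using proj_append2[OF that(1), of "[n]"] comp_assoc_right[OF proj_hom[OF that(1)] Snd_hom, of h c "[n]"]
      that(2) by simp
  \<comment> \<open>the components of \<open>h\<close> are its first projection and the components of its second one\<close>
  have *: "h \<in> Hom T c (n # ns) \<and> (\<forall>i<length (n # ns). proj (n # ns) i \<cdot> h = fs ! i) \<longleftrightarrow>
     h \<in> Hom T c ([n] @ ns) \<and> Fst T [n] ns \<cdot> h = f \<and> Snd T [n] ns \<cdot> h = k" for h
  proof (cases "h \<in> Hom T c (n # ns)")
    case True
    then have "Snd T [n] ns \<cdot> h \<in> Hom T c ns" using comp_hom[OF _ Snd_hom, of h c "[n]"] by simp
    then have "(\<forall>i<length ns. proj ns i \<cdot> (Snd T [n] ns \<cdot> h) = fs' ! i) \<longleftrightarrow> Snd T [n] ns \<cdot> h = k"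
      using k(2) by (intro iffI k_uni) simp_all
    then show ?thesis using True by (simp add: All_less_Suc2 p0 pS fs)
  qed simp
  show ?case unfolding * by (rule pair_ex1[OF f k(1)])
qed

definition tup :: "nat list \<Rightarrow> nat list \<Rightarrow> 'u list \<Rightarrow> 'u" where
  "tup c ns fs = (THE h. h \<in> Hom T c ns \<and> (\<forall>i<length ns. proj ns i \<cdot> h = fs ! i))"

lemma tup_hom: "tuple c ns fs \<Longrightarrow> tup c ns fs \<in> Hom T c ns"
  and proj_tup: "tuple c ns fs \<Longrightarrow> i < length ns \<Longrightarrow> proj ns i \<cdot> tup c ns fs = fs ! i"
  using theI'[OF tup_ex1[of c ns fs]] unfolding tup_def by auto

lemma proj_ext:
  assumes h: "h \<in> Hom T c ns" and h': "h' \<in> Hom T c ns"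
    and eq: "\<And>i. i < length ns \<Longrightarrow> proj ns i \<cdot> h = proj ns i \<cdot> h'"
  shows "h = h'"
proof -
  let ?fs = "map (\<lambda>i. proj ns i \<cdot> h) [0..<length ns]"
  have "tuple c ns ?fs"
    by (auto simp: tuple_def intro: comp_hom[OF h proj_hom])
  moreover have "\<forall>i<length ns. proj ns i \<cdot> h = ?fs ! i" "\<forall>i<length ns. proj ns i \<cdot> h' = ?fs ! i"
    using eq by simp_all
  ultimately show ?thesis using tup_ex1[of c ns ?fs] h h' by blast
qed

lemma tup_eqI:
  assumes "h \<in> Hom T c ns" "tuple c ns fs" "\<And>i. i < length ns \<Longrightarrow> proj ns i \<cdot> h = fs ! i"
  shows "tup c ns fs = h"
  by (rule proj_ext[OF tup_hom[OF assms(2)] assms(1)]) (simp add: proj_tup assms)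

lemma tuple_comp: "tuple c ns fs \<Longrightarrow> g \<in> Hom T c' c \<Longrightarrow> tuple c' ns (map (\<lambda>f. f \<cdot> g) fs)"
  by (auto simp: tuple_def intro: comp_hom)

lemma tup_comp:
  assumes "tuple c ns fs" "g \<in> Hom T c' c"
  shows "tup c ns fs \<cdot> g = tup c' ns (map (\<lambda>f. f \<cdot> g) fs)"
proof (rule tup_eqI[symmetric])
  fix i assume i: "i < length ns"
  show "proj ns i \<cdot> (tup c ns fs \<cdot> g) = map (\<lambda>f. f \<cdot> g) fs ! i"
    using comp_assoc_right[OF proj_hom[OF i] tup_hom[OF assms(1)] assms(2)] i assms
    by (simp add: proj_tup tuple_def)
qed (use assms comp_hom[OF assms(2) tup_hom] tuple_comp in auto)

lemma E_as_tup:
  assumes "list_all2 (elementary ms) ns ts"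
  shows "E ms ts ns = tup ms ns (map (\<lambda>i. E ms [ts ! i] [ns ! i]) [0..<length ns])"
proof (rule tup_eqI[symmetric, OF E_hom[OF assms]])
  show "tuple ms ns (map (\<lambda>i. E ms [ts ! i] [ns ! i]) [0..<length ns])"
    using assms by (auto simp: tuple_def list_all2_conv_all_nth intro!: E_hom)
qed (simp add: proj_E assms)

definition pair :: "nat list \<Rightarrow> nat list \<Rightarrow> 'u \<Rightarrow> 'u \<Rightarrow> 'u" where
  "pair a b h v = (THE k. k \<in> Hom T (Dom T h) (a @ b) \<and> Fst T a b \<cdot> k = h \<and> Snd T a b \<cdot> k = v)"

lemma
  assumes "h \<in> Hom T c a" "v \<in> Hom T c b"
  shows pair_hom: "pair a b h v \<in> Hom T c (a @ b)"
    and Fst_pair: "Fst T a b \<cdot> pair a b h v = h"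
    and Snd_pair: "Snd T a b \<cdot> pair a b h v = v"
  using theI'[OF pair_ex1[OF assms]] unfolding pair_def HomD(2)[OF assms(1)] by auto

lemma pair_eqI:
  assumes "k \<in> Hom T c (a @ b)" "Fst T a b \<cdot> k = h" "Snd T a b \<cdot> k = v"
  shows "pair a b h v = k"
proof -
  have h: "h \<in> Hom T c a" and v: "v \<in> Hom T c b"
    using comp_hom[OF assms(1) Fst_hom] comp_hom[OF assms(1) Snd_hom] assms(2,3) by auto
  show ?thesis
    using pair_ex1[OF h v] pair_hom[OF h v] Fst_pair[OF h v] Snd_pair[OF h v] assms by auto
qed

lemma pair_comp:
  assumes "h \<in> Hom T c a" "v \<in> Hom T c b" "g \<in> Hom T c' c"
  shows "pair a b h v \<cdot> g = pair a b (h \<cdot> g) (v \<cdot> g)"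
proof (rule pair_eqI[symmetric])
  note p = pair_hom[OF assms(1,2)]
  show "pair a b h v \<cdot> g \<in> Hom T c' (a @ b)" by (rule comp_hom[OF assms(3) p])
  show "Fst T a b \<cdot> (pair a b h v \<cdot> g) = h \<cdot> g" "Snd T a b \<cdot> (pair a b h v \<cdot> g) = v \<cdot> g"
    using comp_assoc_right[OF Fst_hom p assms(3)] comp_assoc_right[OF Snd_hom p assms(3)] assms
    by (auto simp: Fst_pair Snd_pair)
qed

text \<open>
  An arrow \<open>g : c \<rightarrow> b + d\<close> (every arity of \<open>b\<close> raised by \<open>d\<close>) is a function of \<open>d\<close> further
  arguments. Here it is applied to arguments \<open>v : c \<rightarrow> (0)\<close>, first one and then a list of them.
\<close>

abbreviation raise :: "nat \<Rightarrow> nat list \<Rightarrow> nat list" where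
  "raise d b \<equiv> map (\<lambda>m. m + d) b"

definition app1 :: "nat list \<Rightarrow> 'u \<Rightarrow> 'u \<Rightarrow> 'u" where
  "app1 b g v = AMap (Emb T) (arity_eval b) \<cdot> pair (map Suc b) [0] g v"

fun app :: "nat list \<Rightarrow> 'u \<Rightarrow> 'u list \<Rightarrow> 'u" where
  "app b g [] = g"
| "app b g (v # vs) = app1 b (app (map Suc b) g vs) v"

definition elems :: "nat list \<Rightarrow> nat \<Rightarrow> 'u list set" where
  "elems c n = {vs. length vs = n \<and> set vs \<subseteq> Hom T c [0]}"

lemma elems_length: "vs \<in> elems c n \<Longrightarrow> length vs = n"
  by (simp add: elems_def)

lemma elems_Nil [simp]: "[] \<in> elems c n \<longleftrightarrow> n = 0"
  by (auto simp: elems_def)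

lemma elems_0 [simp]: "vs \<in> elems c 0 \<longleftrightarrow> vs = []"
  by (auto simp: elems_def)

lemma elems_Cons [simp]: "v # vs \<in> elems c (Suc n) \<longleftrightarrow> v \<in> Hom T c [0] \<and> vs \<in> elems c n"
  by (auto simp: elems_def)

lemma elems_append: "us \<in> elems c k \<Longrightarrow> vs \<in> elems c n \<Longrightarrow> us @ vs \<in> elems c (k + n)"
  by (auto simp: elems_def)

lemma elems_nth: "vs \<in> elems c n \<Longrightarrow> i < n \<Longrightarrow> vs ! i \<in> Hom T c [0]"
  by (auto simp: elems_def)

lemma elems_comp: "vs \<in> elems c n \<Longrightarrow> g \<in> Hom T c' c \<Longrightarrow> map (\<lambda>v. v \<cdot> g) vs \<in> elems c' n"
  by (auto simp: elems_def intro: comp_hom)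

lemma elems_Ide: "vs \<in> elems c n \<Longrightarrow> map (\<lambda>v. v \<cdot> Ide T c) vs = vs"
  by (auto simp: elems_def comp_ide_right intro!: map_idI)

lemma elems_comp_comp:
  "vs \<in> elems c n \<Longrightarrow> r \<in> Hom T c' c \<Longrightarrow> q \<in> Hom T c'' c' \<Longrightarrow>
    map (\<lambda>v. v \<cdot> q) (map (\<lambda>v. v \<cdot> r) vs) = map (\<lambda>v. v \<cdot> (r \<cdot> q)) vs"
  by (auto simp: elems_def comp_assoc_right)

lemma eval_hom: "AMap (Emb T) (arity_eval b) \<in> Hom T (map Suc b @ [0]) b"
  unfolding arity_eval_def arity_exp_def
  by (rule E_hom) (auto simp: list_all2_conv_all_nth nth_append)

lemma app1_hom: "g \<in> Hom T c (map Suc b) \<Longrightarrow> v \<in> Hom T c [0] \<Longrightarrow> app1 b g v \<in> Hom T c b"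
  unfolding app1_def by (rule comp_hom[OF pair_hom eval_hom])

lemma app1_comp:
  "g \<in> Hom T c (map Suc b) \<Longrightarrow> v \<in> Hom T c [0] \<Longrightarrow> k \<in> Hom T c' c \<Longrightarrow>
    app1 b g v \<cdot> k = app1 b (g \<cdot> k) (v \<cdot> k)"
  unfolding app1_def by (simp add: comp_assoc_right[OF eval_hom pair_hom] pair_comp)

text \<open>
  The universal property of the exponential in terms of \<open>app1\<close>: \<open>prod_arr g (Ide T [0])\<close> is the
  pairing of \<open>g\<close> after the first projection with the second projection.
\<close>

lemma curry_ex1:
  assumes "f \<in> Hom T (c @ [0]) b"
  shows "\<exists>!g. g \<in> Hom T c (map Suc b) \<and> app1 b (g \<cdot> Fst T c [0]) (Snd T c [0]) = f"
proof -
  have "is_exponential T [0] b (map Suc b) (AMap (Emb T) (arity_eval b))"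
    using alg_theory by (simp add: is_alg_theory_def arity_exp_def)
  then have ex: "\<exists>!g. g \<in> Hom T c (map Suc b) \<and>
      AMap (Emb T) (arity_eval b) \<cdot> prod_arr T g (Ide T [0]) = f"
    using assms by (simp add: is_exponential_def)
  have "prod_arr T g (Ide T [0]) = pair (map Suc b) [0] (g \<cdot> Fst T c [0]) (Snd T c [0])"
    if g: "g \<in> Hom T c (map Suc b)" for g
    using HomD[OF g] HomD[OF ide_hom[OF Obj_T, of "[0]"]] HomD(2)[OF comp_hom[OF Fst_hom[of c "[0]"] g]]
    by (simp add: prod_arr_def pair_def comp_ide_left[OF Snd_hom] HomD)
  then have "g \<in> Hom T c (map Suc b) \<and> app1 b (g \<cdot> Fst T c [0]) (Snd T c [0]) = f \<longleftrightarrow>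
      g \<in> Hom T c (map Suc b) \<and> AMap (Emb T) (arity_eval b) \<cdot> prod_arr T g (Ide T [0]) = f" for g
    by (auto simp: app1_def)
  then show ?thesis using ex by simp
qed

lemma app1_ext:
  assumes g: "g \<in> Hom T c (map Suc b)" and g': "g' \<in> Hom T c (map Suc b)"
    and eq: "\<And>c' r v. r \<in> Hom T c' c \<Longrightarrow> v \<in> Hom T c' [0] \<Longrightarrow> app1 b (g \<cdot> r) v = app1 b (g' \<cdot> r) v"
  shows "g = g'"
proof -
  note gF = comp_hom[OF Fst_hom[of c "[0]"] g]
  show ?thesis
    using curry_ex1[OF app1_hom[OF gF Snd_hom]] g g' eq[OF Fst_hom Snd_hom] by metis
qed

lemma app_hom: "g \<in> Hom T c (raise d b) \<Longrightarrow> vs \<in> elems c d \<Longrightarrow> app b g vs \<in> Hom T c b"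
proof (induction vs arbitrary: b d)
  case (Cons v vs)
  then obtain d' where d: "d = Suc d'" by (cases d) (auto simp: elems_def)
  have "app (map Suc b) g vs \<in> Hom T c (map Suc b)"
    by (rule Cons.IH[of d']) (use Cons.prems d in \<open>auto simp: comp_def\<close>)
  then show ?case using Cons.prems d by (auto intro: app1_hom)
qed (auto simp: elems_def)

lemma app_comp:
  "g \<in> Hom T c (raise d b) \<Longrightarrow> vs \<in> elems c d \<Longrightarrow> k \<in> Hom T c' c \<Longrightarrow>
    app b g vs \<cdot> k = app b (g \<cdot> k) (map (\<lambda>v. v \<cdot> k) vs)"
proof (induction vs arbitrary: b d)
  case (Cons v vs)
  then obtain d' where d: "d = Suc d'" by (cases d) (auto simp: elems_def)
  have g: "g \<in> Hom T c (raise d' (map Suc b))" and vs: "vs \<in> elems c d'" "v \<in> Hom T c [0]"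
    using Cons.prems d by (auto simp: comp_def)
  show ?case
    using app1_comp[OF app_hom[OF g vs(1)] vs(2) Cons.prems(3)] Cons.IH[OF g vs(1) Cons.prems(3)]
    by simp
qed simp

text \<open>
  Since all generalized elements are available for testing, extensionality for \<open>d\<close> arguments
  follows by induction from uniqueness of transposes for a single one.
\<close>

lemma app_ext:
  "g \<in> Hom T c (raise d b) \<Longrightarrow> g' \<in> Hom T c (raise d b) \<Longrightarrow>
    (\<And>c' r us. r \<in> Hom T c' c \<Longrightarrow> us \<in> elems c' d \<Longrightarrow> app b (g \<cdot> r) us = app b (g' \<cdot> r) us) \<Longrightarrow>
    g = g'"
proof (induction d arbitrary: b g g')
  case 0
  then show ?case
    using "0.prems"(3)[OF ide_hom[OF Obj_T], of "[]"] by (simp add: comp_ide_right)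
next
  case (Suc d)
  have g: "g \<in> Hom T c (raise d (map Suc b))" and g': "g' \<in> Hom T c (raise d (map Suc b))"
    using Suc.prems by (auto simp: comp_def)
  show ?case
  proof (rule Suc.IH[OF g g'])
    fix c' r us assume r: "r \<in> Hom T c' c" and us: "us \<in> elems c' d"
    note gr = comp_hom[OF r g] and g'r = comp_hom[OF r g']
    show "app (map Suc b) (g \<cdot> r) us = app (map Suc b) (g' \<cdot> r) us"
    proof (rule app1_ext[OF app_hom[OF gr us] app_hom[OF g'r us]])
      fix c'' q v assume q: "q \<in> Hom T c'' c'" and v: "v \<in> Hom T c'' [0]"
      show "app1 b (app (map Suc b) (g \<cdot> r) us \<cdot> q) v = app1 b (app (map Suc b) (g' \<cdot> r) us \<cdot> q) v"
        using Suc.prems(3)[OF comp_hom[OF q r], of "v # map (\<lambda>u. u \<cdot> q) us"] v elems_comp[OF us q]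
        by (simp add: app_comp[OF gr us q] app_comp[OF g'r us q] comp_assoc_right[OF g r q]
            comp_assoc_right[OF g' r q])
    qed
  qed
qed

text \<open>
  Conversely, by the universal property of the exponentials, a family of generalized elements
  that is natural in the context is represented by an arrow. This is how binders are interpreted.
\<close>

definition natural_family ::
  "nat list \<Rightarrow> nat list \<Rightarrow> nat \<Rightarrow> ('u \<Rightarrow> 'u list \<Rightarrow> 'u) \<Rightarrow> bool" where
  "natural_family c b d \<phi> \<longleftrightarrow>
     (\<forall>c' r us. r \<in> Hom T c' c \<longrightarrow> us \<in> elems c' d \<longrightarrow> \<phi> r us \<in> Hom T c' b \<and>
        (\<forall>c'' q. q \<in> Hom T c'' c' \<longrightarrow> \<phi> r us \<cdot> q = \<phi> (r \<cdot> q) (map (\<lambda>u. u \<cdot> q) us)))"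

lemma natural_familyD:
  "natural_family c b d \<phi> \<Longrightarrow> r \<in> Hom T c' c \<Longrightarrow> us \<in> elems c' d \<Longrightarrow> \<phi> r us \<in> Hom T c' b"
  "natural_family c b d \<phi> \<Longrightarrow> r \<in> Hom T c' c \<Longrightarrow> us \<in> elems c' d \<Longrightarrow> q \<in> Hom T c'' c' \<Longrightarrow>
     \<phi> r us \<cdot> q = \<phi> (r \<cdot> q) (map (\<lambda>u. u \<cdot> q) us)"
  by (auto simp: natural_family_def)

text \<open>
  By naturality a family is determined by its value at the generic element, which is the pair of
  projections out of \<open>c, (0)\<close>. The transpose of this value represents the family.
\<close>

lemma lam1_ex:
  assumes "natural_family c b 1 \<phi>"
  shows "\<exists>g\<in>Hom T c (map Suc b). \<forall>c' r v. r \<in> Hom T c' c \<longrightarrow> v \<in> Hom T c' [0] \<longrightarrow>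
    app1 b (g \<cdot> r) v = \<phi> r [v]"
proof -
  let ?f = "\<phi> (Fst T c [0]) [Snd T c [0]]"
  have "?f \<in> Hom T (c @ [0]) b"
    by (rule natural_familyD(1)[OF assms Fst_hom]) (simp add: Snd_hom)
  then obtain g where g: "g \<in> Hom T c (map Suc b)" "app1 b (g \<cdot> Fst T c [0]) (Snd T c [0]) = ?f"
    using curry_ex1 by blast
  have "app1 b (g \<cdot> r) v = \<phi> r [v]" if r: "r \<in> Hom T c' c" and v: "v \<in> Hom T c' [0]" for c' r v
  proof -
    let ?p = "pair c [0] r v"
    have p: "?p \<in> Hom T c' (c @ [0])" using pair_hom[OF r v] .
    have "app1 b (g \<cdot> r) v = app1 b (g \<cdot> Fst T c [0]) (Snd T c [0]) \<cdot> ?p"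
      by (simp add: app1_comp[OF comp_hom[OF Fst_hom g(1)] Snd_hom p]
          comp_assoc_right[OF g(1) Fst_hom p] Fst_pair[OF r v] Snd_pair[OF r v])
    also have "\<dots> = \<phi> r [v]"
      unfolding g(2)
      by (subst natural_familyD(2)[OF assms Fst_hom _ p])
        (simp_all add: Snd_hom Fst_pair[OF r v] Snd_pair[OF r v])
    finally show ?thesis .
  qed
  then show ?thesis using g(1) by blast
qed

lemma lam_ex:
  "natural_family c b d \<phi> \<Longrightarrow>
    \<exists>g\<in>Hom T c (raise d b). \<forall>c' r us. r \<in> Hom T c' c \<longrightarrow> us \<in> elems c' d \<longrightarrow>
      app b (g \<cdot> r) us = \<phi> r us"
proof (induction d arbitrary: b \<phi>)
  case 0
  note \<phi> = natural_familyD[OF "0.prems"]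
  have "\<phi> (Ide T c) [] \<in> Hom T c b" using \<phi>(1)[OF ide_hom[OF Obj_T]] by simp
  moreover have "\<phi> (Ide T c) [] \<cdot> r = \<phi> r []" if "r \<in> Hom T c' c" for c' r
    using \<phi>(2)[OF ide_hom[OF Obj_T] _ that] by (simp add: comp_ide_left[OF that])
  ultimately show ?case by auto
next
  case (Suc d)
  note \<phi> = natural_familyD[OF Suc.prems]
  \<comment> \<open>\<open>\<psi> r us\<close> represents \<open>\<lambda>v. \<phi> r (v # us)\<close>\<close>
  define represents where "represents c' r us g \<longleftrightarrow> g \<in> Hom T c' (map Suc b) \<and>
      (\<forall>c'' q v. q \<in> Hom T c'' c' \<longrightarrow> v \<in> Hom T c'' [0] \<longrightarrow>
        app1 b (g \<cdot> q) v = \<phi> (r \<cdot> q) (v # map (\<lambda>u. u \<cdot> q) us))" for c' r us g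
  have ex: "\<exists>g. represents c' r us g" if r: "r \<in> Hom T c' c" and us: "us \<in> elems c' d" for c' r us
  proof -
    have "natural_family c' b 1 (\<lambda>q vs. \<phi> (r \<cdot> q) (vs @ map (\<lambda>u. u \<cdot> q) us))"
      unfolding natural_family_def
    proof (intro allI impI conjI)
      fix c'' q vs assume q: "q \<in> Hom T c'' c'" and vs: "vs \<in> elems c'' 1"
      have el: "vs @ map (\<lambda>u. u \<cdot> q) us \<in> elems c'' (Suc d)"
        using elems_append[OF vs elems_comp[OF us q]] by simp
      show "\<phi> (r \<cdot> q) (vs @ map (\<lambda>u. u \<cdot> q) us) \<in> Hom T c'' b"
        by (rule \<phi>(1)[OF comp_hom[OF q r] el])
      fix c3 p assume p: "p \<in> Hom T c3 c''"
      show "\<phi> (r \<cdot> q) (vs @ map (\<lambda>u. u \<cdot> q) us) \<cdot> p =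
          \<phi> (r \<cdot> (q \<cdot> p)) (map (\<lambda>u. u \<cdot> p) vs @ map (\<lambda>u. u \<cdot> (q \<cdot> p)) us)"
        using \<phi>(2)[OF comp_hom[OF q r] el p]
        by (simp only: map_append elems_comp_comp[OF us q p] comp_assoc_right[OF r q p])
    qed
    from lam1_ex[OF this] show ?thesis unfolding represents_def by auto
  qed
  define \<psi> where "\<psi> c' r us = (SOME g. represents c' r us g)" for c' r us
  have rep: "represents c' r us (\<psi> c' r us)" if "r \<in> Hom T c' c" "us \<in> elems c' d" for c' r us
    unfolding \<psi>_def by (rule someI_ex) (rule ex[OF that])
  have \<psi>_hom: "\<psi> c' r us \<in> Hom T c' (map Suc b)"
    if "r \<in> Hom T c' c" "us \<in> elems c' d" for c' r us
    using rep[OF that] unfolding represents_def by blast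
  have \<psi>: "app1 b (\<psi> c' r us \<cdot> q) v = \<phi> (r \<cdot> q) (v # map (\<lambda>u. u \<cdot> q) us)"
    if "r \<in> Hom T c' c" "us \<in> elems c' d" "q \<in> Hom T c'' c'" "v \<in> Hom T c'' [0]" for c' r us c'' q v
    using rep[OF that(1,2)] that(3,4) unfolding represents_def by blast
  have "natural_family c (map Suc b) d (\<lambda>r us. \<psi> (Dom T r) r us)"
    unfolding natural_family_def
  proof (intro allI impI conjI)
    fix c' r us assume r: "r \<in> Hom T c' c" and us: "us \<in> elems c' d"
    show "\<psi> (Dom T r) r us \<in> Hom T c' (map Suc b)" using \<psi>_hom[OF r us] HomD[OF r] by simp
    fix c'' q assume q: "q \<in> Hom T c'' c'"
    note rq = comp_hom[OF q r] and usq = elems_comp[OF us q]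
    have "\<psi> c' r us \<cdot> q = \<psi> c'' (r \<cdot> q) (map (\<lambda>u. u \<cdot> q) us)"
    proof (rule app1_ext[OF comp_hom[OF q \<psi>_hom[OF r us]] \<psi>_hom[OF rq usq]])
      fix c3 p v assume p: "p \<in> Hom T c3 c''" and v: "v \<in> Hom T c3 [0]"
      show "app1 b (\<psi> c' r us \<cdot> q \<cdot> p) v = app1 b (\<psi> c'' (r \<cdot> q) (map (\<lambda>u. u \<cdot> q) us) \<cdot> p) v"
        using \<psi>[OF r us comp_hom[OF p q] v] \<psi>[OF rq usq p v]
        by (simp only: elems_comp_comp[OF us q p] comp_assoc_right[OF \<psi>_hom[OF r us] q p]
            comp_assoc_right[OF r q p])
    qed
    then show "\<psi> (Dom T r) r us \<cdot> q = \<psi> (Dom T (r \<cdot> q)) (r \<cdot> q) (map (\<lambda>u. u \<cdot> q) us)"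
      using HomD[OF r] HomD[OF rq] by simp
  qed
  from Suc.IH[OF this] obtain g where g: "g \<in> Hom T c (raise d (map Suc b))"
    "\<And>c' r us. r \<in> Hom T c' c \<Longrightarrow> us \<in> elems c' d \<Longrightarrow> app (map Suc b) (g \<cdot> r) us = \<psi> (Dom T r) r us"
    by blast
  have "app b (g \<cdot> r) us = \<phi> r us" if r: "r \<in> Hom T c' c" and us: "us \<in> elems c' (Suc d)" for c' r us
  proof -
    obtain v us' where us': "us = v # us'" "v \<in> Hom T c' [0]" "us' \<in> elems c' d"
      using us by (cases us) (auto simp: elems_def)
    show ?thesis
      using \<psi>[OF r us'(3) ide_hom[OF Obj_T] us'(2)] g(2)[OF r us'(3)] \<psi>_hom[OF r us'(3)] us'
      by (simp add: comp_ide_right[OF r] comp_ide_right elems_Ide HomD[OF r])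
  qed
  then show ?case using g(1) by (auto simp: comp_def)
qed

definition lam :: "nat list \<Rightarrow> nat \<Rightarrow> ('u \<Rightarrow> 'u list \<Rightarrow> 'u) \<Rightarrow> 'u" where
  "lam c d \<phi> = (THE g. g \<in> Hom T c [d] \<and>
     (\<forall>c' r us. r \<in> Hom T c' c \<longrightarrow> us \<in> elems c' d \<longrightarrow> app [0] (g \<cdot> r) us = \<phi> r us))"

lemma app0_ext:
  assumes "g \<in> Hom T c [d]" "g' \<in> Hom T c [d]"
    and "\<And>c' r us. r \<in> Hom T c' c \<Longrightarrow> us \<in> elems c' d \<Longrightarrow> app [0] (g \<cdot> r) us = app [0] (g' \<cdot> r) us"
  shows "g = g'"
  by (rule app_ext[of g c d "[0]"]) (use assms in auto)

lemma app0_hom: "g \<in> Hom T c [d] \<Longrightarrow> vs \<in> elems c d \<Longrightarrow> app [0] g vs \<in> Hom T c [0]"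
  by (rule app_hom[of g c d]) auto

lemma app0_comp:
  "g \<in> Hom T c [d] \<Longrightarrow> vs \<in> elems c d \<Longrightarrow> k \<in> Hom T c' c \<Longrightarrow>
    app [0] g vs \<cdot> k = app [0] (g \<cdot> k) (map (\<lambda>v. v \<cdot> k) vs)"
  by (rule app_comp[of g c d]) auto

lemma lam_eqI:
  assumes "g \<in> Hom T c [d]"
    and "\<And>c' r us. r \<in> Hom T c' c \<Longrightarrow> us \<in> elems c' d \<Longrightarrow> app [0] (g \<cdot> r) us = \<phi> r us"
  shows "lam c d \<phi> = g"
  unfolding lam_def by (rule the_equality) (use assms in \<open>auto intro!: app0_ext[of _ c d g]\<close>)

lemma
  assumes "natural_family c [0] d \<phi>"
  shows lam_hom: "lam c d \<phi> \<in> Hom T c [d]"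
    and app_lam: "r \<in> Hom T c' c \<Longrightarrow> us \<in> elems c' d \<Longrightarrow> app [0] (lam c d \<phi> \<cdot> r) us = \<phi> r us"
proof -
  obtain g where g: "g \<in> Hom T c [d]"
    "\<And>c' r us. r \<in> Hom T c' c \<Longrightarrow> us \<in> elems c' d \<Longrightarrow> app [0] (g \<cdot> r) us = \<phi> r us"
    using lam_ex[OF assms] by auto
  have "lam c d \<phi> = g" using g by (rule lam_eqI)
  then show "lam c d \<phi> \<in> Hom T c [d]"
    "r \<in> Hom T c' c \<Longrightarrow> us \<in> elems c' d \<Longrightarrow> app [0] (lam c d \<phi> \<cdot> r) us = \<phi> r us"
    using g by auto
qed

lemma lam_cong:
  assumes "\<And>c' r us. r \<in> Hom T c' c \<Longrightarrow> us \<in> elems c' d \<Longrightarrow> \<phi> r us = \<phi>' r us"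
  shows "lam c d \<phi> = lam c d \<phi>'"
proof -
  have "(\<forall>c' r us. r \<in> Hom T c' c \<longrightarrow> us \<in> elems c' d \<longrightarrow> app [0] (g \<cdot> r) us = \<phi> r us) \<longleftrightarrow>
    (\<forall>c' r us. r \<in> Hom T c' c \<longrightarrow> us \<in> elems c' d \<longrightarrow> app [0] (g \<cdot> r) us = \<phi>' r us)" for g
    using assms by auto
  then show ?thesis unfolding lam_def by simp
qed

lemma lam_comp:
  assumes "natural_family c [0] d \<phi>" "q \<in> Hom T c' c"
  shows "lam c d \<phi> \<cdot> q = lam c' d (\<lambda>r us. \<phi> (q \<cdot> r) us)"
proof (rule lam_eqI[symmetric])
  show "lam c d \<phi> \<cdot> q \<in> Hom T c' [d]" by (rule comp_hom[OF assms(2) lam_hom[OF assms(1)]])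
  fix c'' r us assume r: "r \<in> Hom T c'' c'" and us: "us \<in> elems c'' d"
  show "app [0] (lam c d \<phi> \<cdot> q \<cdot> r) us = \<phi> (q \<cdot> r) us"
    using app_lam[OF assms(1) comp_hom[OF r assms(2)] us] comp_assoc_right[OF lam_hom[OF assms(1)] assms(2) r]
    by simp
qed

end

section \<open>Interpretation of terms in a theory\<close>

context second_order_theory
begin

text \<open>
  The value of a term at an arrow \<open>h\<close> into its metavariable context and elements \<open>vs\<close> for its
  variables. The body of an abstraction is evaluated at all \<open>r\<close> into the current context and all
  elements \<open>us\<close> for the bound variables; the arrow that represents this family is the argument of the
  operator.
\<close>

fun val :: "('v \<Rightarrow> 'u) \<Rightarrow> 'u \<Rightarrow> 'u list \<Rightarrow> 'v trm \<Rightarrow> 'u" where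
  "val I h vs (Var i) = vs ! i"
| "val I h vs (MVar i ts) = app [0] (proj (Cod T h) i \<cdot> h) (map (val I h vs) ts)"
| "val I h vs (Op \<omega> as) =
     I \<omega> \<cdot> tup (Dom T h) (map fst as)
       (map (\<lambda>(k, t). lam (Dom T h) k (\<lambda>r us. val I (h \<cdot> r) (us @ map (\<lambda>v. v \<cdot> r) vs) t)) as)"

definition interprets :: "('v \<Rightarrow> 'u) \<Rightarrow> 'v signature \<Rightarrow> bool" where
  "interprets I \<Sigma> \<longleftrightarrow> (\<forall>\<omega> ms. \<Sigma> \<omega> = Some ms \<longrightarrow> I \<omega> \<in> Hom T ms [0])"

lemma natural_family_val:
  assumes "h \<in> Hom T c \<Theta>" "vs \<in> elems c n"
    and "\<And>c h vs. h \<in> Hom T c \<Theta> \<Longrightarrow> vs \<in> elems c (k + n) \<Longrightarrow> val I h vs t \<in> Hom T c [0]"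
    and "\<And>c h vs c' q. h \<in> Hom T c \<Theta> \<Longrightarrow> vs \<in> elems c (k + n) \<Longrightarrow> q \<in> Hom T c' c \<Longrightarrow>
      val I h vs t \<cdot> q = val I (h \<cdot> q) (map (\<lambda>v. v \<cdot> q) vs) t"
  shows "natural_family c [0] k (\<lambda>r us. val I (h \<cdot> r) (us @ map (\<lambda>v. v \<cdot> r) vs) t)"
  unfolding natural_family_def
proof (intro allI impI conjI)
  fix c' r us assume r: "r \<in> Hom T c' c" and us: "us \<in> elems c' k"
  note hr = comp_hom[OF r assms(1)] and el = elems_append[OF us elems_comp[OF assms(2) r]]
  show "val I (h \<cdot> r) (us @ map (\<lambda>v. v \<cdot> r) vs) t \<in> Hom T c' [0]"
    by (rule assms(3)[OF hr el])
  fix c'' q assume q: "q \<in> Hom T c'' c'"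
  show "val I (h \<cdot> r) (us @ map (\<lambda>v. v \<cdot> r) vs) t \<cdot> q =
      val I (h \<cdot> (r \<cdot> q)) (map (\<lambda>u. u \<cdot> q) us @ map (\<lambda>v. v \<cdot> (r \<cdot> q)) vs) t"
    unfolding assms(4)[OF hr el q]
    by (simp only: map_append elems_comp_comp[OF assms(2) r q] comp_assoc_right[OF assms(1) r q])
qed

text \<open>
  Values and their naturality are treated in one induction, because the value of an operator exists
  only if the families given by the bodies are natural.
\<close>

lemma val_hom_comp:
  assumes "interprets I \<Sigma>" "is_trm \<Sigma> \<Theta> n t"
  shows "h \<in> Hom T c \<Theta> \<Longrightarrow> vs \<in> elems c n \<Longrightarrow> val I h vs t \<in> Hom T c [0] \<and>
    (\<forall>c' q. q \<in> Hom T c' c \<longrightarrow> val I h vs t \<cdot> q = val I (h \<cdot> q) (map (\<lambda>v. v \<cdot> q) vs) t)"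
  using assms(2)
proof (induction arbitrary: c h vs rule: is_trm.induct)
  case (var i n)
  then show ?case by (auto simp: elems_nth elems_length)
next
  case (mvar i ts n)
  note h = \<open>h \<in> Hom T c \<Theta>\<close>
  have IH: "val I h vs t \<in> Hom T c [0]"
    "q \<in> Hom T c' c \<Longrightarrow> val I h vs t \<cdot> q = val I (h \<cdot> q) (map (\<lambda>v. v \<cdot> q) vs) t"
    if "t \<in> set ts" for t c' q
    using mvar.IH[OF that mvar.prems] by blast+
  let ?ts = "map (val I h vs) ts"
  have ts: "?ts \<in> elems c (\<Theta> ! i)" using IH(1) mvar.hyps by (auto simp: elems_def)
  note p = proj_hom[OF \<open>i < length \<Theta>\<close>]
  note ph = comp_hom[OF h p]
  have "app [0] (proj \<Theta> i \<cdot> h) ?ts \<cdot> q =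
      app [0] (proj \<Theta> i \<cdot> (h \<cdot> q)) (map (val I (h \<cdot> q) (map (\<lambda>v. v \<cdot> q) vs)) ts)"
    if q: "q \<in> Hom T c' c" for c' q
  proof -
    have "map (\<lambda>v. v \<cdot> q) ?ts = map (val I (h \<cdot> q) (map (\<lambda>v. v \<cdot> q) vs)) ts"
      using IH(2)[OF _ q] by simp
    then show ?thesis by (simp only: app0_comp[OF ph ts q] comp_assoc_right[OF p h q])
  qed
  moreover have "Cod T (h \<cdot> q) = \<Theta>" if "q \<in> Hom T c' c" for c' q
    using comp_hom[OF that h] by (rule HomD)
  ultimately show ?case using app0_hom[OF ph ts] by (auto simp: HomD(3)[OF h])
next
  case (op \<omega> as n)
  note h = \<open>h \<in> Hom T c \<Theta>\<close> and vs = \<open>vs \<in> elems c n\<close>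
  have I: "I \<omega> \<in> Hom T (map fst as) [0]"
    using assms(1) op.hyps by (simp add: interprets_def)
  let ?\<phi> = "\<lambda>t r us. val I (h \<cdot> r) (us @ map (\<lambda>v. v \<cdot> r) vs) t"
  have nat: "natural_family c [0] k (?\<phi> t)" if "(k, t) \<in> set as" for k t
    by (rule natural_family_val[OF h vs]) (use op.IH[OF that] in blast)+
  let ?ls = "map (\<lambda>(k, t). lam c k (?\<phi> t)) as"
  have tup: "tuple c (map fst as) ?ls"
    using nat nth_mem by (fastforce simp: tuple_def split: prod.splits intro!: lam_hom)
  have "I \<omega> \<cdot> tup c (map fst as) ?ls \<cdot> q = I \<omega> \<cdot> tup c' (map fst as)
     (map (\<lambda>(k, t). lam c' k (\<lambda>r us. val I (h \<cdot> q \<cdot> r) (us @ map (\<lambda>v. v \<cdot> r) (map (\<lambda>v. v \<cdot> q) vs)) t)) as)"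
    if q: "q \<in> Hom T c' c" for c' q
  proof -
    have "lam c k (?\<phi> t) \<cdot> q =
        lam c' k (\<lambda>r us. val I (h \<cdot> q \<cdot> r) (us @ map (\<lambda>v. v \<cdot> r) (map (\<lambda>v. v \<cdot> q) vs)) t)"
      if "(k, t) \<in> set as" for k t
      unfolding lam_comp[OF nat[OF that] q]
      by (rule lam_cong) (simp only: elems_comp_comp[OF vs q] comp_assoc_right[OF h q])
    then have "map (\<lambda>f. f \<cdot> q) ?ls = (map (\<lambda>(k, t). lam c' k
       (\<lambda>r us. val I (h \<cdot> q \<cdot> r) (us @ map (\<lambda>v. v \<cdot> r) (map (\<lambda>v. v \<cdot> q) vs)) t)) as)"
      unfolding map_map by (auto intro!: map_cong)
    then show ?thesis by (simp only: comp_assoc_right[OF I tup_hom[OF tup] q] tup_comp[OF tup q])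
  qed
  moreover have "Dom T (h \<cdot> q) = c'" if "q \<in> Hom T c' c" for c' q
    using comp_hom[OF that h] by (rule HomD)
  ultimately show ?case
    using comp_hom[OF tup_hom[OF tup] I] by (auto simp only: HomD(2)[OF h] val.simps)
qed

lemma val_hom:
  "interprets I \<Sigma> \<Longrightarrow> is_trm \<Sigma> \<Theta> n t \<Longrightarrow> h \<in> Hom T c \<Theta> \<Longrightarrow> vs \<in> elems c n \<Longrightarrow>
    val I h vs t \<in> Hom T c [0]"
  using val_hom_comp by blast

lemma val_comp:
  "interprets I \<Sigma> \<Longrightarrow> is_trm \<Sigma> \<Theta> n t \<Longrightarrow> h \<in> Hom T c \<Theta> \<Longrightarrow> vs \<in> elems c n \<Longrightarrow>
    q \<in> Hom T c' c \<Longrightarrow> val I h vs t \<cdot> q = val I (h \<cdot> q) (map (\<lambda>v. v \<cdot> q) vs) t"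
  using val_hom_comp by blast

lemma natural_family_val_body:
  "interprets I \<Sigma> \<Longrightarrow> is_trm \<Sigma> \<Theta> (k + n) t \<Longrightarrow> h \<in> Hom T c \<Theta> \<Longrightarrow> vs \<in> elems c n \<Longrightarrow>
    natural_family c [0] k (\<lambda>r us. val I (h \<cdot> r) (us @ map (\<lambda>v. v \<cdot> r) vs) t)"
  by (rule natural_family_val) (auto intro: val_hom val_comp)

lemma tuple_lam_val:
  assumes "interprets I \<Sigma>" "\<And>k t. (k, t) \<in> set as \<Longrightarrow> is_trm \<Sigma> \<Theta> (k + n) t"
    "h \<in> Hom T c \<Theta>" "vs \<in> elems c n"
  shows "tuple c (map fst as)
    (map (\<lambda>(k, t). lam c k (\<lambda>r us. val I (h \<cdot> r) (us @ map (\<lambda>v. v \<cdot> r) vs) t)) as)"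
  unfolding tuple_def
proof (intro conjI allI impI)
  fix i assume i: "i < length (map fst as)"
  obtain k t where kt: "as ! i = (k, t)" by (cases "as ! i")
  then have "(k, t) \<in> set as" using i nth_mem[of i as] by simp
  from lam_hom[OF natural_family_val_body[OF assms(1) assms(2)[OF this] assms(3,4)]]
  show "map (\<lambda>(k, t). lam c k (\<lambda>r us. val I (h \<cdot> r) (us @ map (\<lambda>v. v \<cdot> r) vs) t)) as ! i
      \<in> Hom T c [map fst as ! i]"
    using i kt by simp
qed simp

lemma val_cong:
  assumes "\<And>\<omega> ms. \<Sigma> \<omega> = Some ms \<Longrightarrow> I \<omega> = I' \<omega>" "is_trm \<Sigma> \<Theta> n t"
  shows "val I h vs t = val I' h vs t"
  using assms(2)
proof (induction arbitrary: h vs rule: is_trm.induct)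
  case (mvar i ts n)
  then have "map (val I h vs) ts = map (val I' h vs) ts" by simp
  then show ?case by (simp only: val.simps)
next
  case (op \<omega> as n)
  have "(\<lambda>(k, t). lam (Dom T h) k (\<lambda>r us. val I (h \<cdot> r) (us @ map (\<lambda>v. v \<cdot> r) vs) t)) (k, t) =
    (\<lambda>(k, t). lam (Dom T h) k (\<lambda>r us. val I' (h \<cdot> r) (us @ map (\<lambda>v. v \<cdot> r) vs) t)) (k, t)"
    if "(k, t) \<in> set as" for k t
    using op.IH[OF that] by simp
  then have "map (\<lambda>(k, t). lam (Dom T h) k (\<lambda>r us. val I (h \<cdot> r) (us @ map (\<lambda>v. v \<cdot> r) vs) t)) as =
    map (\<lambda>(k, t). lam (Dom T h) k (\<lambda>r us. val I' (h \<cdot> r) (us @ map (\<lambda>v. v \<cdot> r) vs) t)) as"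
    by (intro map_cong HOL.refl) auto
  then show ?case using assms(1)[OF op.hyps(1)] by (simp only: val.simps)
qed simp

lemma val_rename:
  assumes "is_trm \<Sigma> \<Theta> n t"
  shows "h \<in> Hom T c \<Theta> \<Longrightarrow> vs \<in> elems c n \<Longrightarrow> ws \<in> elems c m \<Longrightarrow>
    (\<And>i. i < n \<Longrightarrow> \<rho> i < m \<and> ws ! \<rho> i = vs ! i) \<Longrightarrow> val I h ws (rename \<rho> t) = val I h vs t"
  using assms
proof (induction arbitrary: c h vs ws m \<rho> rule: is_trm.induct)
  case (mvar i ts n)
  have "val I h ws (rename \<rho> t) = val I h vs t" if "t \<in> set ts" for t
    using mvar.IH[OF that] mvar.prems by blast
  then have "map (val I h ws) (map (rename \<rho>) ts) = map (val I h vs) ts" by simp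
  then show ?case by (simp only: val.simps rename.simps)
next
  case (op \<omega> as n)
  note h = \<open>h \<in> Hom T c \<Theta>\<close> and vs = \<open>vs \<in> elems c n\<close> and ws = \<open>ws \<in> elems c m\<close>
  have "lam c k (\<lambda>r us. val I (h \<cdot> r) (us @ map (\<lambda>v. v \<cdot> r) ws) (rename (lift_ren k \<rho>) t)) =
    lam c k (\<lambda>r us. val I (h \<cdot> r) (us @ map (\<lambda>v. v \<cdot> r) vs) t)" if kt: "(k, t) \<in> set as" for k t
  proof (rule lam_cong)
    fix c' r us assume r: "r \<in> Hom T c' c" and us: "us \<in> elems c' k"
    show "val I (h \<cdot> r) (us @ map (\<lambda>v. v \<cdot> r) ws) (rename (lift_ren k \<rho>) t) =
        val I (h \<cdot> r) (us @ map (\<lambda>v. v \<cdot> r) vs) t"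
    proof (rule op.IH[OF kt comp_hom[OF r h] elems_append[OF us elems_comp[OF vs r]]
            elems_append[OF us elems_comp[OF ws r]]])
      fix i assume i: "i < k + n"
      show "lift_ren k \<rho> i < k + m \<and> (us @ map (\<lambda>v. v \<cdot> r) ws) ! lift_ren k \<rho> i =
          (us @ map (\<lambda>v. v \<cdot> r) vs) ! i"
        using i op.prems(4)[of "i - k"] elems_length[OF us] elems_length[OF vs] elems_length[OF ws]
        by (auto simp: lift_ren_def nth_append)
    qed
  qed
  then show ?case
    by (auto simp: HomD(2)[OF h] comp_def case_prod_unfold
        intro!: arg_cong[where f = "\<lambda>ls. I \<omega> \<cdot> tup c (map fst as) ls"])
qed auto

text \<open>
  Under a binder, the value of a lifted substitution at \<open>us\<close> and the restricted environment is
  \<open>us\<close> followed by the restricted values, by naturality.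
\<close>

lemma val_subst:
  assumes "interprets I \<Sigma>" "is_trm \<Sigma> \<Theta> n t"
  shows "h \<in> Hom T c \<Theta> \<Longrightarrow> ws \<in> elems c m \<Longrightarrow> (\<And>i. i < n \<Longrightarrow> is_trm \<Sigma> \<Theta> m (\<sigma> i)) \<Longrightarrow>
    val I h ws (subst \<sigma> t) = val I h (map (\<lambda>i. val I h ws (\<sigma> i)) [0..<n]) t"
  using assms(2)
proof (induction arbitrary: c h ws m \<sigma> rule: is_trm.induct)
  case (mvar i ts n)
  have "val I h ws (subst \<sigma> t) = val I h (map (\<lambda>i. val I h ws (\<sigma> i)) [0..<n]) t" if "t \<in> set ts" for t
    using mvar.IH[OF that] mvar.prems by blast
  then have "map (val I h ws) (map (subst \<sigma>) ts) =
    map (val I h (map (\<lambda>i. val I h ws (\<sigma> i)) [0..<n])) ts" by simp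
  then show ?case by (simp only: val.simps subst.simps)
next
  case (op \<omega> as n)
  note h = \<open>h \<in> Hom T c \<Theta>\<close> and ws = \<open>ws \<in> elems c m\<close> and \<sigma> = op.prems(3)
  let ?vs = "map (\<lambda>i. val I h ws (\<sigma> i)) [0..<n]"
  have "lam c k (\<lambda>r us. val I (h \<cdot> r) (us @ map (\<lambda>v. v \<cdot> r) ws) (subst (lift k \<sigma>) t)) =
    lam c k (\<lambda>r us. val I (h \<cdot> r) (us @ map (\<lambda>v. v \<cdot> r) ?vs) t)" if kt: "(k, t) \<in> set as" for k t
  proof (rule lam_cong)
    fix c' r us assume r: "r \<in> Hom T c' c" and us: "us \<in> elems c' k"
    note hr = comp_hom[OF r h] and wsr = elems_comp[OF ws r]
    note el = elems_append[OF us wsr]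
    have 1: "is_trm \<Sigma> \<Theta> (k + m) (lift k \<sigma> i)" if "i < k + n" for i
      using \<sigma>[of "i - k"] that by (auto simp: lift_def intro!: is_trm_rename[of _ _ m])
    have 2: "val I (h \<cdot> r) (us @ map (\<lambda>v. v \<cdot> r) ws) (lift k \<sigma> i) = (us @ map (\<lambda>v. v \<cdot> r) ?vs) ! i"
      if i: "i < k + n" for i
    proof (cases "i < k")
      case True
      then show ?thesis using elems_length[OF us] by (simp add: lift_def nth_append)
    next
      case False
      then have i': "i - k < n" using i by simp
      have "val I (h \<cdot> r) (us @ map (\<lambda>v. v \<cdot> r) ws) (rename (\<lambda>j. j + k) (\<sigma> (i - k))) =
          val I (h \<cdot> r) (map (\<lambda>v. v \<cdot> r) ws) (\<sigma> (i - k))"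
        by (rule val_rename[OF \<sigma>[OF i'] hr wsr el])
          (use elems_length[OF us] elems_length[OF ws] in \<open>auto simp: nth_append\<close>)
      also have "\<dots> = val I h ws (\<sigma> (i - k)) \<cdot> r"
        by (rule val_comp[OF assms(1) \<sigma>[OF i'] h ws r, symmetric])
      finally show ?thesis using False i' elems_length[OF us] by (simp add: lift_def nth_append)
    qed
    have "map (\<lambda>i. val I (h \<cdot> r) (us @ map (\<lambda>v. v \<cdot> r) ws) (lift k \<sigma> i)) [0..<k + n] =
      us @ map (\<lambda>v. v \<cdot> r) ?vs"
      by (rule nth_equalityI) (use 2 elems_length[OF us] in auto)
    then show "val I (h \<cdot> r) (us @ map (\<lambda>v. v \<cdot> r) ws) (subst (lift k \<sigma>) t) =
        val I (h \<cdot> r) (us @ map (\<lambda>v. v \<cdot> r) ?vs) t"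
      using op.IH[OF kt hr el 1] by (simp only:)
  qed
  then show ?case
    by (auto simp: HomD(2)[OF h] comp_def case_prod_unfold
        intro!: arg_cong[where f = "\<lambda>ls. I \<omega> \<cdot> tup c (map fst as) ls"])
qed auto

text \<open>
  The hypothesis on \<open>H\<close> says that its components are represented by the abstractions \<open>\<theta>\<close>.
  The abstractions may contain the free variables \<open>vs\<close>; therefore \<open>H\<close> starts at the context
  \<open>c\<close> of the environment and not at \<open>\<Theta>\<close>.
\<close>

lemma val_msubst:
  assumes "interprets I \<Sigma>" "is_trm \<Sigma> ms n t"
  shows "abs_ok \<Sigma> \<Theta> ms n \<theta> \<Longrightarrow> h \<in> Hom T c \<Theta> \<Longrightarrow> H \<in> Hom T c ms \<Longrightarrow> vs \<in> elems c n \<Longrightarrow>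
    (\<And>i c' r us. i < length ms \<Longrightarrow> r \<in> Hom T c' c \<Longrightarrow> us \<in> elems c' (ms ! i) \<Longrightarrow>
      app [0] (proj ms i \<cdot> (H \<cdot> r)) us =
        val I (h \<cdot> r) (us @ map (\<lambda>v. v \<cdot> r) vs) (snd (\<theta> ! i))) \<Longrightarrow>
    val I h vs (msubst \<theta> t) = val I H vs t"
  using assms(2)
proof (induction arbitrary: c h H vs \<theta> rule: is_trm.induct)
  case (mvar i ts n)
  note ok = mvar.prems(1) and h = mvar.prems(2) and H = mvar.prems(3) and vs = mvar.prems(4)
    and i = mvar.hyps(1)
  obtain s where s: "\<theta> ! i = (ms ! i, s)" "is_trm \<Sigma> \<Theta> (ms ! i + n) s"
    using abs_ok_nth[OF ok i] by blast
  let ?k = "ms ! i" and ?us = "map (msubst \<theta>) ts"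
  have IH: "val I h vs (msubst \<theta> t) = val I H vs t" if "t \<in> set ts" for t
    using mvar.IH[OF that mvar.prems] .
  let ?ws = "map (val I H vs) ts"
  have trm: "is_trm \<Sigma> ms n t" if "t \<in> set ts" for t using mvar.IH(1) that mvar.hyps by blast
  have ws: "?ws \<in> elems c ?k"
    using val_hom[OF assms(1) trm H vs] mvar.hyps(2) by (auto simp: elems_def)
  have trm': "is_trm \<Sigma> \<Theta> n (if i < ?k then ?us ! i else Var (i - ?k))" if "i < ?k + n" for i
    using that mvar.hyps(2) trm ok by (auto intro!: is_trm_msubst)
  have "map (\<lambda>i. val I h vs (if i < ?k then ?us ! i else Var (i - ?k))) [0..<?k + n] = ?ws @ vs"
    by (rule nth_equalityI)
      (use elems_length[OF ws] elems_length[OF vs] IH mvar.hyps(2) in \<open>auto simp: nth_append\<close>)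
  then have "val I h vs (msubst \<theta> (MVar i ts)) = val I h (?ws @ vs) s"
    using val_subst[OF assms(1) s(2) h vs trm'] by (simp add: s(1))
  also have "\<dots> = app [0] (proj ms i \<cdot> H) ?ws"
    using mvar.prems(5)[OF i ide_hom[OF Obj_T] ws] s(1)
    by (simp add: comp_ide_right[OF h] comp_ide_right[OF H] elems_Ide[OF vs])
  finally show ?case by (simp add: HomD(3)[OF H])
next
  case (op \<omega> as n)
  note ok = op.prems(1) and h = op.prems(2) and H = op.prems(3) and vs = op.prems(4)
    and rel = op.prems(5)
  have "lam c k (\<lambda>r us. val I (h \<cdot> r) (us @ map (\<lambda>v. v \<cdot> r) vs) (msubst (map (shift_abs k) \<theta>) t)) =
    lam c k (\<lambda>r us. val I (H \<cdot> r) (us @ map (\<lambda>v. v \<cdot> r) vs) t)" if kt: "(k, t) \<in> set as" for k t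
  proof (rule lam_cong)
    fix c' r us assume r: "r \<in> Hom T c' c" and us: "us \<in> elems c' k"
    note hr = comp_hom[OF r h] and Hr = comp_hom[OF r H] and vsr = elems_comp[OF vs r]
    note el = elems_append[OF us vsr]
    show "val I (h \<cdot> r) (us @ map (\<lambda>v. v \<cdot> r) vs) (msubst (map (shift_abs k) \<theta>) t) =
      val I (H \<cdot> r) (us @ map (\<lambda>v. v \<cdot> r) vs) t"
    proof (rule op.IH[OF kt abs_ok_shift[OF ok] hr Hr el])
      fix i c'' q xs assume i: "i < length ms" and q: "q \<in> Hom T c'' c'"
        and xs: "xs \<in> elems c'' (ms ! i)"
      obtain s where s: "\<theta> ! i = (ms ! i, s)" "is_trm \<Sigma> \<Theta> (ms ! i + n) s"
        using abs_ok_nth[OF ok i] by blast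
      note rq = comp_hom[OF q r]
      have "app [0] (proj ms i \<cdot> (H \<cdot> r \<cdot> q)) xs =
          val I (h \<cdot> r \<cdot> q) (xs @ map (\<lambda>v. v \<cdot> (r \<cdot> q)) vs) s"
        using rel[OF i rq xs] by (simp add: comp_assoc_right[OF H r q] comp_assoc_right[OF h r q] s(1))
      \<comment> \<open>the shifted abstraction skips the variables \<open>us\<close> that the operator binds\<close>
      also have "\<dots> = val I (h \<cdot> r \<cdot> q) (xs @ map (\<lambda>v. v \<cdot> q) (us @ map (\<lambda>v. v \<cdot> r) vs))
          (rename (\<lambda>i. if i < ms ! i' then i else i + k) s)" if "i' = i" for i'
        unfolding that
        by (rule val_rename[OF s(2) comp_hom[OF q hr]
              elems_append[OF xs elems_comp[OF vs rq]] elems_append[OF xs elems_comp[OF el q]], symmetric])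
          (use elems_length[OF xs] elems_length[OF us] elems_length[OF vs] in
            \<open>auto simp: nth_append elems_comp_comp[OF vs r q, symmetric]\<close>)
      finally show "app [0] (proj ms i \<cdot> (H \<cdot> r \<cdot> q)) xs =
          val I (h \<cdot> r \<cdot> q) (xs @ map (\<lambda>v. v \<cdot> q) (us @ map (\<lambda>v. v \<cdot> r) vs))
            (snd (map (shift_abs k) \<theta> ! i))"
        using i abs_ok_length[OF ok] s(1) by simp
    qed
  qed
  then show ?case
    by (auto simp: HomD(2)[OF h] HomD(2)[OF H] comp_def case_prod_unfold
        intro!: arg_cong[where f = "\<lambda>ls. I \<omega> \<cdot> tup c (map fst as) ls"])
qed auto

lemma val_extend:
  assumes "is_trm \<Sigma> \<Theta> n t" "h \<in> Hom T c \<Theta>" "vs \<in> elems c n" "ws \<in> elems c m"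
  shows "val I h (vs @ ws) t = val I h vs t"
proof -
  have "val I h (vs @ ws) (rename id t) = val I h vs t"
    by (rule val_rename[OF assms(1,2,3) elems_append[OF assms(3,4)]])
      (use elems_length[OF assms(3)] in \<open>auto simp: nth_append\<close>)
  moreover have "rename id t = t" by (rule rename_id[OF assms(1)]) simp
  ultimately show ?thesis by simp
qed

text \<open>
  The values of a term in all environments form a natural family, hence amount to a single arrow.
\<close>

definition sem :: "('v \<Rightarrow> 'u) \<Rightarrow> nat list \<Rightarrow> nat \<Rightarrow> 'v trm \<Rightarrow> 'u" where
  "sem I \<Theta> n t = lam \<Theta> n (\<lambda>h vs. val I h vs t)"

lemma natural_family_sem:
  "interprets I \<Sigma> \<Longrightarrow> is_trm \<Sigma> \<Theta> n t \<Longrightarrow> natural_family \<Theta> [0] n (\<lambda>h vs. val I h vs t)"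
  unfolding natural_family_def by (auto intro: val_hom val_comp)

lemma sem_hom: "interprets I \<Sigma> \<Longrightarrow> is_trm \<Sigma> \<Theta> n t \<Longrightarrow> sem I \<Theta> n t \<in> Hom T \<Theta> [n]"
  unfolding sem_def by (rule lam_hom[OF natural_family_sem])

lemma app_sem:
  "interprets I \<Sigma> \<Longrightarrow> is_trm \<Sigma> \<Theta> n t \<Longrightarrow> h \<in> Hom T c \<Theta> \<Longrightarrow> vs \<in> elems c n \<Longrightarrow>
    app [0] (sem I \<Theta> n t \<cdot> h) vs = val I h vs t"
  unfolding sem_def by (rule app_lam[OF natural_family_sem])

lemma sem_eqI:
  assumes "g \<in> Hom T \<Theta> [n]"
    "\<And>c h vs. h \<in> Hom T c \<Theta> \<Longrightarrow> vs \<in> elems c n \<Longrightarrow> app [0] (g \<cdot> h) vs = val I h vs t"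
  shows "sem I \<Theta> n t = g"
  unfolding sem_def by (rule lam_eqI) (use assms in auto)

lemma sem_cong:
  "(\<And>\<omega> ms. \<Sigma> \<omega> = Some ms \<Longrightarrow> I \<omega> = I' \<omega>) \<Longrightarrow> is_trm \<Sigma> \<Theta> n t \<Longrightarrow> sem I \<Theta> n t = sem I' \<Theta> n t"
  unfolding sem_def by (rule lam_cong) (rule val_cong)

lemma sem_eq_iff:
  assumes "interprets I \<Sigma>" "interprets I' \<Sigma>'" "is_trm \<Sigma> \<Theta> n s" "is_trm \<Sigma>' \<Theta> n t"
  shows "sem I \<Theta> n s = sem I' \<Theta> n t \<longleftrightarrow>
    (\<forall>c h vs. h \<in> Hom T c \<Theta> \<longrightarrow> vs \<in> elems c n \<longrightarrow> val I h vs s = val I' h vs t)"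
proof
  assume "sem I \<Theta> n s = sem I' \<Theta> n t"
  then show "\<forall>c h vs. h \<in> Hom T c \<Theta> \<longrightarrow> vs \<in> elems c n \<longrightarrow> val I h vs s = val I' h vs t"
    using app_sem[OF assms(1,3)] app_sem[OF assms(2,4)] by auto
next
  assume "\<forall>c h vs. h \<in> Hom T c \<Theta> \<longrightarrow> vs \<in> elems c n \<longrightarrow> val I h vs s = val I' h vs t"
  then show "sem I \<Theta> n s = sem I' \<Theta> n t" unfolding sem_def by (intro lam_cong) blast
qed

text \<open>
  Soundness of second-order equational logic. In the rule of extended metasubstitution, both sides
  of the conclusion are values of the two sides of the first premise at one and the same arrow: by
  the other premises, the two families of abstractions are represented by the same tuple.
\<close>

lemma derivable_sound:
  assumes I: "interprets I \<Sigma>"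
    and Ax: "\<And>\<Theta> n s t. (\<Theta>, n, s, t) \<in> Ax \<Longrightarrow>
      is_trm \<Sigma> \<Theta> n s \<and> is_trm \<Sigma> \<Theta> n t \<and> sem I \<Theta> n s = sem I \<Theta> n t"
    and "derivable \<Sigma> Ax \<Theta> n s t"
  shows "sem I \<Theta> n s = sem I \<Theta> n t"
  using assms(3)
proof (induction rule: derivable.induct)
  case (msubst ms n s t ss ts \<Theta> d)
  have typed: "is_trm \<Sigma> \<Theta> n s \<and> is_trm \<Sigma> \<Theta> n t" if "derivable \<Sigma> Ax \<Theta> n s t" for \<Theta> n s t
    using derivable_is_trm[OF that] Ax by blast
  have trm: "is_trm \<Sigma> ms n s" "is_trm \<Sigma> ms n t" using typed[OF msubst.hyps(1)] by auto
  have trms: "is_trm \<Sigma> \<Theta> (ms ! i + d) (ss ! i)" "is_trm \<Sigma> \<Theta> (ms ! i + d) (ts ! i)"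
    if "i < length ms" for i using typed[OF msubst.hyps(4)[OF that]] by auto
  have ok: "abs_ok \<Sigma> \<Theta> ms (n + d) (map (shift_abs n) (zip ms ss))"
    "abs_ok \<Sigma> \<Theta> ms (n + d) (map (shift_abs n) (zip ms ts))"
    by (rule abs_ok_shift; rule abs_ok_zip; simp add: msubst.hyps trms)+
  \<comment> \<open>the common environment \<open>H\<close> is built from \<open>ss\<close>; by the premises \<open>ts\<close> gives the same\<close>
  have main: "\<exists>H. H \<in> Hom T c ms \<and>
      val I h (vs @ ws) (msubst (map (shift_abs n) (zip ms ss)) s) = val I H vs s \<and>
      val I h (vs @ ws) (msubst (map (shift_abs n) (zip ms ts)) t) = val I H vs t"
    if h: "h \<in> Hom T c \<Theta>" and vs: "vs \<in> elems c n" and ws: "ws \<in> elems c d" for c h vs ws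
  proof -
    let ?\<phi> = "\<lambda>s r us. val I (h \<cdot> r) (us @ map (\<lambda>v. v \<cdot> r) ws) s"
    let ?ls = "map (\<lambda>i. lam c (ms ! i) (?\<phi> (ss ! i))) [0..<length ms]"
    note nat = natural_family_val_body[OF I _ h ws]
    have tup: "tuple c ms ?ls" using nat trms by (auto simp: tuple_def intro!: lam_hom)
    let ?H = "tup c ms ?ls"
    have H: "?H \<in> Hom T c ms" by (rule tup_hom[OF tup])
    have app: "app [0] (proj ms i \<cdot> (?H \<cdot> r)) us = ?\<phi> (ss ! i) r us"
      if i: "i < length ms" and r: "r \<in> Hom T c' c" and us: "us \<in> elems c' (ms ! i)" for i c' r us
      using app_lam[OF nat[OF trms(1)[OF i]] r us] i
      by (simp add: comp_assoc_right[OF proj_hom[OF i] H r, symmetric] proj_tup[OF tup])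
    have eq: "?\<phi> (ts ! i) r us = ?\<phi> (ss ! i) r us"
      if i: "i < length ms" and r: "r \<in> Hom T c' c" and us: "us \<in> elems c' (ms ! i)" for i c' r us
      using msubst.IH(2)[OF i] comp_hom[OF r h] elems_append[OF us elems_comp[OF ws r]]
      by (simp add: sem_eq_iff[OF I I trms(1)[OF i] trms(2)[OF i]])
    \<comment> \<open>the shift past \<open>\<Gamma>\<close> makes the abstractions depend on \<open>ws\<close> only\<close>
    have shift: "val I (h \<cdot> r) (us @ map (\<lambda>v. v \<cdot> r) (vs @ ws)) (snd (shift_abs n (ms ! i, u))) =
        ?\<phi> u r us"
      if u: "is_trm \<Sigma> \<Theta> (ms ! i + d) u" and r: "r \<in> Hom T c' c" and us: "us \<in> elems c' (ms ! i)"
      for i c' r us u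
      unfolding shift_abs.simps snd_conv
      by (rule val_rename[OF u comp_hom[OF r h] elems_append[OF us elems_comp[OF ws r]]
            elems_append[OF us elems_comp[OF elems_append[OF vs ws] r]]])
        (use elems_length[OF us] elems_length[OF vs] elems_length[OF ws] in
          \<open>auto simp: nth_append\<close>)
    have "val I h (vs @ ws) (msubst (map (shift_abs n) (zip ms us)) u) = val I ?H vs u"
      if us: "us = ss \<or> us = ts" and u: "is_trm \<Sigma> ms n u" for us u
    proof -
      have ok': "abs_ok \<Sigma> \<Theta> ms (n + d) (map (shift_abs n) (zip ms us))" using us ok by auto
      have len: "length us = length ms" using us msubst.hyps by auto
      have "val I h (vs @ ws) (msubst (map (shift_abs n) (zip ms us)) u) = val I ?H (vs @ ws) u"
      proof (rule val_msubst[OF I is_trm_mono[OF u] ok' h H elems_append[OF vs ws]])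
        fix i c' r xs assume i: "i < length ms" and r: "r \<in> Hom T c' c"
          and xs: "xs \<in> elems c' (ms ! i)"
        have "?\<phi> (us ! i) r xs = ?\<phi> (ss ! i) r xs" using us eq[OF i r xs] by auto
        moreover have "is_trm \<Sigma> \<Theta> (ms ! i + d) (us ! i)" using us trms[OF i] by auto
        ultimately show "app [0] (proj ms i \<cdot> (?H \<cdot> r)) xs = val I (h \<cdot> r)
            (xs @ map (\<lambda>v. v \<cdot> r) (vs @ ws)) (snd (map (shift_abs n) (zip ms us) ! i))"
          using app[OF i r xs] shift[OF _ r xs, of "us ! i"] i len
          by (simp del: shift_abs.simps map_append)
      qed simp
      also have "\<dots> = val I ?H vs u" by (rule val_extend[OF u H vs ws])
      finally show ?thesis .
    qed
    then show ?thesis using H trm by blast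
  qed
  show ?case
    unfolding sem_eq_iff[OF I I is_trm_msubst[OF is_trm_mono[OF trm(1)] ok(1), simplified]
        is_trm_msubst[OF is_trm_mono[OF trm(2)] ok(2), simplified]]
  proof (intro allI impI)
    fix c h xs assume h: "h \<in> Hom T c \<Theta>" and xs: "xs \<in> elems c (n + d)"
    have vs: "take n xs \<in> elems c n" and ws: "drop n xs \<in> elems c d"
      using xs by (auto simp: elems_def dest: in_set_takeD in_set_dropD)
    show "val I h xs (msubst (map (shift_abs n) (zip ms ss)) s) =
        val I h xs (msubst (map (shift_abs n) (zip ms ts)) t)"
      using main[OF h vs ws] msubst.IH(1) vs
      by (auto simp: sem_eq_iff[OF I I trm])
  qed
qed (use Ax in auto)

text \<open>
  This makes denotation functorial: arrows that are denoted by tuples of terms compose like the tuples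
  in the category of arities.
\<close>

lemma sem_comp_sems:
  assumes I: "interprets I \<Sigma>" and t: "is_trm \<Sigma> ms n t"
    and ss: "list_all2 (is_trm \<Sigma> \<Theta>) ms ss"
  shows "sem I ms n t \<cdot> tup \<Theta> ms (map (\<lambda>i. sem I \<Theta> (ms ! i) (ss ! i)) [0..<length ms]) =
    sem I \<Theta> n (msubst (zip ms ss) t)"
proof (rule sem_eqI[symmetric])
  let ?ls = "map (\<lambda>i. sem I \<Theta> (ms ! i) (ss ! i)) [0..<length ms]"
  have trms: "is_trm \<Sigma> \<Theta> (ms ! i) (ss ! i)" if "i < length ms" for i
    using ss that by (auto simp: list_all2_conv_all_nth)
  have len: "length ss = length ms" using ss by (simp add: list_all2_lengthD)
  have tup: "tuple \<Theta> ms ?ls" by (auto simp: tuple_def intro!: sem_hom[OF I] trms)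
  note H = tup_hom[OF tup]
  show "sem I ms n t \<cdot> tup \<Theta> ms ?ls \<in> Hom T \<Theta> [n]" by (rule comp_hom[OF H sem_hom[OF I t]])
  fix c h vs assume h: "h \<in> Hom T c \<Theta>" and vs: "vs \<in> elems c n"
  note Hh = comp_hom[OF h H]
  have ok: "abs_ok \<Sigma> \<Theta> ms n (zip ms ss)"
    by (rule abs_ok_zip) (auto simp: len intro: is_trm_mono[OF trms])
  have "val I h vs (msubst (zip ms ss) t) = val I (tup \<Theta> ms ?ls \<cdot> h) vs t"
  proof (rule val_msubst[OF I t ok h Hh vs])
    fix i c' r us assume i: "i < length ms" and r: "r \<in> Hom T c' c" and us: "us \<in> elems c' (ms ! i)"
    note hr = comp_hom[OF r h]
    have "proj ms i \<cdot> (tup \<Theta> ms ?ls \<cdot> h \<cdot> r) = sem I \<Theta> (ms ! i) (ss ! i) \<cdot> (h \<cdot> r)"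
      using i by (simp add: comp_assoc_right[OF H h r] comp_assoc_right[OF proj_hom[OF i] H hr, symmetric] proj_tup[OF tup])
    then show "app [0] (proj ms i \<cdot> (tup \<Theta> ms ?ls \<cdot> h \<cdot> r)) us =
        val I (h \<cdot> r) (us @ map (\<lambda>v. v \<cdot> r) vs) (snd (zip ms ss ! i))"
      using app_sem[OF I trms[OF i] hr us] val_extend[OF trms[OF i] hr us elems_comp[OF vs r]] i len
      by simp
  qed
  then show "app [0] (sem I ms n t \<cdot> tup \<Theta> ms ?ls \<cdot> h) vs = val I h vs (msubst (zip ms ss) t)"
    using app_sem[OF I t Hh vs] by (simp add: comp_assoc_right[OF sem_hom[OF I t] H h])
qed

text \<open>
  A translated operator is a metasubstituted instance of \<open>\<tau> \<omega>\<close>, so by \<open>val_msubst\<close> it acts as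
  the denotation of \<open>\<tau> \<omega>\<close> on the values of the arguments: translating and then interpreting is
  interpreting each operator by the denotation of its translation.
\<close>

lemma val_translate:
  assumes I: "interprets I \<Sigma>'" and \<tau>: "is_sig_translation \<Sigma> \<Sigma>' \<tau>"
    and J: "\<And>\<omega> ms. \<Sigma> \<omega> = Some ms \<Longrightarrow> J \<omega> = sem I ms 0 (\<tau> \<omega>)"
    and t: "is_trm \<Sigma> \<Theta> n t"
  shows "h \<in> Hom T c \<Theta> \<Longrightarrow> vs \<in> elems c n \<Longrightarrow> val I h vs (translate \<tau> t) = val J h vs t"
  using t
proof (induction arbitrary: c h vs rule: is_trm.induct)
  case (mvar i ts n)
  have "map (val I h vs) (map (translate \<tau>) ts) = map (val J h vs) ts" using mvar by simp
  then show ?case by (simp only: val.simps translate.simps)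
next
  case (op \<omega> as n)
  note h = op.prems(1) and vs = op.prems(2)
  have \<tau>\<omega>: "is_trm \<Sigma>' (map fst as) 0 (\<tau> \<omega>)"
    using \<tau> op.hyps by (simp add: is_sig_translation_def)
  have trm: "is_trm \<Sigma>' \<Theta> (k + n) (translate \<tau> t)" if "(k, t) \<in> set as" for k t
    using is_trm_translate[OF _ \<tau>] op.IH(1)[OF that] op.hyps that by blast
  let ?\<theta> = "map (\<lambda>(k, t). (k, translate \<tau> t)) as"
  have ok: "abs_ok \<Sigma>' \<Theta> (map fst as) n ?\<theta>" using trm by (auto simp: abs_ok_def)
  let ?ls = "map (\<lambda>(k, t). lam c k (\<lambda>r us. val I (h \<cdot> r) (us @ map (\<lambda>v. v \<cdot> r) vs) t)) ?\<theta>"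
  let ?H = "tup c (map fst as) ?ls"
  have tup: "tuple c (map fst as) ?ls"
    using tuple_lam_val[of I \<Sigma>' ?\<theta> \<Theta> n h c vs] I trm h vs by (fastforce simp: comp_def case_prod_unfold)
  note H = tup_hom[OF tup]
  have "val I h vs (translate \<tau> (Op \<omega> as)) = val I ?H vs (\<tau> \<omega>)"
    unfolding translate.simps
  proof (rule val_msubst[OF I is_trm_mono[OF \<tau>\<omega>] ok h H vs])
    fix i c' r us assume i: "i < length (map fst as)" and r: "r \<in> Hom T c' c"
      and us: "us \<in> elems c' (map fst as ! i)"
    obtain k t where kt: "as ! i = (k, t)" by (cases "as ! i")
    then have "(k, t) \<in> set as" using i nth_mem[of i as] by simp
    note nat = natural_family_val_body[OF I trm[OF this] h vs]
    have "proj (map fst as) i \<cdot> (?H \<cdot> r) = ?ls ! i \<cdot> r"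
      by (simp only: comp_assoc_right[OF proj_hom[OF i] H r, symmetric] proj_tup[OF tup i])
    moreover have "?ls ! i = lam c k (\<lambda>r us. val I (h \<cdot> r) (us @ map (\<lambda>v. v \<cdot> r) vs) (translate \<tau> t))"
      "?\<theta> ! i = (k, translate \<tau> t)" "us \<in> elems c' k"
      using us i kt by simp_all
    ultimately show "app [0] (proj (map fst as) i \<cdot> (?H \<cdot> r)) us =
        val I (h \<cdot> r) (us @ map (\<lambda>v. v \<cdot> r) vs) (snd (?\<theta> ! i))"
      by (simp only: app_lam[OF nat r] snd_conv)
  qed simp
  also have "\<dots> = val I ?H ([] @ vs) (\<tau> \<omega>)" by simp
  also have "\<dots> = val I ?H [] (\<tau> \<omega>)" by (rule val_extend[OF \<tau>\<omega> H _ vs]) simp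
  also have "\<dots> = J \<omega> \<cdot> ?H" using app_sem[OF I \<tau>\<omega> H, of "[]"] J[OF op.hyps(1)] by simp
  also have "?ls = map (\<lambda>(k, t). lam c k (\<lambda>r us. val J (h \<cdot> r) (us @ map (\<lambda>v. v \<cdot> r) vs) t)) as"
  proof -
    have "lam c k (\<lambda>r us. val I (h \<cdot> r) (us @ map (\<lambda>v. v \<cdot> r) vs) (translate \<tau> t)) =
      lam c k (\<lambda>r us. val J (h \<cdot> r) (us @ map (\<lambda>v. v \<cdot> r) vs) t)" if "(k, t) \<in> set as" for k t
      by (rule lam_cong) (rule op.IH[OF that comp_hom[OF _ h] elems_append[OF _ elems_comp[OF vs]]])
    then show ?thesis by (auto simp: comp_def)
  qed
  finally show ?case by (simp only: val.simps HomD(2)[OF h])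
qed simp

lemma sem_translate:
  assumes "interprets I \<Sigma>'" "is_sig_translation \<Sigma> \<Sigma>' \<tau>"
    and "\<And>\<omega> ms. \<Sigma> \<omega> = Some ms \<Longrightarrow> J \<omega> = sem I ms 0 (\<tau> \<omega>)"
    and "is_trm \<Sigma> \<Theta> n t"
  shows "sem I \<Theta> n (translate \<tau> t) = sem J \<Theta> n t"
  unfolding sem_def by (rule lam_cong) (rule val_translate[OF assms])

lemma interprets_translation:
  assumes "interprets I \<Sigma>'" "is_sig_translation \<Sigma> \<Sigma>' \<tau>"
    and "\<And>\<omega> ms. \<Sigma> \<omega> = Some ms \<Longrightarrow> J \<omega> = sem I ms 0 (\<tau> \<omega>)"
  shows "interprets J \<Sigma>"
  unfolding interprets_def using assms sem_hom[OF assms(1)] by (auto simp: is_sig_translation_def)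

end

text \<open>
  The identity translation sends each operator to this term.
\<close>

definition op_trm :: "'v \<Rightarrow> nat list \<Rightarrow> 'v trm" where
  "op_trm \<omega> ms = Op \<omega> (map (\<lambda>i. (ms ! i, generic i (ms ! i))) [0..<length ms])"

lemma is_trm_op_trm: "\<Sigma> \<omega> = Some ms \<Longrightarrow> is_trm \<Sigma> ms n (op_trm \<omega> ms)"
  by (auto simp: op_trm_def is_trm_Op comp_def map_nth is_trm_generic)

text \<open>
  Only arrows into \<open>(0)\<close> become operators; arrows into other arities are recovered by uncurrying and
  tupling.
\<close>

definition sig_of :: "'u alg_theory \<Rightarrow> 'u signature" where
  "sig_of T = (\<lambda>f. if f \<in> Arr T \<and> Cod T f = [0] then Some (Dom T f) else None)"

lemma sig_of_eq_Some: "sig_of T f = Some ms \<longleftrightarrow> f \<in> Hom T ms [0]"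
  by (auto simp: sig_of_def Hom_def)

section \<open>Elementary terms and definability of arrows\<close>

context second_order_theory
begin

lemma interprets_sig_of: "interprets (\<lambda>f. f) (sig_of T)"
  by (simp add: interprets_def sig_of_eq_Some)

text \<open>
  Extend \<open>h : c \<rightarrow> \<Theta>\<close> by elements of the context \<open>c\<close> to an arrow into \<open>\<Theta>, (0), \<dots>, (0)\<close>.
\<close>

definition ext_elems :: "nat list \<Rightarrow> nat list \<Rightarrow> 'u \<Rightarrow> 'u list \<Rightarrow> 'u" where
  "ext_elems c \<Theta> h vs =
     tup c (\<Theta> @ replicate (length vs) 0) (map (\<lambda>i. proj \<Theta> i \<cdot> h) [0..<length \<Theta>] @ vs)"

lemma tuple_ext_elems:
  assumes "h \<in> Hom T c \<Theta>" "vs \<in> elems c d"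
  shows "tuple c (\<Theta> @ replicate d 0) (map (\<lambda>i. proj \<Theta> i \<cdot> h) [0..<length \<Theta>] @ vs)"
  using assms comp_hom[OF assms(1) proj_hom]
  by (auto simp: tuple_def nth_append elems_length elems_nth)

lemma
  assumes h: "h \<in> Hom T c \<Theta>" and vs: "vs \<in> elems c d"
  shows ext_elems_hom: "ext_elems c \<Theta> h vs \<in> Hom T c (\<Theta> @ replicate d 0)"
    and proj_ext_elems1: "i < length \<Theta> \<Longrightarrow>
      proj (\<Theta> @ replicate d 0) i \<cdot> ext_elems c \<Theta> h vs = proj \<Theta> i \<cdot> h"
    and proj_ext_elems2: "j < d \<Longrightarrow>
      proj (\<Theta> @ replicate d 0) (length \<Theta> + j) \<cdot> ext_elems c \<Theta> h vs = vs ! j"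
    and Fst_ext_elems: "Fst T \<Theta> (replicate d 0) \<cdot> ext_elems c \<Theta> h vs = h"
proof -
  let ?k = "ext_elems c \<Theta> h vs" and ?\<Theta>' = "\<Theta> @ replicate d 0"
  note tup = tuple_ext_elems[OF h vs]
  have k: "?k = tup c ?\<Theta>' (map (\<lambda>i. proj \<Theta> i \<cdot> h) [0..<length \<Theta>] @ vs)"
    using elems_length[OF vs] by (simp add: ext_elems_def)
  show hom: "?k \<in> Hom T c ?\<Theta>'" unfolding k by (rule tup_hom[OF tup])
  show p1: "proj ?\<Theta>' i \<cdot> ?k = proj \<Theta> i \<cdot> h" if "i < length \<Theta>" for i
    using that unfolding k by (subst proj_tup[OF tup]) (simp_all add: nth_append)
  show "proj ?\<Theta>' (length \<Theta> + j) \<cdot> ?k = vs ! j" if "j < d" for j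
    using that unfolding k by (subst proj_tup[OF tup]) (simp_all add: nth_append)
  show "Fst T \<Theta> (replicate d 0) \<cdot> ?k = h"
  proof (rule proj_ext[OF comp_hom[OF hom Fst_hom] h])
    fix i assume i: "i < length \<Theta>"
    show "proj \<Theta> i \<cdot> (Fst T \<Theta> (replicate d 0) \<cdot> ?k) = proj \<Theta> i \<cdot> h"
      using p1[OF i]
      by (simp only: comp_assoc_right[OF proj_hom[OF i] Fst_hom hom, symmetric] proj_append1[OF i])
  qed
qed

lemma ext_elems_eqI:
  assumes "k \<in> Hom T c (\<Theta> @ replicate d 0)" "h \<in> Hom T c \<Theta>" "vs \<in> elems c d"
    "\<And>i. i < length \<Theta> \<Longrightarrow> proj (\<Theta> @ replicate d 0) i \<cdot> k = proj \<Theta> i \<cdot> h"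
    "\<And>j. j < d \<Longrightarrow> proj (\<Theta> @ replicate d 0) (length \<Theta> + j) \<cdot> k = vs ! j"
  shows "ext_elems c \<Theta> h vs = k"
proof (rule proj_ext[OF ext_elems_hom[OF assms(2,3)] assms(1)])
  fix i assume "i < length (\<Theta> @ replicate d 0)"
  then consider "i < length \<Theta>" | j where "i = length \<Theta> + j" "j < d"
    by (metis add_diff_inverse_nat length_append length_replicate nat_add_left_cancel_less)
  then show "proj (\<Theta> @ replicate d 0) i \<cdot> ext_elems c \<Theta> h vs = proj (\<Theta> @ replicate d 0) i \<cdot> k"
    by cases (simp_all add: proj_ext_elems1[OF assms(2,3)] proj_ext_elems2[OF assms(2,3)] assms)
qed

text \<open>
  In the category of arities, evaluation replaces the last variable by the metavariable of arity \<open>0\<close>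
  that stands for the argument; this is carried over to the theory by the functor from arities.
\<close>

lemma app1_E:
  assumes e: "elementary \<Theta> (Suc m) e" and k: "k \<in> Hom T c \<Theta>" and v: "v \<in> Hom T c [0]"
  shows "app1 [m] (E \<Theta> [e] [Suc m] \<cdot> k) v =
    E (\<Theta> @ [0]) [subst (\<lambda>j. if j < m then Var j else MVar (length \<Theta>) []) e] [m] \<cdot> pair \<Theta> [0] k v"
proof -
  let ?\<Theta> = "\<Theta> @ [0]" and ?v = "MVar (length \<Theta>) []"
  have e': "elementary ?\<Theta> (Suc m) e" by (rule is_trm_append[OF e])
  have Ee: "E \<Theta> [e] [Suc m] \<in> Hom T \<Theta> [Suc m]" by (rule E_hom) (simp add: e)
  note p = pair_hom[OF k v]
  have l: "list_all2 (elementary ?\<Theta>) \<Theta> (generics \<Theta>)" by (rule trms_generics_append)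
  have EF: "E \<Theta> [e] [Suc m] \<cdot> Fst T \<Theta> [0] = E ?\<Theta> [e] [Suc m]"
    unfolding Fst_T using e by (subst E_comp[OF l]) (auto simp: msubst_generics[OF e])
  have l2: "list_all2 (elementary ?\<Theta>) [Suc m, 0] [e, ?v]" using e' by simp
  have "E \<Theta> [e] [Suc m] \<cdot> k = E ?\<Theta> [e] [Suc m] \<cdot> pair \<Theta> [0] k v"
    by (simp add: EF[symmetric] comp_assoc_right[OF Ee Fst_hom p] Fst_pair[OF k v])
  moreover have "v = Snd T \<Theta> [0] \<cdot> pair \<Theta> [0] k v" by (simp add: Snd_pair[OF k v])
  moreover have Ee': "E ?\<Theta> [e] [Suc m] \<in> Hom T ?\<Theta> [Suc m]" by (rule E_hom) (simp add: e')
  ultimately have "pair [Suc m] [0] (E \<Theta> [e] [Suc m] \<cdot> k) v =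
      pair [Suc m] [0] (E ?\<Theta> [e] [Suc m]) (Snd T \<Theta> [0]) \<cdot> pair \<Theta> [0] k v"
    using pair_comp[OF Ee' Snd_hom p] by simp
  also have "pair [Suc m] [0] (E ?\<Theta> [e] [Suc m]) (Snd T \<Theta> [0]) = E ?\<Theta> [e, ?v] [Suc m, 0]"
  proof (rule pair_eqI)
    show "E ?\<Theta> [e, ?v] [Suc m, 0] \<in> Hom T ?\<Theta> ([Suc m] @ [0])" using E_hom[OF l2] by simp
    show "Fst T [Suc m] [0] \<cdot> E ?\<Theta> [e, ?v] [Suc m, 0] = E ?\<Theta> [e] [Suc m]"
      using e' proj_E[OF l2, of 0] by (simp add: proj_append1[of 0 "[Suc m]" "[0]", simplified, symmetric] proj_def Fst_T generics_def)
    show "Snd T [Suc m] [0] \<cdot> E ?\<Theta> [e, ?v] [Suc m, 0] = Snd T \<Theta> [0]"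
      using proj_E[OF l2, of 1] by (simp add: Snd_T proj_def generic_def)
  qed
  finally have "app1 [m] (E \<Theta> [e] [Suc m] \<cdot> k) v =
      AMap (Emb T) (arity_eval [m]) \<cdot> E ?\<Theta> [e, ?v] [Suc m, 0] \<cdot> pair \<Theta> [0] k v"
    using eval_hom[of "[m]"] E_hom[OF l2] p by (simp add: app1_def comp_assoc_right)
  also have "AMap (Emb T) (arity_eval [m]) \<cdot> E ?\<Theta> [e, ?v] [Suc m, 0] =
      E ?\<Theta> [subst (\<lambda>j. if j < m then Var j else ?v) e] [m]"
  proof -
    have "AMap (Emb T) (arity_eval [m]) = E [Suc m, 0] [MVar 0 (map Var [0..<m] @ [MVar 1 []])] [m]"
      by (simp add: arity_eval_def arity_exp_def)
    moreover have "list_all2 (elementary [Suc m, 0]) [m] [MVar 0 (map Var [0..<m] @ [MVar 1 []])]"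
      by auto
    moreover have "msubst (zip [Suc m, 0] [e, ?v]) (MVar 0 (map Var [0..<m] @ [MVar 1 []])) =
        subst (\<lambda>j. if j < m then Var j else ?v) e"
      by (auto simp: nth_append intro!: subst_cong[OF e])
    ultimately show ?thesis using E_comp[OF l2] by simp
  qed
  finally show ?thesis .
qed

text \<open>
  The value of an elementary term at arguments replaces its variables by metavariables without
  arguments. The last variable is eliminated first, so their order is reversed.
\<close>

definition close_vars :: "nat \<Rightarrow> nat \<Rightarrow> nat \<Rightarrow> nat \<Rightarrow> 'u trm" where
  "close_vars l m d j = (if j < m then Var j else MVar (l + (d - 1 - (j - m))) [])"

lemma is_trm_close_vars:
  "elementary \<Theta> (m + d) e \<Longrightarrow>
    elementary (\<Theta> @ replicate d 0) m (subst (close_vars (length \<Theta>) m d) e)"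
  by (erule is_trm_subst[OF is_trm_append]) (auto simp: close_vars_def nth_append)

lemma app_E:
  "elementary \<Theta> (m + d) e \<Longrightarrow> h \<in> Hom T c \<Theta> \<Longrightarrow> vs \<in> elems c d \<Longrightarrow>
    app [m] (E \<Theta> [e] [m + d] \<cdot> h) vs =
    E (\<Theta> @ replicate d 0) [subst (close_vars (length \<Theta>) m d) e] [m] \<cdot> ext_elems c \<Theta> h (rev vs)"
proof (induction vs arbitrary: m d)
  case Nil
  then have d: "d = 0" by (simp add: elems_def)
  have "subst (close_vars (length \<Theta>) m 0) e = e"
    using Nil.prems d by (intro subst_id) (auto simp: close_vars_def)
  moreover have "ext_elems c \<Theta> h [] = h"
    by (rule ext_elems_eqI[of _ _ _ 0]) (use Nil in auto)
  ultimately show ?case using d by simp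
next
  case (Cons v vs)
  note h = Cons.prems(2)
  obtain d' where d: "d = Suc d'" and v: "v \<in> Hom T c [0]" and vs: "vs \<in> elems c d'"
    using Cons.prems(3) by (cases d) (auto simp: elems_def)
  have e: "elementary \<Theta> (Suc m + d') e" using Cons.prems(1) d by simp
  have rvs: "rev vs \<in> elems c d'" "rev (v # vs) \<in> elems c d" using vs v d by (auto simp: elems_def)
  let ?\<Theta> = "\<Theta> @ replicate d' 0" and ?k = "ext_elems c \<Theta> h (rev vs)"
  have \<Theta>d: "\<Theta> @ replicate d 0 = ?\<Theta> @ [0]" by (simp add: d replicate_append_same)
  let ?e = "subst (close_vars (length \<Theta>) (Suc m) d') e"
  \<comment> \<open>\<open>vs\<close> are consumed before \<open>v\<close>, so \<open>v\<close> becomes the last of the new components\<close>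
  have "app [m] (E \<Theta> [e] [m + d] \<cdot> h) (v # vs) = app1 [m] (E ?\<Theta> [?e] [Suc m] \<cdot> ?k) v"
    using Cons.IH[OF e h vs] d by simp
  also have "\<dots> = E (?\<Theta> @ [0]) [subst (\<lambda>j. if j < m then Var j else MVar (length ?\<Theta>) []) ?e] [m] \<cdot>
      pair ?\<Theta> [0] ?k v"
    by (rule app1_E[OF is_trm_close_vars[OF e] ext_elems_hom[OF h rvs(1)] v])
  also have "subst (\<lambda>j. if j < m then Var j else MVar (length ?\<Theta>) []) ?e =
      subst (close_vars (length \<Theta>) m d) e"
    unfolding subst_subst by (rule subst_cong[OF e]) (auto simp: close_vars_def d)
  also have "pair ?\<Theta> [0] ?k v = ext_elems c \<Theta> h (rev (v # vs))"
  proof (rule pair_eqI)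
    note X = ext_elems_hom[OF h rvs(2)]
    show X': "ext_elems c \<Theta> h (rev (v # vs)) \<in> Hom T c (?\<Theta> @ [0])" using X \<Theta>d by simp
    show "Fst T ?\<Theta> [0] \<cdot> ext_elems c \<Theta> h (rev (v # vs)) = ext_elems c \<Theta> h (rev vs)"
    proof (rule ext_elems_eqI[OF _ h rvs(1), symmetric])
      have pF: "proj ?\<Theta> i \<cdot> (Fst T ?\<Theta> [0] \<cdot> ext_elems c \<Theta> h (rev (v # vs))) =
          proj (\<Theta> @ replicate d 0) i \<cdot> ext_elems c \<Theta> h (rev (v # vs))" if "i < length ?\<Theta>" for i
        unfolding \<Theta>d proj_append1[OF that] comp_assoc_right[OF proj_hom[OF that] Fst_hom X'] ..
      show "Fst T ?\<Theta> [0] \<cdot> ext_elems c \<Theta> h (rev (v # vs)) \<in> Hom T c ?\<Theta>"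
        by (rule comp_hom[OF X' Fst_hom])
      show "proj ?\<Theta> i \<cdot> (Fst T ?\<Theta> [0] \<cdot> ext_elems c \<Theta> h (rev (v # vs))) = proj \<Theta> i \<cdot> h"
        if "i < length \<Theta>" for i
        using that pF[of i] proj_ext_elems1[OF h rvs(2)] by simp
      show "proj ?\<Theta> (length \<Theta> + j) \<cdot> (Fst T ?\<Theta> [0] \<cdot> ext_elems c \<Theta> h (rev (v # vs))) = rev vs ! j"
        if "j < d'" for j
        using that pF[of "length \<Theta> + j"] proj_ext_elems2[OF h rvs(2), of j] elems_length[OF vs]
        by (simp add: d nth_append)
    qed
    have "Snd T ?\<Theta> [0] = proj (\<Theta> @ replicate d 0) (length \<Theta> + d')"
      unfolding \<Theta>d Snd_T proj_def by (simp add: nth_append)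
    then show "Snd T ?\<Theta> [0] \<cdot> ext_elems c \<Theta> h (rev (v # vs)) = v"
      using proj_ext_elems2[OF h rvs(2), of d'] elems_length[OF vs] by (simp add: d nth_append)
  qed
  finally show ?case unfolding \<Theta>d .
qed

lemma proj_replicate: "j < d \<Longrightarrow>
    proj (\<Theta> @ replicate d 0) (length \<Theta> + j) = E (\<Theta> @ replicate d 0) [MVar (length \<Theta> + j) []] [0]"
  by (simp add: proj_def generic_def nth_append)

text \<open>
  By \<open>app_E\<close>, a metavariable applied to elementary elements is the composite of two elementary
  arrows, which is computed in the category of arities.
\<close>

lemma app_E_generic:
  assumes i: "i < length \<Theta>" and us: "length us = \<Theta> ! i" "\<forall>u\<in>set us. elementary \<Theta> 0 u"
  shows "app [0] (proj \<Theta> i) (map (\<lambda>u. E \<Theta> [u] [0]) us) = E \<Theta> [MVar i us] [0]"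
proof -
  let ?m = "\<Theta> ! i" and ?vs = "map (\<lambda>u. E \<Theta> [u] [0]) us"
  let ?\<Theta> = "\<Theta> @ replicate ?m 0"
  have vs: "?vs \<in> elems \<Theta> ?m" using us by (auto simp: elems_def intro!: E_hom)
  have l: "list_all2 (elementary \<Theta>) ?\<Theta> (generics \<Theta> @ rev us)"
  proof (rule list_all2_appendI[OF trms_generics])
    show "list_all2 (elementary \<Theta>) (replicate ?m 0) (rev us)"
      using us nth_mem[of _ us] by (auto simp: list_all2_conv_all_nth rev_nth)
  qed
  have e: "elementary \<Theta> (0 + ?m) (generic i ?m)" using i by (simp add: is_trm_generic)
  have "app [0] (proj \<Theta> i \<cdot> Ide T \<Theta>) ?vs =
      E ?\<Theta> [subst (close_vars (length \<Theta>) 0 ?m) (generic i ?m)] [0] \<cdot> ext_elems \<Theta> \<Theta> (Ide T \<Theta>) (rev ?vs)"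
    using app_E[OF e ide_hom[OF Obj_T] vs] by (simp add: proj_def)
  also have "ext_elems \<Theta> \<Theta> (Ide T \<Theta>) (rev ?vs) = E \<Theta> (generics \<Theta> @ rev us) ?\<Theta>"
  proof (rule ext_elems_eqI[OF E_hom[OF l] ide_hom[OF Obj_T]])
    show "rev ?vs \<in> elems \<Theta> ?m" using vs by (auto simp: elems_def)
    show "proj ?\<Theta> i \<cdot> E \<Theta> (generics \<Theta> @ rev us) ?\<Theta> = proj \<Theta> i \<cdot> Ide T \<Theta>" if "i < length \<Theta>" for i
      using that proj_E[OF l, of i] comp_ide_right[OF proj_hom[OF that]]
      by (simp add: nth_append proj_def)
    show "proj ?\<Theta> (length \<Theta> + j) \<cdot> E \<Theta> (generics \<Theta> @ rev us) ?\<Theta> = rev ?vs ! j" if "j < ?m" for j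
      using that proj_E[OF l, of "length \<Theta> + j"] us by (simp add: nth_append rev_nth)
  qed
  also have "E ?\<Theta> [subst (close_vars (length \<Theta>) 0 ?m) (generic i ?m)] [0] \<cdot>
      E \<Theta> (generics \<Theta> @ rev us) ?\<Theta> = E \<Theta> [MVar i us] [0]"
  proof -
    have "map (\<lambda>j. apply_abs (zip ?\<Theta> (generics \<Theta> @ rev us) ! (length \<Theta> + (?m - 1 - j))) []) [0..<?m] = us"
    proof (rule nth_equalityI)
      fix j assume "j < length (map (\<lambda>j. apply_abs (zip ?\<Theta> (generics \<Theta> @ rev us) ! (length \<Theta> + (?m - 1 - j))) []) [0..<?m])"
      then have j: "j < ?m" by simp
      then have u: "elementary \<Theta> 0 (us ! j)" using us by simp
      show "map (\<lambda>j. apply_abs (zip ?\<Theta> (generics \<Theta> @ rev us) ! (length \<Theta> + (?m - 1 - j))) []) [0..<?m] ! j = us ! j"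
        using j us by (simp add: nth_append rev_nth subst_id[OF u])
    qed (use us in simp)
    moreover have "msubst (zip ?\<Theta> (generics \<Theta> @ rev us)) (subst (close_vars (length \<Theta>) 0 ?m) (generic i ?m)) =
      apply_abs (?m, generic i ?m)
        (map (\<lambda>j. apply_abs (zip ?\<Theta> (generics \<Theta> @ rev us) ! (length \<Theta> + (?m - 1 - j))) []) [0..<?m])"
      using i by (simp add: generic_def close_vars_def comp_def nth_append del: apply_abs.simps)
    ultimately have "msubst (zip ?\<Theta> (generics \<Theta> @ rev us))
        (subst (close_vars (length \<Theta>) 0 ?m) (generic i ?m)) = apply_abs (?m, generic i ?m) us"
      by (simp only:)
    also have "\<dots> = MVar i us"
      using us by (auto simp: generic_def intro!: nth_equalityI)
    finally show ?thesis
      using is_trm_close_vars[OF e] by (simp add: E_comp[OF l])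
  qed
  finally show ?thesis by (simp add: comp_ide_right[OF proj_hom[OF i]])
qed

lemma app_E_eq_val:
  assumes "elementary \<Theta> n e"
  shows "h \<in> Hom T c \<Theta> \<Longrightarrow> vs \<in> elems c n \<Longrightarrow> app [0] (E \<Theta> [e] [n] \<cdot> h) vs = val I h vs e"
  using assms
proof (induction arbitrary: rule: is_trm.induct)
  case (var i n)
  have rvs: "rev vs \<in> elems c n" using var.prems by (auto simp: elems_def)
  have "app [0] (E \<Theta> [Var i] [n] \<cdot> h) vs =
      E (\<Theta> @ replicate n 0) [MVar (length \<Theta> + (n - 1 - i)) []] [0] \<cdot> ext_elems c \<Theta> h (rev vs)"
    using app_E[of \<Theta> 0 n "Var i" h c vs] var by (simp add: close_vars_def)
  also have "\<dots> = rev vs ! (n - 1 - i)"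
  proof -
    have j: "n - 1 - i < n" using var.hyps by simp
    show ?thesis
      unfolding proj_replicate[OF j, symmetric] by (rule proj_ext_elems2[OF var.prems(1) rvs j])
  qed
  finally show ?case using var.hyps elems_length[OF var.prems(2)] by (simp add: rev_nth)
next
  case (mvar i ts n)
  note h = mvar.prems(1) and vs = mvar.prems(2)
  have rvs: "rev vs \<in> elems c n" using vs by (auto simp: elems_def)
  let ?\<Theta> = "\<Theta> @ replicate n 0" and ?k = "ext_elems c \<Theta> h (rev vs)"
    and ?\<sigma> = "close_vars (length \<Theta>) 0 n"
  note k = ext_elems_hom[OF h rvs]
  have ts: "elementary \<Theta> (0 + n) t" if "t \<in> set ts" for t using mvar.IH(1) mvar.hyps that by simp
  have us: "\<forall>u\<in>set (map (subst ?\<sigma>) ts). elementary ?\<Theta> 0 u"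
    using is_trm_close_vars[OF ts] by auto
  have i: "i < length ?\<Theta>" "?\<Theta> ! i = \<Theta> ! i" using mvar.hyps by (auto simp: nth_append)
  have el: "map (\<lambda>u. E ?\<Theta> [u] [0]) (map (subst ?\<sigma>) ts) \<in> elems ?\<Theta> (?\<Theta> ! i)"
    using us i mvar.hyps by (auto simp: elems_def intro!: E_hom)
  have e: "elementary \<Theta> (0 + n) (MVar i ts)" using mvar.hyps ts by simp
  have "app [0] (E \<Theta> [MVar i ts] [n] \<cdot> h) vs = E ?\<Theta> [MVar i (map (subst ?\<sigma>) ts)] [0] \<cdot> ?k"
    using app_E[OF e h vs] by simp
  also have "\<dots> = app [0] (proj ?\<Theta> i) (map (\<lambda>u. E ?\<Theta> [u] [0]) (map (subst ?\<sigma>) ts)) \<cdot> ?k"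
    using app_E_generic[OF i(1) _ us] mvar.hyps i(2) by simp
  also have "\<dots> = app [0] (proj ?\<Theta> i \<cdot> ?k)
      (map (\<lambda>v. v \<cdot> ?k) (map (\<lambda>u. E ?\<Theta> [u] [0]) (map (subst ?\<sigma>) ts)))"
    by (rule app0_comp[OF proj_hom[OF i(1)] el k])
  also have "proj ?\<Theta> i \<cdot> ?k = proj \<Theta> i \<cdot> h"
    by (rule proj_ext_elems1[OF h rvs mvar.hyps(1)])
  also have "map (\<lambda>v. v \<cdot> ?k) (map (\<lambda>u. E ?\<Theta> [u] [0]) (map (subst ?\<sigma>) ts)) = map (val I h vs) ts"
  proof -
    have "E ?\<Theta> [subst ?\<sigma> t] [0] \<cdot> ?k = val I h vs t" if "t \<in> set ts" for t
      using app_E[OF ts[OF that] h vs] mvar.IH[OF that h vs] by simp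
    then show ?thesis by simp
  qed
  finally show ?case by (simp add: HomD(3)[OF h])
qed auto

text \<open>
  Elementary terms denote the arrows that they are in the category of arities, whatever the
  interpretation of the operators. Thus functors defined by denotations commute with the functors from
  arities.
\<close>

lemma sem_elementary: "elementary \<Theta> n e \<Longrightarrow> sem I \<Theta> n e = E \<Theta> [e] [n]"
  by (rule sem_eqI[OF E_hom]) (auto simp: app_E_eq_val)

text \<open>
  The last \<open>d\<close> projections out of \<open>c, (0), \<dots>, (0)\<close> are the generic elements. Applying an
  arrow \<open>c \<rightarrow> (d)\<close> to them uncurries it.
\<close>

definition univ_elems :: "nat list \<Rightarrow> nat \<Rightarrow> 'u list" where
  "univ_elems c d = map (\<lambda>j. proj (c @ replicate d 0) (length c + j)) [0..<d]"

lemma univ_elems: "univ_elems c d \<in> elems (c @ replicate d 0) d"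
proof -
  have "proj (c @ replicate d 0) (length c + j) \<in> Hom T (c @ replicate d 0) [0]" if "j < d" for j
    using proj_hom[of "length c + j" "c @ replicate d 0"] that by (simp add: nth_append)
  then show ?thesis by (auto simp: univ_elems_def elems_def)
qed

lemma univ_elems_ext_elems: "h \<in> Hom T c \<Theta> \<Longrightarrow> vs \<in> elems c d \<Longrightarrow>
    map (\<lambda>v. v \<cdot> ext_elems c \<Theta> h vs) (univ_elems \<Theta> d) = vs"
  by (rule nth_equalityI) (auto simp: univ_elems_def proj_ext_elems2 elems_length)

definition uncurry :: "nat list \<Rightarrow> nat \<Rightarrow> 'u \<Rightarrow> 'u" where
  "uncurry c d g = app [0] (g \<cdot> Fst T c (replicate d 0)) (univ_elems c d)"

lemma uncurry_hom: "g \<in> Hom T c [d] \<Longrightarrow> uncurry c d g \<in> Hom T (c @ replicate d 0) [0]"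
  unfolding uncurry_def by (rule app0_hom[OF comp_hom[OF Fst_hom] univ_elems])

lemma uncurry_ext_elems:
  assumes g: "g \<in> Hom T \<Theta> [d]" and h: "h \<in> Hom T c \<Theta>" and vs: "vs \<in> elems c d"
  shows "uncurry \<Theta> d g \<cdot> ext_elems c \<Theta> h vs = app [0] (g \<cdot> h) vs"
  unfolding uncurry_def app0_comp[OF comp_hom[OF Fst_hom g] univ_elems ext_elems_hom[OF h vs]]
    univ_elems_ext_elems[OF h vs] comp_assoc_right[OF g Fst_hom ext_elems_hom[OF h vs]]
    Fst_ext_elems[OF h vs] ..

lemma uncurry_inject:
  assumes g: "g \<in> Hom T c [d]" and g': "g' \<in> Hom T c [d]" and eq: "uncurry c d g = uncurry c d g'"
  shows "g = g'"
proof (rule app0_ext[OF g g'])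
  fix c' r us assume r: "r \<in> Hom T c' c" and us: "us \<in> elems c' d"
  show "app [0] (g \<cdot> r) us = app [0] (g' \<cdot> r) us"
    using uncurry_ext_elems[OF g r us] uncurry_ext_elems[OF g' r us] eq by simp
qed

lemma val_generic:
  assumes h: "h \<in> Hom T c \<Theta>" and us: "us \<in> elems c m"
  shows "val I h (us @ vs) (generic i m) = app [0] (proj \<Theta> i \<cdot> h) us"
proof -
  have "map (val I h (us @ vs)) (map Var [0..<m]) = us"
    by (rule nth_equalityI) (use elems_length[OF us] in \<open>auto simp: nth_append\<close>)
  then show ?thesis unfolding generic_def by (simp only: val.simps HomD(3)[OF h])
qed

lemma lam_generic:
  assumes i: "i < length \<Theta>" and h: "h \<in> Hom T c \<Theta>"
  shows "lam c (\<Theta> ! i) (\<lambda>r us. val I (h \<cdot> r) (us @ map (\<lambda>v. v \<cdot> r) vs) (generic i (\<Theta> ! i))) =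
    proj \<Theta> i \<cdot> h"
proof (rule lam_eqI[OF comp_hom[OF h proj_hom[OF i]]])
  fix c' r us assume r: "r \<in> Hom T c' c" and us: "us \<in> elems c' (\<Theta> ! i)"
  show "app [0] (proj \<Theta> i \<cdot> h \<cdot> r) us = val I (h \<cdot> r) (us @ map (\<lambda>v. v \<cdot> r) vs) (generic i (\<Theta> ! i))"
    unfolding val_generic[OF comp_hom[OF r h] us] comp_assoc_right[OF proj_hom[OF i] h r] ..
qed

lemma sem_op_trm:
  assumes I: "I \<omega> \<in> Hom T ms [0]"
  shows "sem I ms 0 (op_trm \<omega> ms) = I \<omega>"
proof (rule sem_eqI[OF I])
  fix c h vs assume h: "h \<in> Hom T c ms" and vs: "vs \<in> elems c 0"
  have "tup c ms (map (\<lambda>i. proj ms i \<cdot> h) [0..<length ms]) = h"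
    by (rule tup_eqI[OF h]) (use comp_hom[OF h proj_hom] in \<open>auto simp: tuple_def\<close>)
  moreover have "map (\<lambda>i. lam c (ms ! i) (\<lambda>r us. val I (h \<cdot> r) (us @ map (\<lambda>v. v \<cdot> r) vs)
      (generic i (ms ! i)))) [0..<length ms] = map (\<lambda>i. proj ms i \<cdot> h) [0..<length ms]"
    using lam_generic[OF _ h] by (intro map_cong HOL.refl) simp
  moreover have "val I h vs (op_trm \<omega> ms) = I \<omega> \<cdot> tup c ms (map (\<lambda>i. lam c (ms ! i)
      (\<lambda>r us. val I (h \<cdot> r) (us @ map (\<lambda>v. v \<cdot> r) vs) (generic i (ms ! i)))) [0..<length ms])"
    by (simp add: op_trm_def comp_def map_nth HomD(2)[OF h])
  ultimately have "val I h vs (op_trm \<omega> ms) = I \<omega> \<cdot> h" by (simp only:)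
  then show "app [0] (I \<omega> \<cdot> h) vs = val I h vs (op_trm \<omega> ms)" using vs by simp
qed

text \<open>
  The uncurried arrow is an operator of the internal language. Applied to the metavariables and the
  variables of the context, it denotes the arrow itself.
\<close>

definition arrow_trm :: "nat list \<Rightarrow> nat \<Rightarrow> 'u \<Rightarrow> 'u trm" where
  "arrow_trm ms n f = Op (uncurry ms n f)
     (map (\<lambda>i. (ms ! i, generic i (ms ! i))) [0..<length ms] @ map (\<lambda>j. (0, Var j)) [0..<n])"

lemma is_trm_arrow_trm:
  assumes "f \<in> Hom T ms [n]"
  shows "is_trm (sig_of T) ms n (arrow_trm ms n f)"
  using uncurry_hom[OF assms]
  by (auto simp: arrow_trm_def is_trm_Op sig_of_eq_Some comp_def map_nth map_replicate_const
      is_trm_generic)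

lemma sem_arrow_trm:
  assumes f: "f \<in> Hom T ms [n]"
  shows "sem (\<lambda>f. f) ms n (arrow_trm ms n f) = f"
proof (rule sem_eqI[OF f])
  fix c h vs assume h: "h \<in> Hom T c ms" and vs: "vs \<in> elems c n"
  let ?I = "\<lambda>f. f"
  have 1: "map (\<lambda>i. lam c (ms ! i) (\<lambda>r us. val ?I (h \<cdot> r) (us @ map (\<lambda>v. v \<cdot> r) vs)
      (generic i (ms ! i)))) [0..<length ms] = map (\<lambda>i. proj ms i \<cdot> h) [0..<length ms]"
    using lam_generic[OF _ h] by (intro map_cong HOL.refl) simp
  have "lam c 0 (\<lambda>r us. val ?I (h \<cdot> r) (us @ map (\<lambda>v. v \<cdot> r) vs) (Var j)) = vs ! j" if "j < n" for j
    by (rule lam_eqI) (use that vs in \<open>auto simp: elems_nth elems_length\<close>)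
  then have 2: "map (\<lambda>j. lam c 0 (\<lambda>r us. val ?I (h \<cdot> r) (us @ map (\<lambda>v. v \<cdot> r) vs) (Var j))) [0..<n] = vs"
    using elems_length[OF vs] by (intro nth_equalityI) simp_all
  have "val ?I h vs (arrow_trm ms n f) = uncurry ms n f \<cdot> tup c (ms @ replicate n 0)
      (map (\<lambda>i. lam c (ms ! i) (\<lambda>r us. val ?I (h \<cdot> r) (us @ map (\<lambda>v. v \<cdot> r) vs)
        (generic i (ms ! i)))) [0..<length ms] @
       map (\<lambda>j. lam c 0 (\<lambda>r us. val ?I (h \<cdot> r) (us @ map (\<lambda>v. v \<cdot> r) vs) (Var j))) [0..<n])"
    by (simp add: arrow_trm_def comp_def map_nth map_replicate_const HomD(2)[OF h])
  then have "val ?I h vs (arrow_trm ms n f) = uncurry ms n f \<cdot> ext_elems c ms h vs"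
    by (simp only: 1 2 ext_elems_def elems_length[OF vs])
  then show "app [0] (f \<cdot> h) vs = val ?I h vs (arrow_trm ms n f)"
    using uncurry_ext_elems[OF f h vs] by simp
qed

end

section \<open>Algebraic translations and interpretations\<close>

lemma is_functor_extensional: "is_functor C D F \<Longrightarrow> AMap F \<in> extensional (Arr C)"
  by (auto simp: is_functor_def PiE_def)

text \<open>
  As the projections of a theory are images of elementary arrows, a functor that commutes with the
  functors from arities preserves finite products.
\<close>

lemma is_alg_translationI:
  assumes "is_alg_theory S" "is_alg_theory T" and F: "is_functor S T F"
    and OM: "\<And>a. OMap F a = a"
    and AM: "\<And>a. a \<in> Arr \<bbbM> \<Longrightarrow> AMap F (AMap (Emb S) a) = AMap (Emb T) a"
  shows "is_alg_translation S T F"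
proof -
  interpret S: second_order_theory S by unfold_locales (rule assms)
  interpret T: second_order_theory T by unfold_locales (rule assms)
  have E: "AMap F (S.E ms ts ns) = T.E ms ts ns" if "list_all2 (elementary ms) ns ts" for ms ns ts
    using that by (intro AM) (simp add: arity_cat_def)
  have Fst: "AMap F (Fst S a b) = Fst T a b" for a b
    unfolding S.Fst_T T.Fst_T by (rule E[OF trms_generics_append])
  have Snd: "AMap F (Snd S a b) = Snd T a b" for a b
    unfolding S.Snd_T T.Snd_T by (rule E[OF trms_Snd])
  have "cartesian_functor S T F"
    unfolding cartesian_functor_def
    using S.cartesian_T T.cartesian_T F T.is_product_T
    by (simp add: OM Fst Snd) (simp add: cartesian_def)
  moreover have "comp_ftr \<bbbM> F (Emb S) = Emb T"
  proof -
    have "AMap (comp_ftr \<bbbM> F (Emb S)) = AMap (Emb T)"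
    proof (rule extensionalityI[of _ "Arr \<bbbM>"])
      show "AMap (Emb T) \<in> extensional (Arr \<bbbM>)" by (rule is_functor_extensional[OF T.functor_Emb])
      show "AMap (comp_ftr \<bbbM> F (Emb S)) a = AMap (Emb T) a" if "a \<in> Arr \<bbbM>" for a
        using that AM by (simp add: comp_ftr_def compose_def)
    qed (simp add: comp_ftr_def)
    moreover have "OMap (comp_ftr \<bbbM> F (Emb S)) = OMap (Emb T)"
      by (rule ext) (simp add: comp_ftr_def compose_def arity_cat_def OM)
    ultimately show ?thesis by (cases "Emb T") (simp add: comp_ftr_def)
  qed
  ultimately show ?thesis by (simp add: is_alg_translation_def)
qed

locale algebraic_translation =
  S: second_order_theory S + T: second_order_theory T for S T :: "'u alg_theory" +
  fixes H :: "(nat list, 'u, nat list, 'u) ftr"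
  assumes translation: "is_alg_translation S T H"
begin

lemma functor_H: "is_functor S T H"
  using translation by (simp add: is_alg_translation_def cartesian_functor_def)

lemma OMap_H [simp]: "OMap H a = a"
proof -
  have "OMap (comp_ftr \<bbbM> H (Emb S)) a = OMap (Emb T) a"
    using translation by (simp add: is_alg_translation_def)
  then show ?thesis by (simp add: comp_ftr_def compose_def arity_cat_def)
qed

lemma H_Emb: "a \<in> Arr \<bbbM> \<Longrightarrow> AMap H (AMap (Emb S) a) = AMap (Emb T) a"
proof -
  assume a: "a \<in> Arr \<bbbM>"
  have "AMap (comp_ftr \<bbbM> H (Emb S)) a = AMap (Emb T) a"
    using translation by (simp add: is_alg_translation_def)
  then show ?thesis using a by (simp add: comp_ftr_def compose_def)
qed

lemma H_E: "list_all2 (elementary ms) ns ts \<Longrightarrow> AMap H (S.E ms ts ns) = T.E ms ts ns"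
  by (rule H_Emb) (simp add: arity_cat_def)

lemma H_hom: "f \<in> Hom S a b \<Longrightarrow> AMap H f \<in> Hom T a b"
  using is_functor_Hom[OF functor_H, of f a b] by simp

lemma H_comp: "f \<in> Hom S a b \<Longrightarrow> g \<in> Hom S b c \<Longrightarrow>
    AMap H (g \<cdot>\<^bsub>S\<^esub> f) = AMap H g \<cdot>\<^bsub>T\<^esub> AMap H f"
  by (rule is_functor_Comp[OF functor_H])

lemma H_proj: "i < length ms \<Longrightarrow> AMap H (S.proj ms i) = T.proj ms i"
  unfolding S.proj_def T.proj_def by (rule H_E) (simp add: is_trm_generic)

lemma H_Fst: "AMap H (Fst S a b) = Fst T a b"
  unfolding S.Fst_T T.Fst_T by (rule H_E[OF trms_generics_append])

lemma H_Snd: "AMap H (Snd S a b) = Snd T a b"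
  unfolding S.Snd_T T.Snd_T by (rule H_E[OF trms_Snd])

lemma H_tuple: "S.tuple c ns fs \<Longrightarrow> T.tuple c ns (map (AMap H) fs)"
  by (auto simp: S.tuple_def T.tuple_def H_hom)

lemma H_tup:
  assumes "S.tuple c ns fs"
  shows "AMap H (S.tup c ns fs) = T.tup c ns (map (AMap H) fs)"
proof (rule T.tup_eqI[symmetric, OF H_hom[OF S.tup_hom[OF assms]] H_tuple[OF assms]])
  fix i assume i: "i < length ns"
  have "T.proj ns i \<cdot>\<^bsub>T\<^esub> AMap H (S.tup c ns fs) = AMap H (S.proj ns i \<cdot>\<^bsub>S\<^esub> S.tup c ns fs)"
    by (simp add: H_comp[OF S.tup_hom[OF assms] S.proj_hom[OF i]] H_proj i)
  then show "T.proj ns i \<cdot>\<^bsub>T\<^esub> AMap H (S.tup c ns fs) = map (AMap H) fs ! i"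
    using assms i by (simp add: S.proj_tup S.tuple_def)
qed

lemma H_pair:
  assumes "h \<in> Hom S c a" "v \<in> Hom S c b"
  shows "AMap H (S.pair a b h v) = T.pair a b (AMap H h) (AMap H v)"
proof (rule T.pair_eqI[symmetric])
  note p = S.pair_hom[OF assms]
  show "AMap H (S.pair a b h v) \<in> Hom T c (a @ b)" by (rule H_hom[OF p])
  show "Fst T a b \<cdot>\<^bsub>T\<^esub> AMap H (S.pair a b h v) = AMap H h"
    using H_comp[OF p S.Fst_hom] by (simp add: H_Fst S.Fst_pair[OF assms])
  show "Snd T a b \<cdot>\<^bsub>T\<^esub> AMap H (S.pair a b h v) = AMap H v"
    using H_comp[OF p S.Snd_hom] by (simp add: H_Snd S.Snd_pair[OF assms])
qed

lemma H_elems: "vs \<in> S.elems c d \<Longrightarrow> map (AMap H) vs \<in> T.elems c d"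
  by (auto simp: S.elems_def T.elems_def H_hom)

lemma H_app1:
  assumes "g \<in> Hom S c (map Suc b)" "v \<in> Hom S c [0]"
  shows "AMap H (S.app1 b g v) = T.app1 b (AMap H g) (AMap H v)"
proof -
  have "(arity_eval b :: 'u arity_arrow) \<in> Arr \<bbbM>"
    by (auto simp: arity_eval_def arity_exp_def arity_cat_def list_all2_conv_all_nth nth_append)
  then show ?thesis
    unfolding S.app1_def T.app1_def H_comp[OF S.pair_hom[OF assms] S.eval_hom]
    by (simp add: H_Emb H_pair[OF assms])
qed

lemma H_app:
  "g \<in> Hom S c (S.raise d b) \<Longrightarrow> vs \<in> S.elems c d \<Longrightarrow>
    AMap H (S.app b g vs) = T.app b (AMap H g) (map (AMap H) vs)"
proof (induction vs arbitrary: b d)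
  case (Cons v vs)
  then obtain d' where d: "d = Suc d'" by (cases d) (auto simp: S.elems_def)
  have g: "g \<in> Hom S c (S.raise d' (map Suc b))" and vs: "vs \<in> S.elems c d'" "v \<in> Hom S c [0]"
    using Cons.prems d by (auto simp: comp_def)
  show ?case using H_app1[OF S.app_hom[OF g vs(1)] vs(2)] Cons.IH[OF g vs(1)] by simp
qed simp

lemma H_app0:
  "g \<in> Hom S c [d] \<Longrightarrow> vs \<in> S.elems c d \<Longrightarrow>
    AMap H (S.app [0] g vs) = T.app [0] (AMap H g) (map (AMap H) vs)"
  by (rule H_app[of g c d]) auto

lemma H_univ_elems: "map (AMap H) (S.univ_elems c d) = T.univ_elems c d"
  by (simp add: S.univ_elems_def T.univ_elems_def H_proj)

lemma H_uncurry:
  assumes "g \<in> Hom S c [d]"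
  shows "AMap H (S.uncurry c d g) = T.uncurry c d (AMap H g)"
  unfolding S.uncurry_def T.uncurry_def
    H_app0[OF S.comp_hom[OF S.Fst_hom assms] S.univ_elems] H_comp[OF S.Fst_hom assms]
  by (simp add: H_Fst H_univ_elems)

text \<open>
  Not every arrow of \<open>T\<close> into \<open>c\<close> is in the image of \<open>H\<close>, but by naturality the families need to be
  compared at the generic elements only.
\<close>

lemma H_lam:
  assumes \<phi>: "S.natural_family c [0] d \<phi>" and \<phi>': "T.natural_family c [0] d \<phi>'"
    and eq: "AMap H (\<phi> (Fst S c (replicate d 0)) (S.univ_elems c d)) =
      \<phi>' (Fst T c (replicate d 0)) (T.univ_elems c d)"
  shows "AMap H (S.lam c d \<phi>) = T.lam c d \<phi>'"
proof (rule T.uncurry_inject[OF H_hom[OF S.lam_hom[OF \<phi>]] T.lam_hom[OF \<phi>']])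
  show "T.uncurry c d (AMap H (S.lam c d \<phi>)) = T.uncurry c d (T.lam c d \<phi>')"
    unfolding H_uncurry[OF S.lam_hom[OF \<phi>], symmetric]
    unfolding S.uncurry_def T.uncurry_def S.app_lam[OF \<phi> S.Fst_hom S.univ_elems]
      T.app_lam[OF \<phi>' T.Fst_hom T.univ_elems]
    by (rule eq)
qed

lemma H_interprets: "S.interprets I \<Sigma> \<Longrightarrow> T.interprets (\<lambda>\<omega>. AMap H (I \<omega>)) \<Sigma>"
  by (simp add: S.interprets_def T.interprets_def H_hom)

text \<open>
  An algebraic translation preserves all operations in the definition of \<open>val\<close>; for the arrows that
  represent the bodies of abstractions this is \<open>H_lam\<close>.
\<close>

lemma H_val:
  assumes I: "S.interprets I \<Sigma>" and t: "is_trm \<Sigma> \<Theta> n t"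
  shows "h \<in> Hom S c \<Theta> \<Longrightarrow> vs \<in> S.elems c n \<Longrightarrow>
    AMap H (S.val I h vs t) = T.val (\<lambda>\<omega>. AMap H (I \<omega>)) (AMap H h) (map (AMap H) vs) t"
  using t
proof (induction arbitrary: c h vs rule: is_trm.induct)
  case (var i n)
  then show ?case by (simp add: S.elems_length)
next
  case (mvar i ts n)
  note h = mvar.prems(1) and vs = mvar.prems(2) and i = mvar.hyps(1)
  note ph = S.comp_hom[OF h S.proj_hom[OF i]]
  have trm: "is_trm \<Sigma> \<Theta> n t" if "t \<in> set ts" for t using mvar.IH(1) mvar.hyps that by blast
  have ts: "map (S.val I h vs) ts \<in> S.elems c (\<Theta> ! i)"
    using S.val_hom[OF I trm h vs] mvar.hyps by (auto simp: S.elems_def)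
  have "map (AMap H) (map (S.val I h vs) ts) =
      map (T.val (\<lambda>\<omega>. AMap H (I \<omega>)) (AMap H h) (map (AMap H) vs)) ts"
    using mvar.IH h vs by simp
  then show ?case
    by (simp only: S.val.simps T.val.simps HomD(3)[OF h] HomD(3)[OF H_hom[OF h]] H_app0[OF ph ts]
        H_comp[OF h S.proj_hom[OF i]] H_proj[OF i])
next
  case (op \<omega> as n)
  note h = op.prems(1) and vs = op.prems(2)
  let ?J = "\<lambda>\<omega>. AMap H (I \<omega>)"
  let ?ls = "map (\<lambda>(k, t). S.lam c k (\<lambda>r us. S.val I (h \<cdot>\<^bsub>S\<^esub> r) (us @ map (\<lambda>v. v \<cdot>\<^bsub>S\<^esub> r) vs) t)) as"
  let ?ls' = "map (\<lambda>(k, t). T.lam c k (\<lambda>r us. T.val ?J (AMap H h \<cdot>\<^bsub>T\<^esub> r)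
    (us @ map (\<lambda>v. v \<cdot>\<^bsub>T\<^esub> r) (map (AMap H) vs)) t)) as"
  have trm: "is_trm \<Sigma> \<Theta> (k + n) t" if "(k, t) \<in> set as" for k t using op.IH op.hyps that by blast
  have \<omega>: "I \<omega> \<in> Hom S (map fst as) [0]" using I op.hyps by (simp add: S.interprets_def)
  have tup: "S.tuple c (map fst as) ?ls" by (rule S.tuple_lam_val[OF I trm h vs])
  have "AMap H (S.lam c k (\<lambda>r us. S.val I (h \<cdot>\<^bsub>S\<^esub> r) (us @ map (\<lambda>v. v \<cdot>\<^bsub>S\<^esub> r) vs) t)) =
    T.lam c k (\<lambda>r us. T.val ?J (AMap H h \<cdot>\<^bsub>T\<^esub> r) (us @ map (\<lambda>v. v \<cdot>\<^bsub>T\<^esub> r) (map (AMap H) vs)) t)"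
    if kt: "(k, t) \<in> set as" for k t
  proof (rule H_lam[OF S.natural_family_val_body[OF I trm[OF kt] h vs]
          T.natural_family_val_body[OF H_interprets[OF I] trm[OF kt] H_hom[OF h] H_elems[OF vs]]])
    let ?r = "Fst S c (replicate k 0)" and ?us = "S.univ_elems c k"
    have el: "?us @ map (\<lambda>v. v \<cdot>\<^bsub>S\<^esub> ?r) vs \<in> S.elems (c @ replicate k 0) (k + n)"
      by (rule S.elems_append[OF S.univ_elems S.elems_comp[OF vs S.Fst_hom]])
    have "map (AMap H) (map (\<lambda>v. v \<cdot>\<^bsub>S\<^esub> ?r) vs) =
        map (\<lambda>v. v \<cdot>\<^bsub>T\<^esub> Fst T c (replicate k 0)) (map (AMap H) vs)"
      using vs H_comp[OF S.Fst_hom] by (auto simp: S.elems_def H_Fst)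
    then show "AMap H (S.val I (h \<cdot>\<^bsub>S\<^esub> ?r) (?us @ map (\<lambda>v. v \<cdot>\<^bsub>S\<^esub> ?r) vs) t) =
        T.val ?J (AMap H h \<cdot>\<^bsub>T\<^esub> Fst T c (replicate k 0)) (T.univ_elems c k @
          map (\<lambda>v. v \<cdot>\<^bsub>T\<^esub> Fst T c (replicate k 0)) (map (AMap H) vs)) t"
      by (simp only: op.IH[OF kt S.comp_hom[OF S.Fst_hom h] el] H_comp[OF S.Fst_hom h] H_Fst
          map_append H_univ_elems)
  qed
  then have "map (AMap H) ?ls = ?ls'" unfolding map_map by (auto intro!: map_cong)
  then show ?case
    by (simp only: S.val.simps T.val.simps HomD(2)[OF h] HomD(2)[OF H_hom[OF h]]
        H_comp[OF S.tup_hom[OF tup] \<omega>] H_tup[OF tup])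
qed

lemma H_sem:
  assumes I: "S.interprets I \<Sigma>" and t: "is_trm \<Sigma> \<Theta> n t"
  shows "AMap H (S.sem I \<Theta> n t) = T.sem (\<lambda>\<omega>. AMap H (I \<omega>)) \<Theta> n t"
  unfolding S.sem_def T.sem_def
  by (rule H_lam[OF S.natural_family_sem[OF I t] T.natural_family_sem[OF H_interprets[OF I] t]])
    (simp add: H_val[OF I t S.Fst_hom S.univ_elems] H_Fst H_univ_elems)

text \<open>
  An arrow is determined by its components, and a component \<open>ms \<rightarrow> (n)\<close> by its uncurried form,
  which is an arrow into \<open>(0)\<close>; algebraic translations preserve both.
\<close>

lemma H_determined:
  assumes K: "algebraic_translation S T K"
    and eq: "\<And>f ms. f \<in> Hom S ms [0] \<Longrightarrow> AMap H f = AMap K f"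
  shows "H = K"
proof -
  interpret K: algebraic_translation S T K by (rule K)
  have 1: "AMap H f = AMap K f" if f: "f \<in> Hom S ms [n]" for f ms n
    by (rule T.uncurry_inject[OF H_hom[OF f] K.H_hom[OF f]])
      (simp add: H_uncurry[OF f, symmetric] K.H_uncurry[OF f, symmetric] eq[OF S.uncurry_hom[OF f]])
  have 2: "AMap H f = AMap K f" if f: "f \<in> Hom S ms ns" for f ms ns
  proof (rule T.proj_ext[OF H_hom[OF f] K.H_hom[OF f]])
    fix i assume i: "i < length ns"
    note p = S.proj_hom[OF i]
    show "T.proj ns i \<cdot>\<^bsub>T\<^esub> AMap H f = T.proj ns i \<cdot>\<^bsub>T\<^esub> AMap K f"
      using 1[OF S.comp_hom[OF f p]] i by (simp add: H_comp[OF f p] K.H_comp[OF f p] H_proj K.H_proj)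
  qed
  have "AMap H = AMap K"
  proof (rule extensionalityI[of _ "Arr S"])
    show "AMap H f = AMap K f" if "f \<in> Arr S" for f
      by (rule 2[of f "Dom S f" "Cod S f"]) (use that in \<open>simp add: Hom_def\<close>)
  qed (rule is_functor_extensional[OF functor_H] is_functor_extensional[OF K.functor_H])+
  moreover have "OMap H = OMap K" by (rule ext) simp
  ultimately show ?thesis by (cases H, cases K) simp
qed

end

context second_order_theory
begin

lemma tup_single: "f \<in> Hom T c [n] \<Longrightarrow> tup c [n] [f] = f"
proof (rule tup_eqI)
  assume f: "f \<in> Hom T c [n]"
  have "proj [n] 0 = Ide T [n]" unfolding E_ide[symmetric] by (simp add: proj_def generics_def)
  then show "proj [n] i \<cdot> f = [f] ! i" if "i < length [n]" for i
    using that comp_ide_left[OF f] by simp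
qed (auto simp: tuple_def)

definition sems :: "('v \<Rightarrow> 'u) \<Rightarrow> nat list \<Rightarrow> nat list \<Rightarrow> 'v trm list \<Rightarrow> 'u list" where
  "sems I \<Theta> ns ts = map (\<lambda>i. sem I \<Theta> (ns ! i) (ts ! i)) [0..<length ns]"

lemma tuple_sems:
  "interprets I \<Sigma> \<Longrightarrow> list_all2 (is_trm \<Sigma> \<Theta>) ns ts \<Longrightarrow> tuple \<Theta> ns (sems I \<Theta> ns ts)"
  by (auto simp: tuple_def sems_def list_all2_conv_all_nth intro!: sem_hom)

definition arrow_trms :: "'u \<Rightarrow> 'u trm list" where
  "arrow_trms f = map (\<lambda>i. arrow_trm (Dom T f) (Cod T f ! i) (proj (Cod T f) i \<cdot> f))
     [0..<length (Cod T f)]"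

lemma is_trm_arrow_trms:
  "f \<in> Hom T ms ns \<Longrightarrow> list_all2 (is_trm (sig_of T) ms) ns (arrow_trms f)"
  by (auto simp: arrow_trms_def list_all2_conv_all_nth HomD
      intro!: is_trm_arrow_trm comp_hom[OF _ proj_hom])

lemma sem_nth_arrow_trms:
  "f \<in> Hom T ms ns \<Longrightarrow> i < length ns \<Longrightarrow>
    sem (\<lambda>f. f) ms (ns ! i) (arrow_trms f ! i) = proj ns i \<cdot> f"
  by (simp add: arrow_trms_def HomD sem_arrow_trm[OF comp_hom[OF _ proj_hom]])

lemma tup_sems_arrow_trms:
  assumes "f \<in> Hom T ms ns"
  shows "tup ms ns (sems (\<lambda>f. f) ms ns (arrow_trms f)) = f"
  by (rule tup_eqI[OF assms tuple_sems[OF interprets_sig_of is_trm_arrow_trms[OF assms]]])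
    (simp add: sems_def sem_nth_arrow_trms[OF assms])

end

text \<open>
  Conversely, an interpretation in \<open>T\<close> of the arrows of \<open>S\<close> into \<open>(0)\<close> that satisfies all equations
  true in \<open>S\<close> extends to an algebraic translation: every arrow of \<open>S\<close> is denoted by terms, and their
  denotations in \<open>T\<close> do not depend on the choice of the terms.
\<close>

locale interpretation_between =
  S: second_order_theory S + T: second_order_theory T for S T :: "'u alg_theory" +
  fixes J :: "'u \<Rightarrow> 'u"
  assumes J: "T.interprets J (sig_of S)"
    and resp: "\<And>\<Theta> n s t. is_trm (sig_of S) \<Theta> n s \<Longrightarrow> is_trm (sig_of S) \<Theta> n t \<Longrightarrow>
      S.sem (\<lambda>f. f) \<Theta> n s = S.sem (\<lambda>f. f) \<Theta> n t \<Longrightarrow> T.sem J \<Theta> n s = T.sem J \<Theta> n t"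
begin

definition K :: "(nat list, 'u, nat list, 'u) ftr" where
  "K = \<lparr>OMap = \<lambda>a\<in>Obj S. a,
        AMap = \<lambda>f\<in>Arr S. T.tup (Dom S f) (Cod S f) (T.sems J (Dom S f) (Cod S f) (S.arrow_trms f))\<rparr>"

lemma AMap_K:
  assumes "f \<in> Hom S ms ns"
  shows "AMap K f = T.tup ms ns (T.sems J ms ns (S.arrow_trms f))"
  using assms by (simp add: K_def Hom_def)

lemma AMap_K_hom: "f \<in> Hom S ms ns \<Longrightarrow> AMap K f \<in> Hom T ms ns"
  by (simp add: AMap_K T.tup_hom[OF T.tuple_sems[OF J S.is_trm_arrow_trms]])

lemma AMap_K_sems:
  assumes ts: "list_all2 (is_trm (sig_of S) ms) ns ts"
  shows "AMap K (S.tup ms ns (S.sems (\<lambda>f. f) ms ns ts)) = T.tup ms ns (T.sems J ms ns ts)"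
proof -
  let ?f = "S.tup ms ns (S.sems (\<lambda>f. f) ms ns ts)"
  note tup = S.tuple_sems[OF S.interprets_sig_of ts]
  note f = S.tup_hom[OF tup]
  have "T.sem J ms (ns ! i) (S.arrow_trms ?f ! i) = T.sem J ms (ns ! i) (ts ! i)" if "i < length ns" for i
  proof (rule resp)
    show "is_trm (sig_of S) ms (ns ! i) (S.arrow_trms ?f ! i)" "is_trm (sig_of S) ms (ns ! i) (ts ! i)"
      using S.is_trm_arrow_trms[OF f] ts that by (auto simp: list_all2_conv_all_nth)
    show "S.sem (\<lambda>f. f) ms (ns ! i) (S.arrow_trms ?f ! i) = S.sem (\<lambda>f. f) ms (ns ! i) (ts ! i)"
      using that by (simp add: S.sem_nth_arrow_trms[OF f] S.proj_tup[OF tup]) (simp add: S.sems_def)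
  qed
  then have "T.sems J ms ns (S.arrow_trms ?f) = T.sems J ms ns ts"
    by (simp add: T.sems_def)
  then show ?thesis by (simp add: AMap_K[OF f])
qed

lemma AMap_K_comp:
  assumes f: "f \<in> Hom S ms ns" and g: "g \<in> Hom S ns ls"
  shows "AMap K (g \<cdot>\<^bsub>S\<^esub> f) = AMap K g \<cdot>\<^bsub>T\<^esub> AMap K f"
proof (rule T.proj_ext[OF AMap_K_hom[OF S.comp_hom[OF f g]] T.comp_hom[OF AMap_K_hom[OF f] AMap_K_hom[OF g]]])
  fix i assume i: "i < length ls"
  let ?ts = "S.arrow_trms g ! i" and ?ss = "S.arrow_trms f"
  note gf = S.comp_hom[OF f g]
  note tf = S.is_trm_arrow_trms[OF f] and tg = S.is_trm_arrow_trms[OF g] and tgf = S.is_trm_arrow_trms[OF gf]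
  have t: "is_trm (sig_of S) ns (ls ! i) ?ts" using tg i by (simp add: list_all2_conv_all_nth)
  have ok: "abs_ok (sig_of S) ms ns (ls ! i) (zip ns ?ss)"
    by (rule abs_ok_zip_list_all2[OF tf])
  note pg = T.tuple_sems[OF J tg] and pgf = T.tuple_sems[OF J tgf]
  have "T.proj ls i \<cdot>\<^bsub>T\<^esub> AMap K (g \<cdot>\<^bsub>S\<^esub> f) = T.sem J ms (ls ! i) (S.arrow_trms (g \<cdot>\<^bsub>S\<^esub> f) ! i)"
    using i by (simp add: AMap_K[OF gf] T.proj_tup[OF pgf]) (simp add: T.sems_def)
  also have "\<dots> = T.sem J ms (ls ! i) (msubst (zip ns ?ss) ?ts)"
  proof (rule resp[OF _ is_trm_msubst[OF t ok]])
    show "is_trm (sig_of S) ms (ls ! i) (S.arrow_trms (g \<cdot>\<^bsub>S\<^esub> f) ! i)"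
      using tgf i by (simp add: list_all2_conv_all_nth)
    have "S.sem (\<lambda>f. f) ms (ls ! i) (msubst (zip ns ?ss) ?ts) = S.proj ls i \<cdot>\<^bsub>S\<^esub> g \<cdot>\<^bsub>S\<^esub> f"
      using S.sem_comp_sems[OF S.interprets_sig_of t tf]
      by (simp add: S.sem_nth_arrow_trms[OF g i] S.sems_def[symmetric] S.tup_sems_arrow_trms[OF f])
    then show "S.sem (\<lambda>f. f) ms (ls ! i) (S.arrow_trms (g \<cdot>\<^bsub>S\<^esub> f) ! i) =
        S.sem (\<lambda>f. f) ms (ls ! i) (msubst (zip ns ?ss) ?ts)"
      by (simp add: S.sem_nth_arrow_trms[OF gf i] S.comp_assoc_right[OF S.proj_hom[OF i] g f])
  qed
  also have "\<dots> = T.sem J ns (ls ! i) ?ts \<cdot>\<^bsub>T\<^esub> AMap K f"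
    unfolding AMap_K[OF f] T.sems_def by (rule T.sem_comp_sems[OF J t tf, symmetric])
  also have "T.sem J ns (ls ! i) ?ts = T.proj ls i \<cdot>\<^bsub>T\<^esub> AMap K g"
    using i by (simp add: AMap_K[OF g] T.proj_tup[OF pg]) (simp add: T.sems_def)
  finally show "T.proj ls i \<cdot>\<^bsub>T\<^esub> AMap K (g \<cdot>\<^bsub>S\<^esub> f) = T.proj ls i \<cdot>\<^bsub>T\<^esub> (AMap K g \<cdot>\<^bsub>T\<^esub> AMap K f)"
    by (simp add: T.comp_assoc_right[OF T.proj_hom[OF i] AMap_K_hom[OF g] AMap_K_hom[OF f]])
qed

lemma AMap_K_E:
  assumes ts: "list_all2 (elementary ms) ns ts"
  shows "AMap K (S.E ms ts ns) = T.E ms ts ns"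
proof -
  have "map (\<lambda>i. S.E ms [ts ! i] [ns ! i]) [0..<length ns] = S.sems (\<lambda>f. f) ms ns ts"
    "map (\<lambda>i. T.E ms [ts ! i] [ns ! i]) [0..<length ns] = T.sems J ms ns ts"
    using ts unfolding S.sems_def T.sems_def
    by (auto simp: list_all2_conv_all_nth S.sem_elementary T.sem_elementary)
  then show ?thesis
    using AMap_K_sems[OF list_all2_mono[OF ts elementary_is_trm]]
    by (simp add: S.E_as_tup[OF ts] T.E_as_tup[OF ts])
qed

lemma AMap_K_operator:
  assumes f: "f \<in> Hom S ms [0]"
  shows "AMap K f = J f"
proof -
  have t: "is_trm (sig_of S) ms 0 (op_trm f ms)"
    by (rule is_trm_op_trm) (simp add: sig_of_eq_Some f)
  have Jf: "J f \<in> Hom T ms [0]" using J f by (simp add: T.interprets_def sig_of_eq_Some)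
  show ?thesis
    using AMap_K_sems[of ms "[0]" "[op_trm f ms]"] t
    by (simp add: S.sems_def T.sems_def S.sem_op_trm[of "\<lambda>f. f", OF f] T.sem_op_trm[of J, OF Jf] S.tup_single[OF f]
        T.tup_single[OF Jf])
qed

lemma is_alg_translation_K: "is_alg_translation S T K"
proof (rule is_alg_translationI[OF S.alg_theory T.alg_theory])
  show OM: "OMap K a = a" for a by (simp add: K_def)
  show "AMap K (AMap (Emb S) a) = AMap (Emb T) a" if "a \<in> Arr \<bbbM>" for a
    using that AMap_K_E by (cases a) (auto simp: arity_cat_def)
  show "is_functor S T K"
    unfolding is_functor_def
  proof (intro conjI ballI impI)
    show "AMap K \<in> Arr S \<rightarrow>\<^sub>E Arr T"
      using AMap_K_hom[of _ "Dom S _" "Cod S _"] by (auto simp: K_def Hom_def)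
    show "OMap K \<in> Obj S \<rightarrow>\<^sub>E Obj T" by (auto simp: K_def)
    show "AMap K (Ide S a) = Ide T (OMap K a)" for a
      using AMap_K_E[OF trms_generics] by (simp add: OM S.E_ide T.E_ide)
    show "AMap K (g \<cdot>\<^bsub>S\<^esub> f) = AMap K g \<cdot>\<^bsub>T\<^esub> AMap K f"
      if "f \<in> Arr S" "g \<in> Arr S" "Cod S f = Dom S g" for f g
      by (rule AMap_K_comp[of f "Dom S f" "Cod S f"]) (use that in \<open>auto simp: Hom_def\<close>)
    fix f assume "f \<in> Arr S"
    then have "AMap K f \<in> Hom T (Dom S f) (Cod S f)" by (intro AMap_K_hom) (simp add: Hom_def)
    then show "Dom T (AMap K f) = OMap K (Dom S f)" "Cod T (AMap K f) = OMap K (Cod S f)"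
      by (simp_all add: OM Hom_def)
  qed (use S.category_axioms T.category_axioms in auto)
qed

end

section \<open>Categories of tuples of terms\<close>

lemma shift_abs_zip:
  "list_all2 (is_trm \<Sigma> \<Theta>) ms ss \<Longrightarrow> map (shift_abs k) (zip ms ss) = zip ms ss"
  by (auto simp: list_all2_iff simp del: shift_abs.simps intro!: map_idI intro: shift_abs_id)

lemma msubst_msubst_zip:
  assumes "list_all2 (is_trm \<Sigma> \<Theta>) ms ss" "list_all2 (is_trm \<Sigma> ms) ns ts" "is_trm \<Sigma> ns n u"
  shows "msubst (zip ms ss) (msubst (zip ns ts) u) = msubst (zip ns (map (msubst (zip ms ss)) ts)) u"
proof -
  have "map (\<lambda>(k, s). (k, msubst (map (shift_abs k) (zip ms ss)) s)) (zip ns ts) =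
    zip ns (map (msubst (zip ms ss)) ts)"
    by (simp add: shift_abs_zip[OF assms(1)] zip_map2)
  then show ?thesis
    using msubst_msubst[OF assms(3) abs_ok_zip_list_all2[OF assms(2)] abs_ok_zip_list_all2[OF assms(1)]]
    by simp
qed

lemma is_trm_msubst_zip:
  "is_trm \<Sigma> ms n t \<Longrightarrow> list_all2 (is_trm \<Sigma> \<Theta>) ms ss \<Longrightarrow> is_trm \<Sigma> \<Theta> n (msubst (zip ms ss) t)"
  by (rule is_trm_msubst[OF _ abs_ok_zip_list_all2])

lemma list_all2_msubst_zip:
  "list_all2 (is_trm \<Sigma> ms) ns ts \<Longrightarrow> list_all2 (is_trm \<Sigma> \<Theta>) ms ss \<Longrightarrow>
    list_all2 (is_trm \<Sigma> \<Theta>) ns (map (msubst (zip ms ss)) ts)"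
  by (auto simp: list_all2_conv_all_nth is_trm_msubst_zip[unfolded list_all2_conv_all_nth])

lemma map_msubst_generics:
  assumes "list_all2 (is_trm \<Sigma> a) b ts"
  shows "map (msubst (zip a (generics a))) ts = ts"
proof (rule map_idI)
  fix t assume "t \<in> set ts"
  then obtain i where "is_trm \<Sigma> a (b ! i) t"
    using assms by (auto simp: in_set_conv_nth list_all2_conv_all_nth)
  then show "msubst (zip a (generics a)) t = t" by (rule msubst_generics) simp_all
qed

lemma msubst_zip_generic:
  assumes "list_all2 (is_trm \<Sigma> c) ms ss" "i < length ms"
  shows "msubst (zip ms ss) (generic i (ms ! i)) = ss ! i"
  using assms by (intro msubst_generic[of _ _ _ _ \<Sigma> c]) (auto simp: list_all2_conv_all_nth)

text \<open>
  Exchanging the last metavariable, of arity \<open>0\<close>, for a last variable: this is the exponential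
  adjunction. \<open>close_last\<close> and \<open>open_last\<close> are the two directions.
\<close>

definition close_last :: "nat list \<Rightarrow> nat \<Rightarrow> nat \<Rightarrow> 'u trm" where
  "close_last c m = (\<lambda>j. if j < m then Var j else MVar (length c) [])"

definition open_last :: "nat list \<Rightarrow> nat \<Rightarrow> 'u abs list" where
  "open_last c m = zip c (generics c) @ [(0, Var m)]"

lemma open_last_nth: "i < length c \<Longrightarrow> open_last c m ! i = (c ! i, generic i (c ! i))"
  "open_last c m ! length c = (0, Var m)"
  by (simp_all add: open_last_def nth_append)

lemma shift_open_last: "map (shift_abs k) (open_last c m) = open_last c (k + m)"
  by (auto simp: open_last_def in_set_zip add.commute simp del: shift_abs.simps(1) intro!: map_idI) simp

lemma apply_abs_generic: "length us = m \<Longrightarrow> apply_abs (m, generic i m) us = MVar i us"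
  by (auto simp: generic_def intro!: nth_equalityI)

lemma lift_close_last: "lift k (close_last c m) = close_last c (k + m)"
  by (auto simp: lift_def close_last_def fun_eq_iff)

lemma open_close_last:
  "is_trm \<Sigma> c n u \<Longrightarrow> n = Suc m \<Longrightarrow> msubst (open_last c m) (subst (close_last c m) u) = u"
proof (induction arbitrary: m rule: is_trm.induct)
  case (var i n)
  then show ?case by (auto simp: close_last_def open_last_nth)
next
  case (mvar i ts n)
  have "map (msubst (open_last c m)) (map (subst (close_last c m)) ts) = ts"
    using mvar by (auto intro!: map_idI)
  then show ?case using mvar.hyps by (simp add: open_last_nth apply_abs_generic del: apply_abs.simps)
next
  case (op \<omega> as n)
  then show ?case
    by (auto simp: shift_open_last lift_close_last intro!: map_idI)
qed

lemma close_open_last: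
  "is_trm \<Sigma> (c @ [0]) m t \<Longrightarrow> subst (close_last c m) (msubst (open_last c m) t) = t"
proof (induction rule: is_trm.induct)
  case (var i m)
  then show ?case by (simp add: close_last_def)
next
  case (mvar i ts m)
  have IH: "map (subst (close_last c m)) (map (msubst (open_last c m)) ts) = ts"
    using mvar by (auto intro!: map_idI)
  show ?case
  proof (cases "i < length c")
    case True
    then show ?thesis using mvar.hyps IH
      by (simp add: open_last_nth apply_abs_generic nth_append del: apply_abs.simps)
  next
    case False
    then have "i = length c" using mvar.hyps by simp
    then show ?thesis using mvar.hyps by (simp add: open_last_nth close_last_def)
  qed
next
  case (op \<omega> as m)
  then show ?case
    by (auto simp: shift_open_last lift_close_last intro!: map_idI)
qed

definition eval_trms :: "nat list \<Rightarrow> 'u trm list" where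
  "eval_trms ms = map (\<lambda>i. MVar i (map Var [0..<ms ! i] @ [MVar (length ms) []])) [0..<length ms]"

lemma length_eval_trms [simp]: "length (eval_trms ms) = length ms"
  by (simp add: eval_trms_def)

lemma is_trm_eval_trms: "list_all2 (is_trm \<Sigma> (map Suc b @ [0])) b (eval_trms b)"
  by (auto simp: eval_trms_def list_all2_conv_all_nth nth_append)

lemma msubst_eval_trms:
  assumes us: "list_all2 (is_trm \<Sigma> c) (map Suc b) us" and i: "i < length b"
  shows "msubst (zip (map Suc b @ [0]) (us @ [v])) (eval_trms b ! i) =
    subst (\<lambda>j. if j < b ! i then Var j else v) (us ! i)"
proof -
  have "is_trm \<Sigma> c (Suc (b ! i)) (us ! i)" "length us = length b"
    using us i by (auto simp: list_all2_conv_all_nth)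
  then show ?thesis
    using i by (auto simp: eval_trms_def nth_append
        intro!: subst_cong[of \<Sigma> c "Suc (b ! i)"])
qed

text \<open>
  A category whose arrows are represented by tuples of terms, equality of arrows being given by a
  relation \<open>eq\<close> on terms that is stable under metasubstitution. This covers the category of arities,
  with elementary terms and equality, and the syntactic theory of a presentation, with all terms and
  derivability.
\<close>

locale term_category =
  fixes \<Sigma> :: "'u signature"
    and eq :: "nat list \<Rightarrow> nat \<Rightarrow> 'u trm \<Rightarrow> 'u trm \<Rightarrow> bool"
    and C :: "(nat list, 'a, 'z) cart_cat_scheme" (structure)
    and mk :: "nat list \<Rightarrow> 'u trm list \<Rightarrow> nat list \<Rightarrow> 'a"
  assumes eq_refl: "is_trm \<Sigma> \<Theta> n t \<Longrightarrow> eq \<Theta> n t t"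
    and eq_msubst: "eq ms n s t \<Longrightarrow> is_trm \<Sigma> ms n s \<Longrightarrow> is_trm \<Sigma> ms n t \<Longrightarrow>
      length us = length ms \<Longrightarrow> (\<And>i. i < length ms \<Longrightarrow> is_trm \<Sigma> \<Theta> (ms ! i + d) (us ! i)) \<Longrightarrow>
      eq \<Theta> (n + d) (msubst (map (shift_abs n) (zip ms us)) s) (msubst (map (shift_abs n) (zip ms us)) t)"
    and mk_eq_iff: "list_all2 (is_trm \<Sigma> ms) ns ts \<Longrightarrow> list_all2 (is_trm \<Sigma> ms) ns us \<Longrightarrow>
      mk ms ts ns = mk ms us ns \<longleftrightarrow> (\<forall>i<length ns. eq ms (ns ! i) (ts ! i) (us ! i))"
    and Obj_C [simp]: "Obj C = UNIV"
    and Arr_C: "Arr C = {mk ms ts ns |ms ts ns. list_all2 (is_trm \<Sigma> ms) ns ts}"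
    and Dom_mk: "list_all2 (is_trm \<Sigma> ms) ns ts \<Longrightarrow> Dom C (mk ms ts ns) = ms"
    and Cod_mk: "list_all2 (is_trm \<Sigma> ms) ns ts \<Longrightarrow> Cod C (mk ms ts ns) = ns"
    and Ide_C: "Ide C ms = mk ms (generics ms) ms"
    and Comp_mk: "list_all2 (is_trm \<Sigma> ms) ns ss \<Longrightarrow> list_all2 (is_trm \<Sigma> ns) ls ts \<Longrightarrow>
      mk ns ts ls \<cdot> mk ms ss ns = mk ms (map (msubst (zip ns ss)) ts) ls"
    and One_C [simp]: "One C = []"
    and Prod_C [simp]: "Prod C a b = a @ b"
    and Fst_C: "Fst C a b = mk (a @ b) (generics a) a"
    and Snd_C: "Snd C a b = mk (a @ b) (map (\<lambda>i. generic (length a + i) (b ! i)) [0..<length b]) b"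
begin

abbreviation trms :: "nat list \<Rightarrow> nat list \<Rightarrow> 'u trm list \<Rightarrow> bool" where
  "trms ms ns ts \<equiv> list_all2 (is_trm \<Sigma> ms) ns ts"

lemma mk_hom: "trms ms ns ts \<Longrightarrow> mk ms ts ns \<in> Hom C ms ns"
  unfolding Hom_def Arr_C by (auto simp: Dom_mk Cod_mk)

lemma homE:
  assumes "f \<in> Hom C ms ns"
  obtains ts where "trms ms ns ts" "f = mk ms ts ns"
  using assms unfolding Hom_def Arr_C by (auto simp: Dom_mk Cod_mk)

lemma mk_eqI:
  "trms ms ns ts \<Longrightarrow> trms ms ns us \<Longrightarrow> (\<And>i. i < length ns \<Longrightarrow> eq ms (ns ! i) (ts ! i) (us ! i)) \<Longrightarrow>
    mk ms ts ns = mk ms us ns"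
  by (simp add: mk_eq_iff)

lemma category_C: "category C"
proof
  show "Ide C a \<in> Hom C a a" for a
    unfolding Ide_C by (rule mk_hom[OF trms_generics])
next
  fix f a b g c assume "f \<in> Hom C a b" "g \<in> Hom C b c"
  then show "g \<cdot> f \<in> Hom C a c"
    by (auto elim!: homE simp: Comp_mk intro!: mk_hom list_all2_msubst_zip)
next
  fix f a b assume "f \<in> Hom C a b"
  then obtain ts where ts: "trms a b ts" "f = mk a ts b" by (rule homE)
  show "f \<cdot> Ide C a = f"
    using ts by (simp add: Ide_C Comp_mk trms_generics map_msubst_generics)
  have "map (msubst (zip b ts)) (generics b) = ts"
    using ts(1) by (intro nth_equalityI) (auto simp: msubst_zip_generic dest: list_all2_lengthD)
  then show "Ide C b \<cdot> f = f" using ts by (simp add: Ide_C Comp_mk trms_generics)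
next
  fix f a b g c h d assume "f \<in> Hom C a b" "g \<in> Hom C b c" "h \<in> Hom C c d"
  then obtain ss ts us where t: "trms a b ss" "f = mk a ss b" "trms b c ts" "g = mk b ts c"
    "trms c d us" "h = mk c us d" by (elim homE)
  have "msubst (zip c (map (msubst (zip b ss)) ts)) u = msubst (zip b ss) (msubst (zip c ts) u)"
    if "u \<in> set us" for u
  proof -
    from that obtain n where "is_trm \<Sigma> c n u"
      using t(5) by (auto simp: list_all2_conv_all_nth in_set_conv_nth)
    then show ?thesis using msubst_msubst_zip[OF t(1,3)] by simp
  qed
  then have assoc: "map (msubst (zip c (map (msubst (zip b ss)) ts))) us =
      map (msubst (zip b ss)) (map (msubst (zip c ts)) us)" by simp
  show "h \<cdot> (g \<cdot> f) = h \<cdot> g \<cdot> f"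
    unfolding t(2,4,6) Comp_mk[OF t(1,3)] Comp_mk[OF t(3,5)] assoc
      Comp_mk[OF t(1) list_all2_msubst_zip[OF t(5,3)]]
      Comp_mk[OF list_all2_msubst_zip[OF t(3,1)] t(5)] ..
qed auto

sublocale category C
  by (rule category_C)

lemma Fst_mk:
  assumes ts: "trms c (a @ b) (ts @ us)" "length ts = length a"
  shows "Fst C a b \<cdot> mk c (ts @ us) (a @ b) = mk c ts a"
proof -
  have "map (msubst (zip (a @ b) (ts @ us))) (generics a) = ts"
  proof (rule nth_equalityI)
    fix i assume "i < length (map (msubst (zip (a @ b) (ts @ us))) (generics a))"
    then show "map (msubst (zip (a @ b) (ts @ us))) (generics a) ! i = ts ! i"
      using msubst_zip_generic[OF ts(1), of i] ts(2) by (simp add: nth_append)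
  qed (simp add: ts(2))
  then show ?thesis
    unfolding Fst_C by (simp add: Comp_mk[OF ts(1) trms_generics_append])
qed

lemma Snd_mk:
  assumes ts: "trms c (a @ b) (ts @ us)" "length ts = length a"
  shows "Snd C a b \<cdot> mk c (ts @ us) (a @ b) = mk c us b"
proof -
  have "map (msubst (zip (a @ b) (ts @ us))) (map (\<lambda>i. generic (length a + i) (b ! i)) [0..<length b]) = us"
    using ts(2) list_all2_lengthD[OF ts(1)] msubst_zip_generic[OF ts(1), of "length a + _"]
    by (intro nth_equalityI) (simp_all add: nth_append)
  then show ?thesis
    unfolding Snd_C by (simp only: Comp_mk[OF ts(1) trms_Snd])
qed

lemma trms_appendE:
  assumes "trms c (a @ b) hs"
  obtains ts us where "hs = ts @ us" "trms c a ts" "trms c b us" "length ts = length a"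
  using assms by (auto simp: list_all2_append1)

lemma is_product_C: "is_product C a b (a @ b) (Fst C a b) (Snd C a b)"
  unfolding is_product_def
proof (intro conjI ballI)
  fix c f g assume "f \<in> Hom C c a" "g \<in> Hom C c b"
  then obtain ts us where ts: "trms c a ts" "f = mk c ts a" and us: "trms c b us" "g = mk c us b"
    by (elim homE)
  note tu = list_all2_appendI[OF ts(1) us(1)]
  have len: "length ts = length a" using ts(1) by (simp add: list_all2_lengthD)
  show "\<exists>!h. h \<in> Hom C c (a @ b) \<and> Fst C a b \<cdot> h = f \<and> Snd C a b \<cdot> h = g"
  proof (rule ex1I[of _ "mk c (ts @ us) (a @ b)"])
    show "mk c (ts @ us) (a @ b) \<in> Hom C c (a @ b) \<and>
        Fst C a b \<cdot> mk c (ts @ us) (a @ b) = f \<and> Snd C a b \<cdot> mk c (ts @ us) (a @ b) = g"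
      using mk_hom[OF tu] Fst_mk[OF tu len] Snd_mk[OF tu len] ts us by simp
    fix h assume h: "h \<in> Hom C c (a @ b) \<and> Fst C a b \<cdot> h = f \<and> Snd C a b \<cdot> h = g"
    then obtain hs where hs: "trms c (a @ b) hs" "h = mk c hs (a @ b)" by (auto elim: homE)
    then obtain ts' us' where tu': "hs = ts' @ us'" "trms c a ts'" "trms c b us'" "length ts' = length a"
      by (auto elim: trms_appendE)
    have "mk c ts' a = mk c ts a" "mk c us' b = mk c us b"
      using Fst_mk[of c a b ts' us'] Snd_mk[of c a b ts' us'] h hs tu' ts(2) us(2) by auto
    then have "\<forall>i<length a. eq c (a ! i) (ts' ! i) (ts ! i)" "\<forall>i<length b. eq c (b ! i) (us' ! i) (us ! i)"
      using tu' ts us by (auto simp: mk_eq_iff)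
    then show "h = mk c (ts @ us) (a @ b)"
      unfolding hs(2) tu'(1) using hs(1) tu' tu len
      by (intro mk_eqI) (auto simp: nth_append)
  qed
qed (auto simp: Fst_C Snd_C intro!: mk_hom trms_generics_append trms_Snd)

lemma cartesian_C: "cartesian C"
  unfolding cartesian_def is_terminal_def
proof (intro conjI ballI)
  show "\<exists>!f. f \<in> Hom C a (One C)" for a
    by (rule ex1I[of _ "mk a [] []"]) (auto intro: mk_hom elim: homE)
qed (use category_C is_product_C in auto)

text \<open>
  The transpose of a tuple of terms exchanges the last metavariable for a variable. The two exchanges
  are mutually inverse on terms; for uniqueness, the equation between evaluated terms is transported
  back by metasubstitution, whose parameter \<open>d = 1\<close> provides the new variable.
\<close>

lemma is_exponential_C: "is_exponential C [0] b (map Suc b) (mk (map Suc b @ [0]) (eval_trms b) b)"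
  unfolding is_exponential_def
proof (intro conjI ballI)
  show "mk (map Suc b @ [0]) (eval_trms b) b \<in> Hom C (Prod C (map Suc b) [0]) b"
    using mk_hom[OF is_trm_eval_trms] by simp
  fix c f assume "f \<in> Hom C (Prod C c [0]) b"
  then obtain ts where ts: "trms (c @ [0]) b ts" "f = mk (c @ [0]) ts b" by (auto elim: homE)
  let ?v = "MVar (length c) [] :: 'u trm"
  \<comment> \<open>evaluating \<open>us\<close> replaces the last variable by the last metavariable\<close>
  have ev: "mk (map Suc b @ [0]) (eval_trms b) b \<cdot> prod_arr C (mk c us (map Suc b)) (Ide C [0]) =
      mk (c @ [0]) (map (\<lambda>i. subst (close_last c (b ! i)) (us ! i)) [0..<length b]) b"
    if us: "trms c (map Suc b) us" for us
  proof -
    have us': "trms (c @ [0]) (map Suc b) us"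
      using us by (rule list_all2_mono) (rule is_trm_append)
    have usv: "trms (c @ [0]) (map Suc b @ [0]) (us @ [?v])"
      by (rule list_all2_appendI[OF us']) simp
    have len: "length us = length (map Suc b)" using us by (auto dest: list_all2_lengthD)
    have 1: "mk c us (map Suc b) \<cdot> Fst C c [0] = mk (c @ [0]) us (map Suc b)"
    proof -
      show ?thesis
        unfolding Fst_C by (simp add: Comp_mk[OF trms_generics_append us] map_msubst_generics[OF us])
    qed
    have 2: "Ide C [0] \<cdot> Snd C c [0] = mk (c @ [0]) [?v] [0]"
      using comp_ide_left[OF mk_hom[OF trms_Snd[of _ c "[0]"]]] by (simp add: Snd_C generic_def)
    have D: "Dom C (mk c us (map Suc b)) = c" "Cod C (mk c us (map Suc b)) = map Suc b"
      "Dom C (Ide C [0]) = [0]" "Cod C (Ide C [0]) = [0]"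
      using HomD[OF mk_hom[OF us]] HomD[OF ide_hom[of "[0]"]] by simp_all
    have m: "mk (c @ [0]) us (map Suc b) \<in> Hom C (c @ [0]) (map Suc b)"
      "mk (c @ [0]) [?v] [0] \<in> Hom C (c @ [0]) [0]"
      by (rule mk_hom[OF us']) (rule mk_hom, simp)
    have "prod_arr C (mk c us (map Suc b)) (Ide C [0]) = mk (c @ [0]) (us @ [?v]) (map Suc b @ [0])"
      unfolding prod_arr_def D 1 2 Prod_C
    proof (rule the1_equality)
      show "\<exists>!h. h \<in> Hom C (c @ [0]) (map Suc b @ [0]) \<and>
          Fst C (map Suc b) [0] \<cdot> h = mk (c @ [0]) us (map Suc b) \<and>
          Snd C (map Suc b) [0] \<cdot> h = mk (c @ [0]) [?v] [0]"
        using is_product_C[of "map Suc b" "[0]"] m by (simp add: is_product_def)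
      show "mk (c @ [0]) (us @ [?v]) (map Suc b @ [0]) \<in> Hom C (c @ [0]) (map Suc b @ [0]) \<and>
          Fst C (map Suc b) [0] \<cdot> mk (c @ [0]) (us @ [?v]) (map Suc b @ [0]) = mk (c @ [0]) us (map Suc b) \<and>
          Snd C (map Suc b) [0] \<cdot> mk (c @ [0]) (us @ [?v]) (map Suc b @ [0]) = mk (c @ [0]) [?v] [0]"
        using mk_hom[OF usv] Fst_mk[OF usv len] Snd_mk[OF usv len] by simp
    qed
    moreover have "map (msubst (zip (map Suc b @ [0]) (us @ [?v]))) (eval_trms b) =
        map (\<lambda>i. subst (close_last c (b ! i)) (us ! i)) [0..<length b]"
    proof (rule nth_equalityI)
      fix i assume "i < length (map (msubst (zip (map Suc b @ [0]) (us @ [?v]))) (eval_trms b))"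
      then have i: "i < length b" by simp
      show "map (msubst (zip (map Suc b @ [0]) (us @ [?v]))) (eval_trms b) ! i =
          map (\<lambda>i. subst (close_last c (b ! i)) (us ! i)) [0..<length b] ! i"
        using i msubst_eval_trms[OF us' i, of ?v] by (simp add: close_last_def)
    qed simp
    ultimately show ?thesis by (simp add: Comp_mk[OF usv is_trm_eval_trms])
  qed
  let ?us = "map (\<lambda>i. msubst (open_last c (b ! i)) (ts ! i)) [0..<length b]"
  have ts': "is_trm \<Sigma> (c @ [0]) (b ! i) (ts ! i)" if "i < length b" for i
    using ts(1) that by (simp add: list_all2_conv_all_nth)
  have op: "open_last c m = map (shift_abs m) (zip (c @ [0]) (generics c @ [Var 0]))" for m
    using shift_open_last[of m c 0, symmetric] by (simp add: open_last_def)
  have gen: "length (generics c @ [Var 0]) = length (c @ [0])"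
    "i < length (c @ [0]) \<Longrightarrow> is_trm \<Sigma> c ((c @ [0]) ! i + 1) ((generics c @ [Var 0]) ! i)" for i
    by (auto simp: nth_append is_trm_generic)
  have us: "trms c (map Suc b) ?us"
  proof -
    have "is_trm \<Sigma> c (Suc (b ! i)) (msubst (open_last c (b ! i)) (ts ! i))" if "i < length b" for i
    proof (rule is_trm_msubst)
      show "is_trm \<Sigma> (c @ [0]) (Suc (b ! i)) (ts ! i)" by (rule is_trm_mono[OF ts'[OF that]]) simp
      show "abs_ok \<Sigma> c (c @ [0]) (Suc (b ! i)) (open_last c (b ! i))"
        using abs_ok_shift[OF abs_ok_zip[OF gen], of "b ! i"] unfolding op by simp
    qed
    then show ?thesis by (simp add: list_all2_conv_all_nth)
  qed
  have tc: "trms (c @ [0]) b (map (\<lambda>i. subst (close_last c (b ! i)) (us ! i)) [0..<length b])"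
    if us: "trms c (map Suc b) us" for us
    using us by (auto simp: list_all2_conv_all_nth close_last_def
        intro!: is_trm_subst[OF is_trm_append])
  show "\<exists>!g. g \<in> Hom C c (map Suc b) \<and>
      mk (map Suc b @ [0]) (eval_trms b) b \<cdot> prod_arr C g (Ide C [0]) = f"
  proof (rule ex1I[of _ "mk c ?us (map Suc b)"])
    have "map (\<lambda>i. subst (close_last c (b ! i)) (?us ! i)) [0..<length b] = ts"
    proof (rule nth_equalityI)
      fix i assume "i < length (map (\<lambda>i. subst (close_last c (b ! i)) (?us ! i)) [0..<length b])"
      then have "i < length b" by simp
      then show "map (\<lambda>i. subst (close_last c (b ! i)) (?us ! i)) [0..<length b] ! i = ts ! i"
        by (simp add: close_open_last[OF ts'])
    qed (use ts(1) in \<open>auto dest: list_all2_lengthD\<close>)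
    then show "mk c ?us (map Suc b) \<in> Hom C c (map Suc b) \<and>
        mk (map Suc b @ [0]) (eval_trms b) b \<cdot> prod_arr C (mk c ?us (map Suc b)) (Ide C [0]) = f"
      using mk_hom[OF us] ev[OF us] ts(2) by simp
    fix g assume g: "g \<in> Hom C c (map Suc b) \<and>
      mk (map Suc b @ [0]) (eval_trms b) b \<cdot> prod_arr C g (Ide C [0]) = f"
    then obtain us where us': "trms c (map Suc b) us" "g = mk c us (map Suc b)" by (auto elim: homE)
    have "mk (c @ [0]) (map (\<lambda>i. subst (close_last c (b ! i)) (us ! i)) [0..<length b]) b = mk (c @ [0]) ts b"
      using g ev[OF us'(1)] us'(2) ts(2) by simp
    then have e: "eq (c @ [0]) (b ! i) (subst (close_last c (b ! i)) (us ! i)) (ts ! i)"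
      if "i < length b" for i
      using that by (simp add: mk_eq_iff[OF tc[OF us'(1)] ts(1)])
    show "g = mk c ?us (map Suc b)"
      unfolding us'(2)
    proof (rule mk_eqI[OF us'(1) us])
      fix i assume "i < length (map Suc b)"
      then have i: "i < length b" by simp
      have u: "is_trm \<Sigma> c (Suc (b ! i)) (us ! i)" using us'(1) i by (simp add: list_all2_conv_all_nth)
      have "is_trm \<Sigma> (c @ [0]) (b ! i) (subst (close_last c (b ! i)) (us ! i))"
        using tc[OF us'(1)] i by (simp add: list_all2_conv_all_nth)
      from eq_msubst[OF e[OF i] this ts'[OF i] gen]
      have "eq c (Suc (b ! i)) (msubst (open_last c (b ! i)) (subst (close_last c (b ! i)) (us ! i)))
          (msubst (open_last c (b ! i)) (ts ! i))"
        unfolding op[symmetric] by simp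
      then show "eq c (map Suc b ! i) (us ! i) (?us ! i)"
        using i by (simp add: open_close_last[OF u HOL.refl])
    qed
  qed
qed auto

end

interpretation arity: term_category "Map.empty :: 'u signature" "\<lambda>_ _. (=)"
  "\<bbbM> :: (nat list, 'u arity_arrow) cart_cat" "\<lambda>ms ts ns. (ms, ts, ns)"
proof
  fix ms ns and ts us :: "'u trm list"
  assume "list_all2 (elementary ms) ns ts" "list_all2 (elementary ms) ns us"
  then have "length ts = length ns" "length us = length ns" by (auto dest: list_all2_lengthD)
  then show "((ms, ts, ns) = (ms, us, ns)) = (\<forall>i<length ns. ts ! i = us ! i)"
    by (auto simp: list_eq_iff_nth_eq)
qed (auto simp: arity_cat_def generics_def)

section \<open>The syntactic theory of a presentation\<close>

lemma presentation_derivable_is_trm: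
  assumes "is_presentation P" "derivable (sig P) (axs P) \<Theta> n s t"
  shows "is_trm (sig P) \<Theta> n s \<and> is_trm (sig P) \<Theta> n t"
  using assms(2) by (rule derivable_is_trm) (use assms(1) in \<open>auto simp: is_presentation_def\<close>)

definition canon :: "'u presentation \<Rightarrow> nat list \<Rightarrow> nat \<Rightarrow> 'u trm \<Rightarrow> 'u trm" where
  "canon P \<Theta> n t = (SOME s. derivable (sig P) (axs P) \<Theta> n t s)"

text \<open>
  The arrow given by a tuple of terms. Taking representatives makes derivably equal tuples give the
  same arrow, and \<open>code\<close> moves the result into \<open>'u\<close>.
\<close>

definition syn_arrow ::
  "('u arity_arrow \<Rightarrow> 'u) \<Rightarrow> 'u presentation \<Rightarrow> nat list \<Rightarrow> 'u trm list \<Rightarrow> nat list \<Rightarrow> 'u" where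
  "syn_arrow code P ms ts ns = code (ms, map (\<lambda>(n, t). canon P ms n t) (zip ns ts), ns)"

definition syn_theory :: "('u arity_arrow \<Rightarrow> 'u) \<Rightarrow> 'u presentation \<Rightarrow> 'u alg_theory" where
  "syn_theory code P =
     \<lparr>Obj = UNIV,
      Arr = {syn_arrow code P ms ts ns |ms ts ns. list_all2 (is_trm (sig P) ms) ns ts},
      Dom = (\<lambda>f. fst (inv code f)),
      Cod = (\<lambda>f. snd (snd (inv code f))),
      Ide = (\<lambda>ms. syn_arrow code P ms (generics ms) ms),
      Comp = (\<lambda>g f. case (inv code g, inv code f) of ((_, ts, ls), (ms, ss, ns)) \<Rightarrow>
        syn_arrow code P ms (map (msubst (zip ns ss)) ts) ls),
      One = [],
      Prod = (@),
      Fst = (\<lambda>a b. syn_arrow code P (a @ b) (generics a) a),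
      Snd = (\<lambda>a b. syn_arrow code P (a @ b) (map (\<lambda>i. generic (length a + i) (b ! i)) [0..<length b]) b),
      Emb = \<lparr>OMap = \<lambda>a\<in>UNIV. a, AMap = \<lambda>(ms, ts, ns)\<in>Arr \<bbbM>. syn_arrow code P ms ts ns\<rparr>\<rparr>"

locale syntactic_theory =
  fixes P :: "'u presentation" and code :: "'u arity_arrow \<Rightarrow> 'u"
  assumes presentation: "is_presentation P" and inj_code: "inj code"
begin

abbreviation "\<Sigma> \<equiv> sig P"
abbreviation "Ax \<equiv> axs P"
abbreviation "mk \<equiv> syn_arrow code P"
abbreviation "Syn \<equiv> syn_theory code P"

lemmas derivable_typed = presentation_derivable_is_trm[OF presentation]

lemma derivable_canon: "is_trm \<Sigma> \<Theta> n t \<Longrightarrow> derivable \<Sigma> Ax \<Theta> n t (canon P \<Theta> n t)"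
  unfolding canon_def by (rule someI[of _ t]) (rule derivable.refl)

lemma canon_eq_iff:
  assumes "is_trm \<Sigma> \<Theta> n s" "is_trm \<Sigma> \<Theta> n t"
  shows "canon P \<Theta> n s = canon P \<Theta> n t \<longleftrightarrow> derivable \<Sigma> Ax \<Theta> n s t"
proof
  assume "canon P \<Theta> n s = canon P \<Theta> n t"
  then have "derivable \<Sigma> Ax \<Theta> n s (canon P \<Theta> n t)" using derivable_canon[OF assms(1)] by simp
  then show "derivable \<Sigma> Ax \<Theta> n s t"
    by (rule derivable.trans) (rule derivable.sym[OF derivable_canon[OF assms(2)]])
next
  assume st: "derivable \<Sigma> Ax \<Theta> n s t"
  have "derivable \<Sigma> Ax \<Theta> n s = derivable \<Sigma> Ax \<Theta> n t"
    using derivable.trans[OF st] derivable.trans[OF derivable.sym[OF st]] by blast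
  then show "canon P \<Theta> n s = canon P \<Theta> n t" by (simp add: canon_def)
qed

lemma is_trm_canon: "is_trm \<Sigma> \<Theta> n t \<Longrightarrow> is_trm \<Sigma> \<Theta> n (canon P \<Theta> n t)"
  using derivable_typed[OF derivable_canon] by blast

lemma inv_code_mk: "inv code (mk ms ts ns) = (ms, map (\<lambda>(n, t). canon P ms n t) (zip ns ts), ns)"
  by (simp add: syn_arrow_def inj_code)

lemma mk_eq:
  assumes "list_all2 (is_trm \<Sigma> ms) ns ts" "list_all2 (is_trm \<Sigma> ms) ns us"
  shows "mk ms ts ns = mk ms us ns \<longleftrightarrow> (\<forall>i<length ns. derivable \<Sigma> Ax ms (ns ! i) (ts ! i) (us ! i))"
proof -
  have "length ts = length ns" "length us = length ns" using assms by (auto dest: list_all2_lengthD)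
  then have "mk ms ts ns = mk ms us ns \<longleftrightarrow>
      (\<forall>i<length ns. canon P ms (ns ! i) (ts ! i) = canon P ms (ns ! i) (us ! i))"
    by (simp add: syn_arrow_def inj_eq[OF inj_code] list_eq_iff_nth_eq)
  also have "\<dots> \<longleftrightarrow> (\<forall>i<length ns. derivable \<Sigma> Ax ms (ns ! i) (ts ! i) (us ! i))"
    using assms by (auto simp: list_all2_conv_all_nth canon_eq_iff)
  finally show ?thesis .
qed

lemma derivable_msubst_zip:
  assumes "derivable \<Sigma> Ax ns n t t'" "length ss = length ns" "length ss' = length ns"
    and "\<And>i. i < length ns \<Longrightarrow> derivable \<Sigma> Ax ms (ns ! i) (ss ! i) (ss' ! i)"
  shows "derivable \<Sigma> Ax ms n (msubst (zip ns ss) t) (msubst (zip ns ss') t')"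
proof -
  have "map (shift_abs n) (zip ns ss) = zip ns ss" "map (shift_abs n) (zip ns ss') = zip ns ss'"
    using derivable_typed[OF assms(4)] assms(2,3)
    by (intro shift_abs_zip[of \<Sigma> ms]; simp add: list_all2_conv_all_nth)+
  then show ?thesis using derivable.msubst[OF assms(1-3), of ms 0] assms(4) by simp
qed

lemma Comp_mk_mk:
  assumes ss: "list_all2 (is_trm \<Sigma> ms) ns ss" and ts: "list_all2 (is_trm \<Sigma> ns) ls ts"
  shows "Comp Syn (mk ns ts ls) (mk ms ss ns) = mk ms (map (msubst (zip ns ss)) ts) ls"
proof -
  let ?ss = "map (\<lambda>(n, t). canon P ms n t) (zip ns ss)"
    and ?ts = "map (\<lambda>(n, t). canon P ns n t) (zip ls ts)"
  have len: "length ss = length ns" "length ts = length ls"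
    using assms by (auto dest: list_all2_lengthD)
  have ss': "list_all2 (is_trm \<Sigma> ms) ns ?ss" and ts': "list_all2 (is_trm \<Sigma> ns) ls ?ts"
    using assms by (auto simp: list_all2_conv_all_nth is_trm_canon)
  have "mk ms (map (msubst (zip ns ?ss)) ?ts) ls = mk ms (map (msubst (zip ns ss)) ts) ls"
  proof (subst mk_eq, intro list_all2_msubst_zip[OF ts' ss'], intro list_all2_msubst_zip[OF ts ss], intro allI impI)
    fix i assume i: "i < length ls"
    have "derivable \<Sigma> Ax ms (ls ! i) (msubst (zip ns ?ss) (?ts ! i)) (msubst (zip ns ss) (ts ! i))"
    proof (rule derivable_msubst_zip)
      show "derivable \<Sigma> Ax ns (ls ! i) (?ts ! i) (ts ! i)"
        using derivable.sym[OF derivable_canon] ts i by (simp add: list_all2_conv_all_nth)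
      show "derivable \<Sigma> Ax ms (ns ! j) (?ss ! j) (ss ! j)" if "j < length ns" for j
        using derivable.sym[OF derivable_canon] ss that by (simp add: list_all2_conv_all_nth)
    qed (simp_all add: len)
    then show "derivable \<Sigma> Ax ms (ls ! i) (map (msubst (zip ns ?ss)) ?ts ! i)
        (map (msubst (zip ns ss)) ts ! i)"
      using i len by simp
  qed
  then show ?thesis by (simp add: syn_theory_def inv_code_mk)
qed

sublocale term_category \<Sigma> "derivable \<Sigma> Ax" Syn mk
proof
  fix ms n s t us \<Theta> d
  assume "derivable \<Sigma> Ax ms n s t" "length us = length ms"
    "\<And>i. i < length ms \<Longrightarrow> is_trm \<Sigma> \<Theta> (ms ! i + d) (us ! i)"
  then show "derivable \<Sigma> Ax \<Theta> (n + d) (msubst (map (shift_abs n) (zip ms us)) s)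
      (msubst (map (shift_abs n) (zip ms us)) t)"
    by (intro derivable.msubst) (auto intro: derivable.refl)
qed (simp_all add: derivable.refl mk_eq Comp_mk_mk, simp_all add: syn_theory_def inv_code_mk)

lemma Emb_mk: "list_all2 (elementary ms) ns ts \<Longrightarrow> AMap (Emb Syn) (ms, ts, ns) = mk ms ts ns"
  by (simp add: syn_theory_def arity_cat_def)

lemma OMap_Emb_Syn: "OMap (Emb Syn) ms = ms"
  by (simp add: syn_theory_def)

lemma elementary_trms: "list_all2 (elementary ms) ns ts \<Longrightarrow> trms ms ns ts"
  by (erule list_all2_mono) (rule elementary_is_trm)

lemma is_functor_Emb_Syn: "is_functor \<bbbM> Syn (Emb Syn)"
  unfolding is_functor_def
proof (intro conjI ballI impI)
  show "category \<bbbM>" "category Syn" by (rule arity.category_C, rule category_C)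
  show "OMap (Emb Syn) \<in> Obj \<bbbM> \<rightarrow>\<^sub>E Obj Syn" by (simp add: syn_theory_def arity_cat_def)
  have Arr: "f \<in> Arr \<bbbM> \<Longrightarrow> \<exists>ms ts ns. f = (ms, ts, ns) \<and> list_all2 (elementary ms) ns ts" for f :: "'u arity_arrow"
    by (cases f) (simp add: arity_cat_def)
  have hom: "AMap (Emb Syn) f \<in> Hom Syn (Dom \<bbbM> f) (Cod \<bbbM> f)" if f: "f \<in> Arr \<bbbM>" for f
    using Arr[OF f] by (auto simp: Emb_mk arity.Dom_mk arity.Cod_mk intro!: mk_hom elementary_trms)
  show "AMap (Emb Syn) \<in> Arr \<bbbM> \<rightarrow>\<^sub>E Arr Syn"
    using hom by (auto simp: Hom_def) (simp add: syn_theory_def)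
  fix f :: "'u arity_arrow" assume f: "f \<in> Arr \<bbbM>"
  show "Dom Syn (AMap (Emb Syn) f) = OMap (Emb Syn) (Dom \<bbbM> f)"
    "Cod Syn (AMap (Emb Syn) f) = OMap (Emb Syn) (Cod \<bbbM> f)"
    using hom[OF f] by (auto simp: Hom_def OMap_Emb_Syn)
  fix g :: "'u arity_arrow" assume g: "g \<in> Arr \<bbbM>" and fg: "Cod \<bbbM> f = Dom \<bbbM> g"
  obtain ms ss ns where f': "f = (ms, ss, ns)" "list_all2 (elementary ms) ns ss" using Arr[OF f] by blast
  obtain ns' ts ls where "g = (ns', ts, ls)" "list_all2 (elementary ns') ls ts" using Arr[OF g] by blast
  then have g': "g = (ns, ts, ls)" "list_all2 (elementary ns) ls ts"
    using fg f' by (auto simp: arity.Dom_mk arity.Cod_mk)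
  show "AMap (Emb Syn) (Comp \<bbbM> g f) = Comp Syn (AMap (Emb Syn) g) (AMap (Emb Syn) f)"
    unfolding f'(1) g'(1) arity.Comp_mk[OF f'(2) g'(2)]
    by (simp add: Emb_mk list_all2_msubst_zip[OF g'(2) f'(2)] f'(2) g'(2)
        Comp_mk[OF elementary_trms[OF f'(2)] elementary_trms[OF g'(2)]])
next
  fix a
  show "AMap (Emb Syn) (Ide \<bbbM> a) = Ide Syn (OMap (Emb Syn) a)"
    by (simp add: arity.Ide_C Ide_C OMap_Emb_Syn Emb_mk trms_generics)
qed

lemma Emb_arity_eval: "AMap (Emb Syn) (arity_eval b) = mk (map Suc b @ [0]) (eval_trms b) b"
  unfolding arity_eval_def arity_exp_def eval_trms_def[symmetric]
  by (rule Emb_mk[OF is_trm_eval_trms])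

lemma is_alg_theory_Syn: "is_alg_theory Syn"
  unfolding is_alg_theory_def
proof (intro conjI ballI allI)
  show "strict_cartesian_functor \<bbbM> Syn (Emb Syn)"
    unfolding strict_cartesian_functor_def
    using arity.cartesian_C cartesian_C is_functor_Emb_Syn
    by (simp add: OMap_Emb_Syn arity.Fst_C arity.Snd_C Fst_C Snd_C Emb_mk
        trms_generics_append trms_Snd)
  show "is_exponential Syn (OMap (Emb Syn) [0]) (OMap (Emb Syn) ms)
      (OMap (Emb Syn) (arity_exp ms)) (AMap (Emb Syn) (arity_eval ms))" for ms
    using is_exponential_C[of ms] by (simp add: OMap_Emb_Syn Emb_arity_eval arity_exp_def)
  show "exponentiable Syn [0]"
    using is_exponential_C by (auto simp: exponentiable_def)
qed (auto simp: cartesian_C OMap_Emb_Syn arity_cat_def)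

sublocale Syn: second_order_theory Syn
  by unfold_locales (rule is_alg_theory_Syn)

definition can :: "'u \<Rightarrow> 'u" where
  "can \<omega> = mk (the (\<Sigma> \<omega>)) [op_trm \<omega> (the (\<Sigma> \<omega>))] [0]"

lemma interprets_can: "Syn.interprets can \<Sigma>"
  by (auto simp: Syn.interprets_def can_def is_trm_op_trm intro!: mk_hom)

lemma proj_mk:
  assumes "trms c \<Theta> hs" "i < length \<Theta>"
  shows "Comp Syn (Syn.proj \<Theta> i) (mk c hs \<Theta>) = mk c [hs ! i] [\<Theta> ! i]"
proof -
  have e: "list_all2 (is_trm S \<Theta>) [\<Theta> ! i] [generic i (\<Theta> ! i)]" for S :: "'u signature"
    using assms(2) by (simp add: is_trm_generic)
  show ?thesis
    unfolding Syn.proj_def Emb_mk[OF e] Comp_mk[OF assms(1) e]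
    by (simp add: msubst_zip_generic[OF assms])
qed

lemma app1_mk:
  assumes s: "is_trm \<Sigma> c (Suc m) s" and v: "is_trm \<Sigma> c 0 v"
  shows "Syn.app1 [m] (mk c [s] [Suc m]) (mk c [v] [0]) =
    mk c [subst (\<lambda>j. if j < m then Var j else v) s] [m]"
proof -
  have sv: "trms c (map Suc [m] @ [0]) ([s] @ [v])" using s v by simp
  have s': "trms c (map Suc [m]) [s]" using s by simp
  have pair: "Syn.pair (map Suc [m]) [0] (mk c [s] [Suc m]) (mk c [v] [0]) =
      mk c ([s] @ [v]) (map Suc [m] @ [0])"
    by (rule Syn.pair_eqI[OF mk_hom[OF sv]]) (use Fst_mk[OF sv] Snd_mk[OF sv] in simp_all)
  have "map f (eval_trms [m]) = [f (eval_trms [m] ! 0)]" for f :: "'u trm \<Rightarrow> 'u trm"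
    by (simp add: eval_trms_def)
  then have "map (msubst (zip (map Suc [m] @ [0]) ([s] @ [v]))) (eval_trms [m]) =
      [subst (\<lambda>j. if j < m then Var j else v) s]"
    using msubst_eval_trms[OF s', of 0 v] by (simp del: list.map zip_Cons_Cons append.simps)
  then show ?thesis
    unfolding Syn.app1_def Emb_arity_eval pair Comp_mk[OF sv is_trm_eval_trms] by (rule arg_cong)
qed

lemma app_mk:
  "is_trm \<Sigma> c (m + length vs) s \<Longrightarrow> (\<And>v. v \<in> set vs \<Longrightarrow> is_trm \<Sigma> c 0 v) \<Longrightarrow>
    Syn.app [m] (mk c [s] [m + length vs]) (map (\<lambda>v. mk c [v] [0]) vs) =
      mk c [subst (\<lambda>j. if j < m then Var j else vs ! (j - m)) s] [m]"
proof (induction vs arbitrary: m)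
  case Nil
  have "subst (\<lambda>j. if j < m then Var j else [] ! (j - m)) s = s"
    by (rule subst_id[of \<Sigma> c m]) (use Nil in auto)
  then show ?case by simp
next
  case (Cons v vs)
  have v: "is_trm \<Sigma> c 0 v" and vs: "\<And>v. v \<in> set vs \<Longrightarrow> is_trm \<Sigma> c 0 v" using Cons.prems by auto
  have s: "is_trm \<Sigma> c (Suc m + length vs) s" using Cons.prems(1) by simp
  let ?s = "subst (\<lambda>j. if j < Suc m then Var j else vs ! (j - Suc m)) s"
  have s': "is_trm \<Sigma> c (Suc m) ?s"
    by (rule is_trm_subst[OF s]) (auto intro: is_trm_mono[OF vs])
  have "subst (\<lambda>j. if j < m then Var j else v) ?s =
      subst (\<lambda>j. if j < m then Var j else (v # vs) ! (j - m)) s"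
    unfolding subst_subst
  proof (rule subst_cong[OF s])
    fix i assume i: "i < Suc m + length vs"
    consider "i < m" | "i = m" | "i > m" by linarith
    then show "subst (\<lambda>j. if j < m then Var j else v) (if i < Suc m then Var i else vs ! (i - Suc m)) =
        (if i < m then Var i else (v # vs) ! (i - m))"
    proof cases
      case 3
      then have "is_trm \<Sigma> c 0 (vs ! (i - Suc m))" using i by (intro vs) simp
      then have "subst (\<lambda>j. if j < m then Var j else v) (vs ! (i - Suc m)) = vs ! (i - Suc m)"
        by (rule subst_id) simp
      then show ?thesis using 3 by (simp add: nth_Cons')
    qed auto
  qed
  then show ?case using Cons.IH[OF s vs] app1_mk[OF s' v] by simp
qed

lemma app0_mk:
  assumes "is_trm \<Sigma> c (length vs) s" "\<And>v. v \<in> set vs \<Longrightarrow> is_trm \<Sigma> c 0 v"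
  shows "Syn.app [0] (mk c [s] [length vs]) (map (\<lambda>v. mk c [v] [0]) vs) =
    mk c [subst (\<lambda>j. vs ! j) s] [0]"
  using app_mk[of c 0 vs s] assms by simp

lemma elemsE:
  assumes "vs \<in> Syn.elems c n"
  obtains us where "vs = map (\<lambda>v. mk c [v] [0]) us" "length us = n" "\<forall>u\<in>set us. is_trm \<Sigma> c 0 u"
proof -
  have "\<exists>us. vs = map (\<lambda>v. mk c [v] [0]) us \<and> (\<forall>u\<in>set us. is_trm \<Sigma> c 0 u)"
    using assms[unfolded Syn.elems_def]
  proof (induction vs arbitrary: n)
    case (Cons v vs)
    then obtain us where us: "vs = map (\<lambda>v. mk c [v] [0]) us" "\<forall>u\<in>set us. is_trm \<Sigma> c 0 u" by auto
    have "v \<in> Hom Syn c [0]" using Cons.prems by auto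
    then obtain ts where "trms c [0] ts" "v = mk c ts [0]" by (rule homE)
    then obtain u where "is_trm \<Sigma> c 0 u" "v = mk c [u] [0]" by (auto simp: list_all2_Cons1)
    then show ?case using us by (intro exI[of _ "u # us"]) simp
  qed simp
  then obtain us where us: "vs = map (\<lambda>v. mk c [v] [0]) us" "\<forall>u\<in>set us. is_trm \<Sigma> c 0 u"
    by blast
  moreover have "length us = n" using us(1) assms by (simp add: Syn.elems_def)
  ultimately show thesis using that by blast
qed

lemma tup_mk:
  assumes "trms c ns ts" "fs = map (\<lambda>i. mk c [ts ! i] [ns ! i]) [0..<length ns]"
  shows "Syn.tup c ns fs = mk c ts ns"
proof (rule Syn.tup_eqI[OF mk_hom[OF assms(1)]])
  show "Syn.tuple c ns fs"
    using assms by (auto simp: Syn.tuple_def list_all2_conv_all_nth intro!: mk_hom)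
qed (simp add: proj_mk[OF assms(1)] assms(2))

lemma subst_abs_closed: "is_trm \<Sigma> \<Theta> k t \<Longrightarrow> subst_abs \<sigma> (k, t) = (k, t)"
  by (auto simp: lift_def intro!: subst_id)

lemma lift_closed:
  assumes "\<And>j. j < n \<Longrightarrow> is_trm \<Sigma> c 0 (\<sigma> j)" "i < k + n"
  shows "lift k \<sigma> i = (if i < k then Var i else \<sigma> (i - k))"
  using assms(1)[of "i - k"] assms(2) by (auto simp: lift_def intro!: rename_id[of \<Sigma> c 0])

lemma msubst_subst_closed:
  assumes "trms c ms rs" "is_trm \<Sigma> ms n x" "\<And>i. i < n \<Longrightarrow> is_trm \<Sigma> ms m (\<sigma> i)"
  shows "msubst (zip ms rs) (subst \<sigma> x) =
    subst (\<lambda>i. msubst (zip ms rs) (\<sigma> i)) (msubst (zip ms rs) x)"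
proof (rule msubst_subst[OF assms(2), of _ _ _ _ m])
  fix i assume "i < length ms"
  then show "zip ms rs ! i = subst_abs (\<lambda>i. msubst (zip ms rs) (\<sigma> i)) (zip ms rs ! i)"
    using assms(1) by (auto simp: list_all2_conv_all_nth subst_abs_closed simp del: subst_abs.simps)
qed (use assms in \<open>auto simp: list_all2_conv_all_nth\<close>)

text \<open>
  In the syntactic theory, elements are terms without free variables, and evaluation substitutes them.
  For an operator, \<open>lam\<close> has to be identified: the substituted body represents the family in question,
  because by the induction hypothesis both have the same values.
\<close>

lemma val_can:
  assumes "is_trm \<Sigma> \<Theta> n t"
  shows "trms c \<Theta> hs \<Longrightarrow> length vs = n \<Longrightarrow> (\<And>v. v \<in> set vs \<Longrightarrow> is_trm \<Sigma> c 0 v) \<Longrightarrow>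
    Syn.val can (mk c hs \<Theta>) (map (\<lambda>v. mk c [v] [0]) vs) t =
      mk c [subst (\<lambda>j. vs ! j) (msubst (zip \<Theta> hs) t)] [0]"
  using assms
proof (induction arbitrary: c hs vs rule: is_trm.induct)
  case (var i n)
  then show ?case by simp
next
  case (mvar i ts n)
  note hs = mvar.prems(1) and vs = mvar.prems(3) and i = mvar.hyps(1)
  let ?us = "map (\<lambda>t. subst (\<lambda>j. vs ! j) (msubst (zip \<Theta> hs) t)) ts"
  have hi: "is_trm \<Sigma> c (length ?us) (hs ! i)" "is_trm \<Sigma> c (\<Theta> ! i) (hs ! i)"
    using hs i mvar.hyps by (auto simp: list_all2_conv_all_nth)
  have us: "is_trm \<Sigma> c 0 u" if u: "u \<in> set ?us" for u
  proof -
    obtain t where t: "t \<in> set ts" "u = subst (\<lambda>j. vs ! j) (msubst (zip \<Theta> hs) t)"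
      using u unfolding set_map by blast
    have "is_trm \<Sigma> c n (msubst (zip \<Theta> hs) t)"
      using mvar.IH(1) mvar.hyps t(1) by (intro is_trm_msubst_zip[OF _ hs]) blast
    then show ?thesis
      unfolding t(2) by (rule is_trm_subst) (use mvar.prems(2) vs in simp)
  qed
  have "map (Syn.val can (mk c hs \<Theta>) (map (\<lambda>v. mk c [v] [0]) vs)) ts = map (\<lambda>v. mk c [v] [0]) ?us"
    using mvar.IH mvar.prems by simp
  then have "Syn.val can (mk c hs \<Theta>) (map (\<lambda>v. mk c [v] [0]) vs) (MVar i ts) =
      Syn.app [0] (mk c [hs ! i] [length ?us]) (map (\<lambda>v. mk c [v] [0]) ?us)"
    using mvar.hyps by (simp only: Syn.val.simps Cod_mk[OF hs] proj_mk[OF hs i] length_map)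
  also have "\<dots> = mk c [subst (\<lambda>j. ?us ! j) (hs ! i)] [0]" by (rule app0_mk[OF hi(1) us])
  also have "subst (\<lambda>j. ?us ! j) (hs ! i) = apply_abs (\<Theta> ! i, hs ! i) ?us"
    using mvar.hyps by (auto intro!: subst_cong[OF hi(2)])
  also have "\<dots> = subst (\<lambda>j. vs ! j) (apply_abs (\<Theta> ! i, hs ! i) (map (msubst (zip \<Theta> hs)) ts))"
    using mvar.hyps(2)
    by (simp only: subst_apply_abs length_map fst_conv subst_abs_closed[OF hi(2)] map_map comp_def)
  also have "(\<Theta> ! i, hs ! i) = zip \<Theta> hs ! i" using i list_all2_lengthD[OF hs] by simp
  finally show ?case by simp
next
  case (op \<omega> as n)
  note hs = op.prems(1) and len = op.prems(2) and vs = op.prems(3)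
  let ?h = "mk c hs \<Theta>" and ?vs = "map (\<lambda>v. mk c [v] [0]) vs"
  let ?b = "\<lambda>(k, t). subst (lift k (\<lambda>j. vs ! j)) (msubst (zip \<Theta> hs) t)"
  have vs': "is_trm \<Sigma> c 0 (vs ! j)" if "j < n" for j using that len by (intro vs) simp
  have trm: "is_trm \<Sigma> \<Theta> (k + n) t" if "(k, t) \<in> set as" for k t using op.IH op.hyps that by blast
  have lift: "lift k (\<lambda>j. vs ! j) i = (if i < k then Var i else vs ! (i - k))" if "i < k + n" for i k
    by (rule lift_closed[of n c]) (use vs' that in auto)
  have lift_trm: "is_trm \<Sigma> c k (lift k (\<lambda>j. vs ! j) i)" if "i < k + n" for i k
    using lift[OF that] is_trm_mono[OF vs'[of "i - k"], of k] that by auto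
  have b: "is_trm \<Sigma> c k (?b (k, t))" if "(k, t) \<in> set as" for k t
    using is_trm_subst[OF is_trm_msubst_zip[OF trm[OF that] hs] lift_trm] by simp
  have lam: "Syn.lam c k (\<lambda>r us. Syn.val can (Comp Syn ?h r) (us @ map (\<lambda>v. Comp Syn v r) ?vs) t) =
      mk c [?b (k, t)] [k]" if kt: "(k, t) \<in> set as" for k t
  proof (rule Syn.lam_eqI)
    show "mk c [?b (k, t)] [k] \<in> Hom Syn c [k]" using b[OF kt] by (intro mk_hom) simp
    fix c' r us assume r: "r \<in> Hom Syn c' c" and us: "us \<in> Syn.elems c' k"
    obtain rs where rs: "trms c' c rs" "r = mk c' rs c" using r by (rule homE)
    obtain us' where us': "us = map (\<lambda>v. mk c' [v] [0]) us'" "length us' = k"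
      "\<forall>u\<in>set us'. is_trm \<Sigma> c' 0 u" using us by (rule elemsE)
    let ?hs = "map (msubst (zip c rs)) hs" and ?ws = "us' @ map (msubst (zip c rs)) vs"
    have bt: "trms c [k] [?b (k, t)]" using b[OF kt] by simp
    have hr: "Comp Syn ?h r = mk c' ?hs \<Theta>" unfolding rs(2) by (rule Comp_mk[OF rs(1) hs])
    have "Comp Syn (mk c [v] [0]) r = mk c' [msubst (zip c rs) v] [0]" if "v \<in> set vs" for v
      unfolding rs(2) using vs[OF that] by (subst Comp_mk[OF rs(1)]) simp_all
    then have vr: "us @ map (\<lambda>v. Comp Syn v r) ?vs = map (\<lambda>v. mk c' [v] [0]) ?ws"
      by (simp add: us'(1))
    have ws: "is_trm \<Sigma> c' 0 w" if "w \<in> set ?ws" for w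
      using that us'(3) vs by (auto intro: is_trm_msubst_zip[OF _ rs(1)])
    have "Syn.app [0] (Comp Syn (mk c [?b (k, t)] [k]) r) us =
        mk c' [subst (\<lambda>j. us' ! j) (msubst (zip c rs) (?b (k, t)))] [0]"
      using app0_mk[of c' us' "msubst (zip c rs) (?b (k, t))"] us' is_trm_msubst_zip[OF b[OF kt] rs(1)]
      unfolding rs(2) Comp_mk[OF rs(1) bt] by simp
    also have "subst (\<lambda>j. us' ! j) (msubst (zip c rs) (?b (k, t))) =
        subst (\<lambda>j. ?ws ! j) (msubst (zip \<Theta> ?hs) t)"
    proof -
      have "msubst (zip c rs) (?b (k, t)) = subst (\<lambda>i. msubst (zip c rs) (lift k (\<lambda>j. vs ! j) i))
          (msubst (zip \<Theta> ?hs) t)"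
        using msubst_subst_closed[OF rs(1) is_trm_msubst_zip[OF trm[OF kt] hs] lift_trm]
          msubst_msubst_zip[OF rs(1) hs trm[OF kt]] by simp
      moreover have "is_trm \<Sigma> c' (k + n) (msubst (zip \<Theta> ?hs) t)"
        by (rule is_trm_msubst_zip[OF trm[OF kt] list_all2_msubst_zip[OF hs rs(1)]])
      then have "subst (\<lambda>i. subst (\<lambda>j. us' ! j) (msubst (zip c rs) (lift k (\<lambda>j. vs ! j) i)))
          (msubst (zip \<Theta> ?hs) t) = subst (\<lambda>j. ?ws ! j) (msubst (zip \<Theta> ?hs) t)"
      proof (rule subst_cong)
        fix i assume i: "i < k + n"
        show "subst (\<lambda>j. us' ! j) (msubst (zip c rs) (lift k (\<lambda>j. vs ! j) i)) = ?ws ! i"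
        proof (cases "i < k")
          case True
          then show ?thesis using lift[OF i] us'(2) by (simp add: nth_append)
        next
          case False
          then have "i - k < n" using i by simp
          then have "is_trm \<Sigma> c' 0 (msubst (zip c rs) (vs ! (i - k)))"
            using vs' by (intro is_trm_msubst_zip[OF _ rs(1)]) simp
          then have "subst (\<lambda>j. us' ! j) (msubst (zip c rs) (vs ! (i - k))) =
              msubst (zip c rs) (vs ! (i - k))" by (rule subst_id) simp
          then show ?thesis using lift[OF i] us'(2) False \<open>i - k < n\<close> len by (simp add: nth_append)
        qed
      qed
      ultimately show ?thesis by (simp add: subst_subst)
    qed
    also have "mk c' [subst (\<lambda>j. ?ws ! j) (msubst (zip \<Theta> ?hs) t)] [0] =
        Syn.val can (Comp Syn ?h r) (us @ map (\<lambda>v. Comp Syn v r) ?vs) t"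
      unfolding hr vr
      by (rule op.IH[OF kt list_all2_msubst_zip[OF hs rs(1)] _ ws, symmetric])
        (simp add: us'(2) len)
    finally show "Syn.app [0] (Comp Syn (mk c [?b (k, t)] [k]) r) us =
        Syn.val can (Comp Syn ?h r) (us @ map (\<lambda>v. Comp Syn v r) ?vs) t" .
  qed
  let ?ms = "map fst as" and ?bs = "map ?b as"
  have bs: "trms c ?ms ?bs"
    using b by (auto simp: list_all2_conv_all_nth split: prod.split) (metis nth_mem)
  have "map (\<lambda>(k, t). Syn.lam c k (\<lambda>r us. Syn.val can (Comp Syn ?h r)
      (us @ map (\<lambda>v. Comp Syn v r) ?vs) t)) as = map (\<lambda>(k, t). mk c [?b (k, t)] [k]) as"
    using lam by (intro map_cong HOL.refl) auto
  also have "\<dots> = map (\<lambda>i. mk c [?bs ! i] [?ms ! i]) [0..<length ?ms]"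
    by (rule nth_equalityI) (auto split: prod.split)
  finally have "Syn.val can ?h ?vs (Op \<omega> as) = Comp Syn (can \<omega>) (mk c ?bs ?ms)"
    using tup_mk[OF bs HOL.refl] by (simp only: Syn.val.simps Dom_mk[OF hs])
  also have "\<dots> = mk c [msubst (zip ?ms ?bs) (op_trm \<omega> ?ms)] [0]"
    unfolding can_def op.hyps(1) option.sel
    by (subst Comp_mk[OF bs]) (simp_all add: is_trm_op_trm[of \<Sigma>, OF op.hyps(1)])
  also have "msubst (zip ?ms ?bs) (op_trm \<omega> ?ms) = Op \<omega> (map (\<lambda>(k, t). (k, ?b (k, t))) as)"
  proof -
    have "msubst (zip ?ms ?bs) (generic i k) = ?b (k, t)" if "i < length as" "as ! i = (k, t)" for i k t
      using msubst_zip_generic[OF bs, of i] that by simp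
    then show ?thesis
      by (auto simp: op_trm_def shift_abs_zip[OF bs] intro!: nth_equalityI split: prod.split)
  qed
  also have "\<dots> = subst (\<lambda>j. vs ! j) (msubst (zip \<Theta> hs) (Op \<omega> as))"
    by (auto simp: shift_abs_zip[OF hs])
  finally show ?case .
qed

text \<open>
  Each term denotes its own class. This is completeness: the equations that hold in the syntactic
  theory under the canonical interpretation are exactly the derivable ones.
\<close>

lemma sem_can:
  assumes t: "is_trm \<Sigma> \<Theta> n t"
  shows "Syn.sem can \<Theta> n t = mk \<Theta> [t] [n]"
proof (rule Syn.sem_eqI)
  have tt: "trms \<Theta> [n] [t]" using t by simp
  show "mk \<Theta> [t] [n] \<in> Hom Syn \<Theta> [n]" by (rule mk_hom[OF tt])
  fix c h vs assume h: "h \<in> Hom Syn c \<Theta>" and vs: "vs \<in> Syn.elems c n"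
  obtain hs where hs: "trms c \<Theta> hs" "h = mk c hs \<Theta>" using h by (rule homE)
  obtain us where us: "vs = map (\<lambda>v. mk c [v] [0]) us" "length us = n"
    "\<forall>u\<in>set us. is_trm \<Sigma> c 0 u" using vs by (rule elemsE)
  show "Syn.app [0] (Comp Syn (mk \<Theta> [t] [n]) h) vs = Syn.val can h vs t"
    unfolding hs(2) us(1) Comp_mk[OF hs(1) tt]
    using val_can[OF t hs(1) us(2)] app0_mk[of c us "msubst (zip \<Theta> hs) t"] is_trm_msubst_zip[OF t hs(1)] us by simp
qed

lemma sem_can_eq_iff:
  assumes "is_trm \<Sigma> \<Theta> n s" "is_trm \<Sigma> \<Theta> n t"
  shows "Syn.sem can \<Theta> n s = Syn.sem can \<Theta> n t \<longleftrightarrow> derivable \<Sigma> Ax \<Theta> n s t"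
  using assms by (simp add: sem_can mk_eq_iff)

end

section \<open>Coding tuples of terms in an infinite type\<close>

text \<open>
  An infinite type admits injections from pairs and from natural numbers; finite lists and terms are
  coded recursively with these.
\<close>

locale pairing =
  fixes pr :: "'u \<times> 'u \<Rightarrow> 'u" and num :: "nat \<Rightarrow> 'u"
  assumes inj_pr: "inj pr" and inj_num: "inj num"
begin

lemma pr_eq [simp]: "pr (a, b) = pr (c, d) \<longleftrightarrow> a = c \<and> b = d"
  using inj_pr by (auto dest: injD)

lemma num_eq [simp]: "num m = num n \<longleftrightarrow> m = n"
  using inj_num by (auto dest: injD)

fun enc_list :: "'u list \<Rightarrow> 'u" where
  "enc_list [] = pr (num 0, num 0)"
| "enc_list (x # xs) = pr (num 1, pr (x, enc_list xs))"

lemma enc_list_eq [simp]: "enc_list xs = enc_list ys \<longleftrightarrow> xs = ys"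
proof (induction xs arbitrary: ys)
  case Nil
  then show ?case by (cases ys) auto
next
  case (Cons x xs)
  then show ?case by (cases ys) auto
qed

fun enc_trm :: "'u trm \<Rightarrow> 'u" where
  "enc_trm (Var i) = pr (num 0, num i)"
| "enc_trm (MVar i ts) = pr (num 1, pr (num i, enc_list (map enc_trm ts)))"
| "enc_trm (Op \<omega> as) = pr (num 2, pr (\<omega>, enc_list (map (\<lambda>(k, t). pr (num k, enc_trm t)) as)))"

lemma enc_trm_inj: "enc_trm s = enc_trm t \<Longrightarrow> s = t"
proof (induction s arbitrary: t rule: trm_induct)
  case (Var i)
  then show ?case by (cases t) auto
next
  case (MVar i ss)
  then obtain ts where t: "t = MVar i ts" and eq: "map enc_trm ss = map enc_trm ts"
    by (cases t) auto
  have "ss = ts"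
    using eq MVar.IH by (auto simp: list_eq_iff_nth_eq)
  then show ?case using t by simp
next
  case (Op \<omega> as)
  then obtain bs where t: "t = Op \<omega> bs"
    and eq: "map (\<lambda>(k, t). pr (num k, enc_trm t)) as = map (\<lambda>(k, t). pr (num k, enc_trm t)) bs"
    by (cases t) auto
  have len: "length as = length bs" using eq by (rule map_eq_imp_length_eq)
  have "as ! i = bs ! i" if i: "i < length as" for i
  proof -
    obtain k s l u where "as ! i = (k, s)" "bs ! i = (l, u)" by (cases "as ! i", cases "bs ! i")
    moreover from this i have "pr (num k, enc_trm s) = pr (num l, enc_trm u)"
      using arg_cong[OF eq, of "\<lambda>xs. xs ! i"] len by simp
    moreover have "(k, s) \<in> set as" using i \<open>as ! i = (k, s)\<close> nth_mem by metis
    ultimately show ?thesis using Op.IH by simp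
  qed
  then show ?case using t len by (simp add: list_eq_iff_nth_eq)
qed

definition enc_arrow :: "'u arity_arrow \<Rightarrow> 'u" where
  "enc_arrow = (\<lambda>(ms, ts, ns). pr (enc_list (map num ms),
     pr (enc_list (map enc_trm ts), enc_list (map num ns))))"

lemma inj_enc_arrow: "inj enc_arrow"
proof (rule injI)
  fix a b assume eq: "enc_arrow a = enc_arrow b"
  have "inj enc_trm" by (rule injI) (rule enc_trm_inj)
  then show "a = b"
    using eq by (cases a, cases b) (auto simp: enc_arrow_def inj_map_eq_map inj_num)
qed

end

lemma ex_inj_arity_arrow:
  assumes "infinite (UNIV :: 'u set)"
  shows "\<exists>code :: 'u arity_arrow \<Rightarrow> 'u. inj code"
proof -
  obtain pr :: "'u \<times> 'u \<Rightarrow> 'u" where "bij_betw pr (UNIV \<times> UNIV) UNIV"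
    using card_of_Times_same_infinite[OF assms] unfolding card_of_ordIso[symmetric] by blast
  then have "inj pr" by (simp add: bij_betw_def)
  moreover obtain num :: "nat \<Rightarrow> 'u" where "inj num"
    using infinite_countable_subset[OF assms] by blast
  ultimately interpret pairing pr num by unfold_locales
  show ?thesis using inj_enc_arrow by blast
qed

section \<open>The category of presentations\<close>

lemma Hom_SOAT: "x \<in> Hom SOAT S T \<longleftrightarrow>
    (\<exists>F. x = (S, F, T) \<and> is_alg_theory S \<and> is_alg_theory T \<and> is_alg_translation S T F)"
  by (auto simp: Hom_def SOAT_def)

definition translation_class :: "'u presentation \<Rightarrow> 'u presentation \<Rightarrow> ('u \<Rightarrow> 'u trm) \<Rightarrow> 'u pres_arrow"
  where "translation_class P Q \<tau> = (P, translation_rel P Q `` {\<tau>}, Q)"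

text \<open>
  With a coding of arrows, every presentation has a syntactic theory, and derivability of equations can
  be tested by comparing denotations there.
\<close>

locale coding =
  fixes code :: "'u arity_arrow \<Rightarrow> 'u"
  assumes inj: "inj code"
begin

lemma syntactic: "is_presentation P \<Longrightarrow> syntactic_theory P code"
  by unfold_locales (auto simp: inj)

lemma is_translation_trm:
  "is_translation P Q \<tau> \<Longrightarrow> sig P \<omega> = Some ms \<Longrightarrow> is_trm (sig Q) ms 0 (\<tau> \<omega>)"
  by (auto simp: is_translation_def is_sig_translation_def)

text \<open>
  A translation interprets its source in the syntactic theory of its target, and the axioms hold in
  this interpretation. By soundness all derivable equations hold, and by completeness they are
  derivable in the target.
\<close>

lemma derivable_translate:
  fixes P :: "'u presentation"
  assumes PQ: "is_presentation P" "is_presentation Q" and \<tau>: "is_translation P Q \<tau>"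
    and st: "derivable (sig P) (axs P) \<Theta> n s t"
  shows "derivable (sig Q) (axs Q) \<Theta> n (translate \<tau> s) (translate \<tau> t)"
proof -
  interpret Q: syntactic_theory Q code by (rule syntactic[OF PQ(2)])
  have \<tau>': "is_sig_translation (sig P) (sig Q) \<tau>" using \<tau> by (simp add: is_translation_def)
  let ?J = "\<lambda>\<omega>. Q.Syn.sem Q.can (the (sig P \<omega>)) 0 (\<tau> \<omega>)"
  have J: "Q.Syn.interprets ?J (sig P)"
    by (rule Q.Syn.interprets_translation[OF Q.interprets_can \<tau>']) simp
  have tr: "Q.Syn.sem Q.can \<Theta> n (translate \<tau> t) = Q.Syn.sem ?J \<Theta> n t"
    if "is_trm (sig P) \<Theta> n t" for \<Theta> n t
    by (rule Q.Syn.sem_translate[OF Q.interprets_can \<tau>' _ that]) simp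
  have "Q.Syn.sem ?J \<Theta> n s = Q.Syn.sem ?J \<Theta> n t"
  proof (rule Q.Syn.derivable_sound[OF J _ st])
    fix \<Theta> n s t assume ax: "(\<Theta>, n, s, t) \<in> axs P"
    then have trm: "is_trm (sig P) \<Theta> n s" "is_trm (sig P) \<Theta> n t"
      using PQ(1) by (auto simp: is_presentation_def)
    have "derivable (sig Q) (axs Q) \<Theta> n (translate \<tau> s) (translate \<tau> t)"
      using \<tau> ax by (auto simp: is_translation_def)
    then show "is_trm (sig P) \<Theta> n s \<and> is_trm (sig P) \<Theta> n t \<and> Q.Syn.sem ?J \<Theta> n s = Q.Syn.sem ?J \<Theta> n t"
      using trm Q.sem_can_eq_iff[OF is_trm_translate[OF trm(1) \<tau>'] is_trm_translate[OF trm(2) \<tau>']]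
      by (simp add: tr)
  qed
  moreover have trm: "is_trm (sig P) \<Theta> n s" "is_trm (sig P) \<Theta> n t"
    using presentation_derivable_is_trm[OF PQ(1) st] by auto
  ultimately show ?thesis
    using Q.sem_can_eq_iff[OF is_trm_translate[OF trm(1) \<tau>'] is_trm_translate[OF trm(2) \<tau>']]
    by (simp add: tr)
qed

lemma derivable_translate_cong:
  fixes Q :: "'u presentation"
  assumes Q: "is_presentation Q" and rel: "(\<tau>, \<tau>') \<in> translation_rel P Q"
    and t: "is_trm (sig P) \<Theta> n t"
  shows "derivable (sig Q) (axs Q) \<Theta> n (translate \<tau> t) (translate \<tau>' t)"
proof -
  interpret Q: syntactic_theory Q code by (rule syntactic[OF Q])
  have \<tau>: "is_sig_translation (sig P) (sig Q) \<tau>" "is_sig_translation (sig P) (sig Q) \<tau>'"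
    using rel by (auto simp: translation_rel_def is_translation_def)
  let ?J = "\<lambda>\<tau> \<omega>. Q.Syn.sem Q.can (the (sig P \<omega>)) 0 (\<tau> \<omega>)"
  have "Q.Syn.sem Q.can \<Theta> n (translate \<tau> t) = Q.Syn.sem (?J \<tau>) \<Theta> n t"
    "Q.Syn.sem Q.can \<Theta> n (translate \<tau>' t) = Q.Syn.sem (?J \<tau>') \<Theta> n t"
    by (rule Q.Syn.sem_translate[OF Q.interprets_can \<tau>(1) _ t], simp,
        rule Q.Syn.sem_translate[OF Q.interprets_can \<tau>(2) _ t], simp)
  moreover have "Q.Syn.sem (?J \<tau>) \<Theta> n t = Q.Syn.sem (?J \<tau>') \<Theta> n t"
  proof (rule Q.Syn.sem_cong[OF _ t])
    fix \<omega> ms assume \<omega>: "sig P \<omega> = Some ms"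
    then have "derivable (sig Q) (axs Q) ms 0 (\<tau> \<omega>) (\<tau>' \<omega>)" using rel by (simp add: translation_rel_def)
    then show "?J \<tau> \<omega> = ?J \<tau>' \<omega>"
      using Q.sem_can_eq_iff presentation_derivable_is_trm[OF Q] \<omega> by simp
  qed
  ultimately show ?thesis
    using Q.sem_can_eq_iff[OF is_trm_translate[OF t \<tau>(1)] is_trm_translate[OF t \<tau>(2)]] by simp
qed

lemma is_sig_translation_comp:
  assumes "is_sig_translation (sig P) (sig Q) \<tau>" "is_sig_translation (sig Q) (sig R) \<tau>'"
  shows "is_sig_translation (sig P) (sig R) (comp_translation P \<tau>' \<tau>)"
  using assms is_trm_translate[OF _ assms(2)]
  by (auto simp: is_sig_translation_def comp_translation_def)

text \<open>
  Both sides have the same denotation in the syntactic theory of \<open>R\<close>, by \<open>sem_translate\<close> applied once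
  to \<open>\<tau>'\<close> and once to \<open>\<tau>\<close>. The case of a value \<open>\<tau> \<omega>\<close> of a translation is the associativity of composition up to
  derivability.
\<close>

lemma derivable_translate_comp:
  fixes R :: "'u presentation"
  assumes R: "is_presentation R"
    and \<tau>: "is_sig_translation (sig P) (sig Q) \<tau>" and \<tau>': "is_sig_translation (sig Q) (sig R) \<tau>'"
    and t: "is_trm (sig P) \<Theta> n t"
  shows "derivable (sig R) (axs R) \<Theta> n
    (translate \<tau>' (translate \<tau> t)) (translate (comp_translation P \<tau>' \<tau>) t)"
proof -
  interpret R: syntactic_theory R code by (rule syntactic[OF R])
  note c = is_sig_translation_comp[OF \<tau> \<tau>']
  let ?J' = "\<lambda>\<omega>. R.Syn.sem R.can (the (sig Q \<omega>)) 0 (\<tau>' \<omega>)"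
  let ?J = "\<lambda>\<omega>. R.Syn.sem ?J' (the (sig P \<omega>)) 0 (\<tau> \<omega>)"
  have J': "R.Syn.interprets ?J' (sig Q)"
    by (rule R.Syn.interprets_translation[OF R.interprets_can \<tau>']) simp
  have tr': "R.Syn.sem R.can \<Theta> n (translate \<tau>' t) = R.Syn.sem ?J' \<Theta> n t"
    if "is_trm (sig Q) \<Theta> n t" for \<Theta> n t
    by (rule R.Syn.sem_translate[OF R.interprets_can \<tau>' _ that]) simp
  have trm: "is_trm (sig Q) \<Theta> n (translate \<tau> t)" by (rule is_trm_translate[OF t \<tau>])
  have "R.Syn.sem R.can \<Theta> n (translate \<tau>' (translate \<tau> t)) = R.Syn.sem ?J \<Theta> n t"
    unfolding tr'[OF trm] by (rule R.Syn.sem_translate[OF J' \<tau> _ t]) simp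
  also have "\<dots> = R.Syn.sem R.can \<Theta> n (translate (comp_translation P \<tau>' \<tau>) t)"
  proof (rule R.Syn.sem_translate[OF R.interprets_can c _ t, symmetric])
    fix \<omega> ms assume \<omega>: "sig P \<omega> = Some ms"
    then have "is_trm (sig Q) ms 0 (\<tau> \<omega>)" using \<tau> by (simp add: is_sig_translation_def)
    from tr'[OF this] show "?J \<omega> = R.Syn.sem R.can ms 0 (comp_translation P \<tau>' \<tau> \<omega>)"
      using \<omega> by (simp add: comp_translation_def domI)
  qed
  finally show ?thesis
    using R.sem_can_eq_iff[OF is_trm_translate[OF trm \<tau>'] is_trm_translate[OF t c]] by simp
qed

lemma id_translation_eq: "sig P \<omega> = Some ms \<Longrightarrow> id_translation P \<omega> = op_trm \<omega> ms"
  by (simp add: id_translation_def op_trm_def domI Let_def)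

lemma is_sig_translation_id: "is_sig_translation (sig P) (sig P) (id_translation P)"
  by (auto simp: is_sig_translation_def id_translation_eq is_trm_op_trm) (simp add: id_translation_def)

lemma derivable_translate_id:
  fixes P :: "'u presentation"
  assumes P: "is_presentation P" and t: "is_trm (sig P) \<Theta> n t"
  shows "derivable (sig P) (axs P) \<Theta> n (translate (id_translation P) t) t"
proof -
  interpret P: syntactic_theory P code by (rule syntactic[OF P])
  have "P.Syn.sem P.can \<Theta> n (translate (id_translation P) t) = P.Syn.sem P.can \<Theta> n t"
  proof (rule P.Syn.sem_translate[OF P.interprets_can is_sig_translation_id _ t])
    fix \<omega> ms assume \<omega>: "sig P \<omega> = Some ms"
    then have "P.can \<omega> \<in> Hom P.Syn ms [0]" using P.interprets_can by (simp add: P.Syn.interprets_def)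
    then show "P.can \<omega> = P.Syn.sem P.can ms 0 (id_translation P \<omega>)"
      using \<omega> by (simp add: id_translation_eq P.Syn.sem_op_trm)
  qed
  then show ?thesis
    using P.sem_can_eq_iff[OF is_trm_translate[OF t is_sig_translation_id] t] by simp
qed

lemma derivable_translate_op_trm:
  fixes Q :: "'u presentation"
  assumes Q: "is_presentation Q" and \<tau>: "is_sig_translation (sig P) (sig Q) \<tau>"
    and \<omega>: "sig P \<omega> = Some ms"
  shows "derivable (sig Q) (axs Q) ms 0 (translate \<tau> (op_trm \<omega> ms)) (\<tau> \<omega>)"
proof -
  interpret Q: syntactic_theory Q code by (rule syntactic[OF Q])
  have trm: "is_trm (sig P) ms 0 (op_trm \<omega> ms)" "is_trm (sig Q) ms 0 (\<tau> \<omega>)"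
    using \<omega> \<tau> by (simp_all add: is_trm_op_trm is_sig_translation_def)
  let ?J = "\<lambda>\<omega>. Q.Syn.sem Q.can (the (sig P \<omega>)) 0 (\<tau> \<omega>)"
  have "Q.Syn.sem Q.can ms 0 (translate \<tau> (op_trm \<omega> ms)) = Q.Syn.sem ?J ms 0 (op_trm \<omega> ms)"
    by (rule Q.Syn.sem_translate[OF Q.interprets_can \<tau> _ trm(1)]) simp
  also have "\<dots> = ?J \<omega>"
    by (rule Q.Syn.sem_op_trm) (simp add: \<omega> Q.Syn.sem_hom[OF Q.interprets_can trm(2)])
  finally show ?thesis
    using Q.sem_can_eq_iff[OF is_trm_translate[OF trm(1) \<tau>] trm(2)] \<omega> by simp
qed

lemma is_translation_comp:
  fixes P :: "'u presentation"
  assumes PQR: "is_presentation P" "is_presentation Q" "is_presentation R"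
    and \<tau>: "is_translation P Q \<tau>" and \<tau>': "is_translation Q R \<tau>'"
  shows "is_translation P R (comp_translation P \<tau>' \<tau>)"
proof -
  have s: "is_sig_translation (sig P) (sig Q) \<tau>" "is_sig_translation (sig Q) (sig R) \<tau>'"
    using \<tau> \<tau>' by (auto simp: is_translation_def)
  have "derivable (sig R) (axs R) \<Theta> n (translate (comp_translation P \<tau>' \<tau>) s)
      (translate (comp_translation P \<tau>' \<tau>) t)" if ax: "(\<Theta>, n, s, t) \<in> axs P" for \<Theta> n s t
  proof -
    have trm: "is_trm (sig P) \<Theta> n s" "is_trm (sig P) \<Theta> n t"
      using PQR(1) ax by (auto simp: is_presentation_def)
    have "derivable (sig Q) (axs Q) \<Theta> n (translate \<tau> s) (translate \<tau> t)"
      using \<tau> ax by (auto simp: is_translation_def)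
    from derivable_translate[OF PQR(2,3) \<tau>' this]
    have "derivable (sig R) (axs R) \<Theta> n (translate \<tau>' (translate \<tau> s)) (translate \<tau>' (translate \<tau> t))" .
    then show ?thesis
      using derivable_translate_comp[OF PQR(3) s trm(1)] derivable_translate_comp[OF PQR(3) s trm(2)]
      by (blast intro: derivable.trans derivable.sym)
  qed
  then show ?thesis using is_sig_translation_comp[OF s] by (auto simp: is_translation_def)
qed

lemma is_translation_id:
  fixes P :: "'u presentation"
  assumes P: "is_presentation P"
  shows "is_translation P P (id_translation P)"
proof -
  have "derivable (sig P) (axs P) \<Theta> n (translate (id_translation P) s) (translate (id_translation P) t)"
    if ax: "(\<Theta>, n, s, t) \<in> axs P" for \<Theta> n s t
  proof -
    have trm: "is_trm (sig P) \<Theta> n s" "is_trm (sig P) \<Theta> n t"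
      using P ax by (auto simp: is_presentation_def)
    show ?thesis
      using derivable_translate_id[OF P trm(1)] derivable_translate_id[OF P trm(2)]
        derivable.axiom[OF ax, of "sig P"]
      by (blast intro: derivable.trans derivable.sym)
  qed
  then show ?thesis using is_sig_translation_id by (auto simp: is_translation_def)
qed

lemma translation_relI:
  "is_translation P Q \<tau> \<Longrightarrow> is_translation P Q \<tau>' \<Longrightarrow>
    (\<And>\<omega> ms. sig P \<omega> = Some ms \<Longrightarrow> derivable (sig Q) (axs Q) ms 0 (\<tau> \<omega>) (\<tau>' \<omega>)) \<Longrightarrow>
    (\<tau>, \<tau>') \<in> translation_rel P Q"
  by (simp add: translation_rel_def)

lemma equiv_translation_rel: "equiv {\<tau>. is_translation P Q \<tau>} (translation_rel P Q)"
proof (rule equivI)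
  show "translation_rel P Q \<subseteq> {\<tau>. is_translation P Q \<tau>} \<times> {\<tau>. is_translation P Q \<tau>}"
    by (auto simp: translation_rel_def)
  show "refl_on {\<tau>. is_translation P Q \<tau>} (translation_rel P Q)"
    by (auto simp: refl_on_def translation_rel_def intro: derivable.refl is_translation_trm)
  show "sym (translation_rel P Q)"
    by (auto simp: sym_def translation_rel_def intro: derivable.sym)
  show "trans (translation_rel P Q)"
    by (rule transI) (simp add: translation_rel_def, blast intro: derivable.trans)
qed

lemma translation_class_eq_iff:
  "is_translation P Q \<tau> \<Longrightarrow> is_translation P Q \<tau>' \<Longrightarrow>
    translation_class P Q \<tau> = translation_class P Q \<tau>' \<longleftrightarrow> (\<tau>, \<tau>') \<in> translation_rel P Q"
  using eq_equiv_class_iff[OF equiv_translation_rel[of P Q]] by (simp add: translation_class_def)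

lemma translation_class_hom:
  "is_presentation P \<Longrightarrow> is_presentation Q \<Longrightarrow> is_translation P Q \<tau> \<Longrightarrow>
    translation_class P Q \<tau> \<in> Hom SOEP P Q"
  by (auto simp: Hom_def SOEP_def translation_class_def intro: quotientI)

lemma Hom_SOEPE:
  assumes "f \<in> Hom SOEP P Q"
  obtains \<tau> where "is_presentation P" "is_presentation Q" "is_translation P Q \<tau>"
    "f = translation_class P Q \<tau>"
  using assms by (auto simp: Hom_def SOEP_def translation_class_def elim!: quotientE)

text \<open>
  The union over representatives in the definition of composition is a union of equal classes.
\<close>

lemma Comp_translation_class:
  fixes P :: "'u presentation"
  assumes PQR: "is_presentation P" "is_presentation Q" "is_presentation R"
    and \<tau>: "is_translation P Q \<tau>" and \<tau>': "is_translation Q R \<tau>'"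
  shows "Comp SOEP (translation_class Q R \<tau>') (translation_class P Q \<tau>) =
    translation_class P R (comp_translation P \<tau>' \<tau>)"
proof -
  let ?A = "translation_rel P Q `` {\<tau>}" and ?B = "translation_rel Q R `` {\<tau>'}"
  have "translation_rel P R `` {comp_translation P \<sigma>' \<sigma>} =
      translation_rel P R `` {comp_translation P \<tau>' \<tau>}" if \<sigma>: "\<sigma> \<in> ?A" "\<sigma>' \<in> ?B" for \<sigma> \<sigma>'
  proof (rule equiv_class_eq[OF equiv_translation_rel, symmetric], rule translation_relI)
    have \<sigma>t: "is_translation P Q \<sigma>" "is_translation Q R \<sigma>'"
      using \<sigma> by (auto simp: translation_rel_def)
    show "is_translation P R (comp_translation P \<tau>' \<tau>)" "is_translation P R (comp_translation P \<sigma>' \<sigma>)"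
      by (rule is_translation_comp[OF PQR \<tau> \<tau>'], rule is_translation_comp[OF PQR \<sigma>t])
    fix \<omega> ms assume \<omega>: "sig P \<omega> = Some ms"
    have "derivable (sig Q) (axs Q) ms 0 (\<tau> \<omega>) (\<sigma> \<omega>)" using \<sigma>(1) \<omega> by (simp add: translation_rel_def)
    from derivable_translate[OF PQR(2,3) \<tau>' this]
    have "derivable (sig R) (axs R) ms 0 (translate \<tau>' (\<tau> \<omega>)) (translate \<tau>' (\<sigma> \<omega>))" .
    moreover have "derivable (sig R) (axs R) ms 0 (translate \<tau>' (\<sigma> \<omega>)) (translate \<sigma>' (\<sigma> \<omega>))"
      by (rule derivable_translate_cong[OF PQR(3)]) (use \<sigma>(2) is_translation_trm[OF \<sigma>t(1) \<omega>] in auto)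
    ultimately show "derivable (sig R) (axs R) ms 0 (comp_translation P \<tau>' \<tau> \<omega>) (comp_translation P \<sigma>' \<sigma> \<omega>)"
      using \<omega> by (auto simp: comp_translation_def domI intro: derivable.trans)
  qed
  moreover have "\<tau> \<in> ?A" "\<tau>' \<in> ?B"
    using \<tau> \<tau>' equiv_class_self[OF equiv_translation_rel] by auto
  ultimately have "(\<Union>\<sigma>\<in>?A. \<Union>\<sigma>'\<in>?B. translation_rel P R `` {comp_translation P \<sigma>' \<sigma>}) =
      translation_rel P R `` {comp_translation P \<tau>' \<tau>}"
    by blast
  then show ?thesis by (simp add: SOEP_def translation_class_def)
qed

lemma Ide_SOEP: "Ide SOEP P = translation_class P P (id_translation P)"
  by (simp add: SOEP_def translation_class_def)

lemma category_SOEP: "category (SOEP :: ('u presentation, 'u pres_arrow) cat)"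
proof
  fix f :: "'u pres_arrow" assume f: "f \<in> Arr SOEP"
  then show "Dom SOEP f \<in> Obj SOEP" "Cod SOEP f \<in> Obj SOEP" by (auto simp: SOEP_def)
next
  fix P :: "'u presentation" assume "P \<in> Obj SOEP"
  then have "is_presentation P" by (simp add: SOEP_def)
  then show "Ide SOEP P \<in> Hom SOEP P P"
    unfolding Ide_SOEP by (intro translation_class_hom is_translation_id)
next
  fix f g and P Q R :: "'u presentation" assume "f \<in> Hom SOEP P Q" "g \<in> Hom SOEP Q R"
  then obtain \<tau> \<tau>' where *: "is_presentation P" "is_presentation Q" "is_presentation R"
    "is_translation P Q \<tau>" "is_translation Q R \<tau>'"
    "f = translation_class P Q \<tau>" "g = translation_class Q R \<tau>'" by (elim Hom_SOEPE)
  show "Comp SOEP g f \<in> Hom SOEP P R"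
    unfolding *(6,7) Comp_translation_class[OF *(1-5)]
    by (rule translation_class_hom[OF *(1,3) is_translation_comp[OF *(1-5)]])
next
  fix f and P Q :: "'u presentation" assume "f \<in> Hom SOEP P Q"
  then obtain \<tau> where *: "is_presentation P" "is_presentation Q" "is_translation P Q \<tau>"
    "f = translation_class P Q \<tau>" by (elim Hom_SOEPE)
  have s: "is_sig_translation (sig P) (sig Q) \<tau>" using *(3) by (simp add: is_translation_def)
  note idP = is_translation_id[OF *(1)] and idQ = is_translation_id[OF *(2)]
  have "(comp_translation P \<tau> (id_translation P), \<tau>) \<in> translation_rel P Q"
    by (rule translation_relI[OF is_translation_comp[OF *(1,1,2) idP *(3)] *(3)])
      (simp add: comp_translation_def domI id_translation_eq derivable_translate_op_trm[OF *(2) s])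
  then show "Comp SOEP f (Ide SOEP P) = f"
    unfolding *(4) Ide_SOEP Comp_translation_class[OF *(1,1,2) idP *(3)]
    by (simp add: translation_class_eq_iff[OF is_translation_comp[OF *(1,1,2) idP *(3)] *(3)])
  have "(comp_translation P (id_translation Q) \<tau>, \<tau>) \<in> translation_rel P Q"
    by (rule translation_relI[OF is_translation_comp[OF *(1,2,2,3) idQ] *(3)])
      (simp add: comp_translation_def domI derivable_translate_id[OF *(2)] is_translation_trm[OF *(3)])
  then show "Comp SOEP (Ide SOEP Q) f = f"
    unfolding *(4) Ide_SOEP Comp_translation_class[OF *(1,2,2,3) idQ]
    by (simp add: translation_class_eq_iff[OF is_translation_comp[OF *(1,2,2,3) idQ] *(3)])
next
  fix f g h and P Q R S :: "'u presentation" assume "f \<in> Hom SOEP P Q" "g \<in> Hom SOEP Q R" "h \<in> Hom SOEP R S"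
  then obtain \<tau> \<tau>' \<tau>'' where *: "is_presentation P" "is_presentation Q" "is_presentation R"
    "is_presentation S" "is_translation P Q \<tau>" "is_translation Q R \<tau>'" "is_translation R S \<tau>''"
    "f = translation_class P Q \<tau>" "g = translation_class Q R \<tau>'" "h = translation_class R S \<tau>''"
    by (elim Hom_SOEPE)
  have s: "is_sig_translation (sig Q) (sig R) \<tau>'" "is_sig_translation (sig R) (sig S) \<tau>''"
    using *(6,7) by (auto simp: is_translation_def)
  note c1 = is_translation_comp[OF *(1-3,5,6)] and c2 = is_translation_comp[OF *(2-4,6,7)]
  note d1 = is_translation_comp[OF *(1,3,4) c1 *(7)] and d2 = is_translation_comp[OF *(1,2,4,5) c2]
  have "(comp_translation P \<tau>'' (comp_translation P \<tau>' \<tau>),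
      comp_translation P (comp_translation Q \<tau>'' \<tau>') \<tau>) \<in> translation_rel P S"
  proof (rule translation_relI[OF d1 d2])
    fix \<omega> ms assume \<omega>: "sig P \<omega> = Some ms"
    show "derivable (sig S) (axs S) ms 0 (comp_translation P \<tau>'' (comp_translation P \<tau>' \<tau>) \<omega>)
        (comp_translation P (comp_translation Q \<tau>'' \<tau>') \<tau> \<omega>)"
      using derivable_translate_comp[OF *(4) s is_translation_trm[OF *(5) \<omega>]] \<omega>
      by (simp add: comp_translation_def domI)
  qed
  then show "Comp SOEP h (Comp SOEP g f) = Comp SOEP (Comp SOEP h g) f"
    unfolding *(8-10) Comp_translation_class[OF *(1-3,5,6)] Comp_translation_class[OF *(2-4,6,7)]
      Comp_translation_class[OF *(1,3,4) c1 *(7)] Comp_translation_class[OF *(1,2,4,5) c2]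
    by (simp add: translation_class_eq_iff[OF d1 d2])
qed

end

section \<open>The category of theories\<close>

lemma is_functor_id: "category C \<Longrightarrow> is_functor C C (id_ftr C)"
  unfolding is_functor_def id_ftr_def
  using category.dom_obj category.cod_obj category.ide_hom category.comp_hom
  by (fastforce simp: Hom_def)

lemma is_functor_comp:
  assumes F: "is_functor C D F" and G: "is_functor D E G"
  shows "is_functor C E (comp_ftr C G F)"
proof -
  have C: "category C" using F by (simp add: is_functor_def)
  have hom: "AMap G (AMap F f) \<in> Hom E (OMap G (OMap F a)) (OMap G (OMap F b))" if "f \<in> Hom C a b" for f a b
    by (rule is_functor_Hom[OF G is_functor_Hom[OF F that]])
  have hom': "AMap G (AMap F f) \<in> Hom E (OMap G (OMap F (Dom C f))) (OMap G (OMap F (Cod C f)))"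
    if "f \<in> Arr C" for f using that by (intro hom) (simp add: Hom_def)
  show ?thesis
    unfolding is_functor_def
  proof (intro conjI ballI impI)
    show "category C" "category E" using F G by (auto simp: is_functor_def)
    show "OMap (comp_ftr C G F) \<in> Obj C \<rightarrow>\<^sub>E Obj E"
      using is_functor_Obj[OF F] is_functor_Obj[OF G] by (auto simp: comp_ftr_def compose_def)
    show "AMap (comp_ftr C G F) \<in> Arr C \<rightarrow>\<^sub>E Arr E"
      using hom' by (auto simp: comp_ftr_def compose_def Hom_def)
    show "Dom E (AMap (comp_ftr C G F) f) = OMap (comp_ftr C G F) (Dom C f)"
      "Cod E (AMap (comp_ftr C G F) f) = OMap (comp_ftr C G F) (Cod C f)" if "f \<in> Arr C" for f
      using hom'[OF that] that category.dom_obj[OF C that] category.cod_obj[OF C that]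
      by (auto simp: comp_ftr_def compose_def Hom_def)
    show "AMap (comp_ftr C G F) (Ide C a) = Ide E (OMap (comp_ftr C G F) a)" if "a \<in> Obj C" for a
      using category.ide_hom[OF C that] that is_functor_Ide[OF F that]
        is_functor_Ide[OF G is_functor_Obj[OF F that]]
      by (simp add: comp_ftr_def compose_def Hom_def)
    fix f g assume fg: "f \<in> Arr C" "g \<in> Arr C" "Cod C f = Dom C g"
    then have f: "f \<in> Hom C (Dom C f) (Dom C g)" and g: "g \<in> Hom C (Dom C g) (Cod C g)"
      by (auto simp: Hom_def)
    show "AMap (comp_ftr C G F) (Comp C g f) =
        Comp E (AMap (comp_ftr C G F) g) (AMap (comp_ftr C G F) f)"
      using HomD(1)[OF category.comp_hom[OF C f g]] fg is_functor_Comp[OF F f g]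
        is_functor_Comp[OF G is_functor_Hom[OF F f] is_functor_Hom[OF F g]]
      by (simp add: comp_ftr_def compose_def)
  qed
qed

lemma comp_ftr_id_right: "is_functor C D F \<Longrightarrow> comp_ftr C F (id_ftr C) = F"
  by (cases F) (auto simp: comp_ftr_def id_ftr_def compose_def is_functor_def PiE_def extensional_def
      restrict_def fun_eq_iff)

lemma comp_ftr_id_left: "is_functor C D F \<Longrightarrow> comp_ftr C (id_ftr D) F = F"
  by (cases F) (auto simp: comp_ftr_def id_ftr_def compose_def is_functor_def PiE_def extensional_def
      restrict_def fun_eq_iff Pi_iff)

lemma comp_ftr_assoc:
  "is_functor C D F \<Longrightarrow> comp_ftr C H (comp_ftr C G F) = comp_ftr C (comp_ftr D H G) F"
  by (auto simp: comp_ftr_def compose_def is_functor_def restrict_def fun_eq_iff)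

lemma algebraic_translationI:
  "is_alg_theory S \<Longrightarrow> is_alg_theory T \<Longrightarrow> is_alg_translation S T H \<Longrightarrow> algebraic_translation S T H"
  by (simp add: algebraic_translation_def second_order_theory_def algebraic_translation_axioms_def)

lemma is_alg_translation_id: "is_alg_theory T \<Longrightarrow> is_alg_translation T T (id_ftr T)"
proof -
  assume T: "is_alg_theory T"
  then interpret second_order_theory T by unfold_locales
  have "AMap (Emb T) a \<in> Arr T" if "a \<in> Arr \<bbbM>" for a
    using functor_Emb that by (auto simp: is_functor_def)
  then show ?thesis
    by (intro is_alg_translationI[OF T T] is_functor_id category_axioms)
      (simp_all add: id_ftr_def)
qed

lemma is_alg_translation_comp:
  assumes "algebraic_translation R S F" "algebraic_translation S T G"
  shows "is_alg_translation R T (comp_ftr R G F)"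
proof -
  interpret F: algebraic_translation R S F by (rule assms)
  interpret G: algebraic_translation S T G by (rule assms)
  have "AMap (Emb R) a \<in> Arr R" if "a \<in> Arr \<bbbM>" for a
    using F.S.functor_Emb that by (auto simp: is_functor_def)
  then show ?thesis
    using is_functor_comp[OF F.functor_H G.functor_H]
    by (intro is_alg_translationI[OF F.S.alg_theory G.T.alg_theory])
      (simp_all add: comp_ftr_def compose_def F.H_Emb G.H_Emb)
qed

lemma category_SOAT: "category (SOAT :: ('u alg_theory, 'u theory_arrow) cat)"
proof
  fix f :: "'u theory_arrow" assume f: "f \<in> Arr SOAT"
  then show "Dom SOAT f \<in> Obj SOAT" "Cod SOAT f \<in> Obj SOAT" by (auto simp: SOAT_def)
next
  fix T :: "'u alg_theory" assume "T \<in> Obj SOAT"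
  then show "Ide SOAT T \<in> Hom SOAT T T"
    by (simp add: Hom_SOAT) (simp add: SOAT_def is_alg_translation_id)
next
  fix f g :: "'u theory_arrow" and R S T assume "f \<in> Hom SOAT R S" "g \<in> Hom SOAT S T"
  then obtain F G where *: "f = (R, F, S)" "g = (S, G, T)" "is_alg_theory R" "is_alg_theory T"
    "algebraic_translation R S F" "algebraic_translation S T G"
    by (auto simp: Hom_SOAT algebraic_translationI)
  have "Comp SOAT g f = (R, comp_ftr R G F, T)" by (simp add: *(1,2) SOAT_def)
  then show "Comp SOAT g f \<in> Hom SOAT R T"
    using *(3,4) is_alg_translation_comp[OF *(5,6)] by (simp add: Hom_SOAT)
next
  fix f :: "'u theory_arrow" and S T assume "f \<in> Hom SOAT S T"
  then obtain F where F: "f = (S, F, T)" "algebraic_translation S T F"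
    by (auto simp: Hom_SOAT algebraic_translationI)
  interpret algebraic_translation S T F by (rule F)
  show "Comp SOAT f (Ide SOAT S) = f" "Comp SOAT (Ide SOAT T) f = f"
    using functor_H by (simp_all add: F(1) SOAT_def comp_ftr_id_left comp_ftr_id_right)
next
  fix f g h :: "'u theory_arrow" and R S T U
  assume "f \<in> Hom SOAT R S" "g \<in> Hom SOAT S T" "h \<in> Hom SOAT T U"
  then obtain F G H where *: "f = (R, F, S)" "g = (S, G, T)" "h = (T, H, U)" "algebraic_translation R S F"
    by (auto simp: Hom_SOAT algebraic_translationI)
  interpret algebraic_translation R S F by (rule *)
  show "Comp SOAT h (Comp SOAT g f) = Comp SOAT (Comp SOAT h g) f"
    by (simp add: *(1-3) SOAT_def comp_ftr_assoc[OF functor_H])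
qed

section \<open>The presentation of a theory\<close>

text \<open>
  The internal language of a theory: its axioms are all equations that hold under the tautological
  interpretation, in which an operator, being an arrow of the theory, denotes itself.
\<close>

definition pres_of :: "'u alg_theory \<Rightarrow> 'u presentation" where
  "pres_of T = \<lparr>sig = sig_of T,
     axs = {(\<Theta>, n, s, t). is_trm (sig_of T) \<Theta> n s \<and> is_trm (sig_of T) \<Theta> n t \<and>
       second_order_theory.sem T (\<lambda>f. f) \<Theta> n s = second_order_theory.sem T (\<lambda>f. f) \<Theta> n t}\<rparr>"

lemma sig_pres_of [simp]: "sig (pres_of T) = sig_of T"
  by (simp add: pres_of_def)

lemma is_presentation_pres_of: "is_presentation (pres_of T)"
  by (auto simp: is_presentation_def pres_of_def)

context second_order_theory
begin

abbreviation den :: "nat list \<Rightarrow> nat \<Rightarrow> 'u trm \<Rightarrow> 'u" where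
  "den \<equiv> sem (\<lambda>f. f)"

text \<open>
  By soundness, nothing beyond the axioms is derivable.
\<close>

lemma derivable_pres_of:
  assumes "is_trm (sig_of T) \<Theta> n s" "is_trm (sig_of T) \<Theta> n t"
  shows "derivable (sig_of T) (axs (pres_of T)) \<Theta> n s t \<longleftrightarrow> den \<Theta> n s = den \<Theta> n t"
proof
  assume d: "derivable (sig_of T) (axs (pres_of T)) \<Theta> n s t"
  show "den \<Theta> n s = den \<Theta> n t"
    by (rule derivable_sound[OF interprets_sig_of _ d]) (auto simp: pres_of_def)
next
  assume "den \<Theta> n s = den \<Theta> n t"
  then show "derivable (sig_of T) (axs (pres_of T)) \<Theta> n s t"
    using assms by (intro derivable.axiom) (simp add: pres_of_def)
qed

lemma is_translation_pres_ofI: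
  assumes P: "is_presentation P" and \<tau>: "is_sig_translation (sig P) (sig_of T) \<tau>"
    and "\<And>\<Theta> n s t. (\<Theta>, n, s, t) \<in> axs P \<Longrightarrow> den \<Theta> n (translate \<tau> s) = den \<Theta> n (translate \<tau> t)"
  shows "is_translation P (pres_of T) \<tau>"
  unfolding is_translation_def
proof (intro conjI ballI, goal_cases)
  case (2 e)
  obtain \<Theta> n s t where e: "e = (\<Theta>, n, s, t)" by (cases e)
  then have trm: "is_trm (sig P) \<Theta> n s" "is_trm (sig P) \<Theta> n t"
    using P 2 by (auto simp: is_presentation_def)
  show ?case
    using assms(3) 2 derivable_pres_of[OF is_trm_translate[OF trm(1) \<tau>] is_trm_translate[OF trm(2) \<tau>]] e
    by simp
qed (use \<tau> in simp)

lemma den_op_trm: "f \<in> Hom T ms [0] \<Longrightarrow> den ms 0 (op_trm f ms) = f"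
  by (rule sem_op_trm)

end

definition trans_of :: "'u alg_theory \<Rightarrow> (nat list, 'u, nat list, 'u) ftr \<Rightarrow> 'u \<Rightarrow> 'u trm" where
  "trans_of S H = (\<lambda>f\<in>dom (sig_of S). op_trm (AMap H f) (the (sig_of S f)))"

lemma trans_of_eq: "f \<in> Hom S ms [0] \<Longrightarrow> trans_of S H f = op_trm (AMap H f) ms"
  using sig_of_eq_Some[of S f ms] by (simp add: trans_of_def domI)

context algebraic_translation
begin

lemma is_sig_translation_trans_of: "is_sig_translation (sig_of S) (sig_of T) (trans_of S H)"
proof -
  have "is_trm (sig_of T) ms 0 (trans_of S H f)" if "f \<in> Hom S ms [0]" for f ms
    using H_hom[OF that] by (simp add: trans_of_eq[OF that] is_trm_op_trm sig_of_eq_Some)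
  moreover have "trans_of S H \<in> extensional (dom (sig_of S))" by (simp add: trans_of_def)
  ultimately show ?thesis by (simp add: is_sig_translation_def sig_of_eq_Some)
qed

lemma den_trans_of: "f \<in> Hom S ms [0] \<Longrightarrow> T.den ms 0 (trans_of S H f) = AMap H f"
  by (simp add: trans_of_eq T.den_op_trm H_hom)

text \<open>
  Translating along \<open>H\<close> and taking the denotation is applying \<open>H\<close> to the denotation: both are the
  denotation under the interpretation of an operator \<open>f\<close> as \<open>H f\<close>.
\<close>

lemma den_translate_trans_of:
  assumes t: "is_trm (sig_of S) \<Theta> n t"
  shows "T.den \<Theta> n (translate (trans_of S H) t) = AMap H (S.den \<Theta> n t)"
  unfolding H_sem[OF S.interprets_sig_of t]
  by (rule T.sem_translate[OF T.interprets_sig_of is_sig_translation_trans_of _ t])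
    (simp add: sig_of_eq_Some den_trans_of)

lemma is_translation_trans_of: "is_translation (pres_of S) (pres_of T) (trans_of S H)"
proof (rule T.is_translation_pres_ofI[OF is_presentation_pres_of])
  fix \<Theta> n s t assume "(\<Theta>, n, s, t) \<in> axs (pres_of S)"
  then show "T.den \<Theta> n (translate (trans_of S H) s) = T.den \<Theta> n (translate (trans_of S H) t)"
    by (simp add: pres_of_def den_translate_trans_of)
qed (simp add: is_sig_translation_trans_of)

end

context coding
begin

definition pres_functor :: "('u alg_theory, 'u theory_arrow, 'u presentation, 'u pres_arrow) ftr" where
  "pres_functor = \<lparr>OMap = \<lambda>T\<in>Obj SOAT. pres_of T,
     AMap = \<lambda>(S, H, T)\<in>Arr SOAT. translation_class (pres_of S) (pres_of T) (trans_of S H)\<rparr>"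

lemma AMap_pres_functor:
  "algebraic_translation S T H \<Longrightarrow>
    AMap pres_functor (S, H, T) = translation_class (pres_of S) (pres_of T) (trans_of S H)"
  by (simp add: pres_functor_def SOAT_def algebraic_translation_def second_order_theory_def
      algebraic_translation_axioms_def)

lemma OMap_pres_functor: "is_alg_theory T \<Longrightarrow> OMap pres_functor T = pres_of T"
  by (simp add: pres_functor_def SOAT_def)

lemma Hom_SOATE:
  assumes "f \<in> Hom SOAT S T"
  obtains H where "f = (S, H, T)" "algebraic_translation S T H"
  using assms by (auto simp: Hom_SOAT algebraic_translationI)

lemma is_functor_pres_functor:
  "is_functor (SOAT :: ('u alg_theory, 'u theory_arrow) cat) SOEP pres_functor"
  unfolding is_functor_def
proof (intro conjI ballI impI)
  show "category (SOAT :: ('u alg_theory, 'u theory_arrow) cat)"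
    "category (SOEP :: ('u presentation, 'u pres_arrow) cat)"
    by (rule category_SOAT, rule category_SOEP)
  show "OMap pres_functor \<in> Obj SOAT \<rightarrow>\<^sub>E Obj SOEP"
    by (auto simp: pres_functor_def SOEP_def is_presentation_pres_of)
  have hom: "AMap pres_functor f \<in> Hom SOEP (pres_of S) (pres_of T)" if "f \<in> Hom SOAT S T"
    for f :: "'u theory_arrow" and S T
    using that by (elim Hom_SOATE) (simp add: AMap_pres_functor translation_class_hom
        is_presentation_pres_of algebraic_translation.is_translation_trans_of)
  have hom': "AMap pres_functor f \<in> Hom SOEP (pres_of (Dom SOAT f)) (pres_of (Cod SOAT f))"
    if "f \<in> Arr SOAT" for f using that by (intro hom) (simp add: Hom_def)
  show "AMap pres_functor \<in> Arr SOAT \<rightarrow>\<^sub>E Arr SOEP"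
  proof (rule PiE_I)
    show "AMap pres_functor f \<in> Arr SOEP" if "f \<in> Arr SOAT" for f
      using hom'[OF that] by (simp add: Hom_def)
  qed (simp add: pres_functor_def)
  have obj: "is_alg_theory (Dom SOAT f)" "is_alg_theory (Cod SOAT f)" if "f \<in> Arr SOAT"
    for f :: "'u theory_arrow" using that by (auto simp: SOAT_def)
  show "Dom SOEP (AMap pres_functor f) = OMap pres_functor (Dom SOAT f)"
    "Cod SOEP (AMap pres_functor f) = OMap pres_functor (Cod SOAT f)" if "f \<in> Arr SOAT" for f
    using hom'[OF that] obj[OF that] by (auto simp: Hom_def OMap_pres_functor)
  show "AMap pres_functor (Ide SOAT T) = Ide SOEP (OMap pres_functor T)" if "T \<in> Obj SOAT" for T
  proof -
    have T: "is_alg_theory T" using that by (simp add: SOAT_def)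
    have "trans_of T (id_ftr T) = id_translation (pres_of T)"
    proof (rule extensionalityI[of _ "dom (sig_of T)"])
      fix f assume "f \<in> dom (sig_of T)"
      then obtain ms where f: "sig_of T f = Some ms" by blast
      then have f': "f \<in> Hom T ms [0]" by (simp add: sig_of_eq_Some)
      then have "f \<in> Arr T" by (rule HomD)
      then show "trans_of T (id_ftr T) f = id_translation (pres_of T) f"
        using id_translation_eq[of "pres_of T" f ms] f trans_of_eq[OF f', of "id_ftr T"]
        by (simp add: id_ftr_def)
    qed (simp_all add: trans_of_def id_translation_def)
    then show ?thesis
      using AMap_pres_functor[OF algebraic_translationI[OF T T is_alg_translation_id[OF T]]]
      by (simp add: Ide_SOEP OMap_pres_functor T) (simp add: SOAT_def)
  qed
  fix f g :: "'u theory_arrow" assume fg: "f \<in> Arr SOAT" "g \<in> Arr SOAT" "Cod SOAT f = Dom SOAT g"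
  obtain R F S where f: "f = (R, F, S)" by (cases f)
  obtain T G where g: "g = (S, G, T)" using fg f by (cases g) (auto simp: SOAT_def)
  have "algebraic_translation R S F" "algebraic_translation S T G"
    using fg unfolding f g by (auto simp: SOAT_def intro: algebraic_translationI)
  then interpret F: algebraic_translation R S F + G: algebraic_translation S T G .
  interpret GF: algebraic_translation R T "comp_ftr R G F"
    by (rule algebraic_translationI[OF F.S.alg_theory G.T.alg_theory
          is_alg_translation_comp[OF F.algebraic_translation_axioms G.algebraic_translation_axioms]])
  note p = is_presentation_pres_of
  note c = is_translation_comp[OF p p p F.is_translation_trans_of G.is_translation_trans_of]
  have "(trans_of R (comp_ftr R G F), comp_translation (pres_of R) (trans_of S G) (trans_of R F))
      \<in> translation_rel (pres_of R) (pres_of T)"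
  proof (rule translation_relI[OF GF.is_translation_trans_of c])
    fix h ms assume "sig (pres_of R) h = Some ms"
    then have h: "h \<in> Hom R ms [0]" "h \<in> Arr R" "h \<in> dom (sig_of R)"
      by (auto simp: sig_of_eq_Some domI HomD)
    have trm: "is_trm (sig_of S) ms 0 (trans_of R F h)"
      using F.is_sig_translation_trans_of h by (simp add: is_sig_translation_def sig_of_eq_Some)
    have "G.T.den ms 0 (trans_of R (comp_ftr R G F) h) =
        G.T.den ms 0 (translate (trans_of S G) (trans_of R F h))"
      by (simp add: GF.den_trans_of[OF h(1)] G.den_translate_trans_of[OF trm] F.den_trans_of[OF h(1)])
        (simp add: comp_ftr_def compose_def h)
    then show "derivable (sig (pres_of T)) (axs (pres_of T)) ms 0 (trans_of R (comp_ftr R G F) h)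
        (comp_translation (pres_of R) (trans_of S G) (trans_of R F) h)"
      using G.T.derivable_pres_of GF.is_sig_translation_trans_of h(1)
        is_trm_translate[OF trm G.is_sig_translation_trans_of] h(3)
      by (simp add: comp_translation_def is_sig_translation_def sig_of_eq_Some)
  qed
  then show "AMap pres_functor (Comp SOAT g f) = Comp SOEP (AMap pres_functor g) (AMap pres_functor f)"
    using AMap_pres_functor[OF GF.algebraic_translation_axioms]
    by (simp add: f g AMap_pres_functor[OF F.algebraic_translation_axioms]
        AMap_pres_functor[OF G.algebraic_translation_axioms] 
        Comp_translation_class[OF p p p F.is_translation_trans_of G.is_translation_trans_of]
        translation_class_eq_iff[OF GF.is_translation_trans_of c, symmetric])
      (simp add: SOAT_def)
qed

lemma faithful_pres_functor:
  assumes "algebraic_translation S T H" "algebraic_translation S T K"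
    and eq: "AMap pres_functor (S, H, T) = AMap pres_functor (S, K, T)"
  shows "H = K"
proof -
  interpret H: algebraic_translation S T H by (rule assms)
  interpret K: algebraic_translation S T K by (rule assms)
  have rel: "(trans_of S H, trans_of S K) \<in> translation_rel (pres_of S) (pres_of T)"
    using eq by (simp add: AMap_pres_functor assms(1,2)
        translation_class_eq_iff[OF H.is_translation_trans_of K.is_translation_trans_of])
  show ?thesis
  proof (rule H.H_determined[OF assms(2)])
    fix f ms assume f: "f \<in> Hom S ms [0]"
    then have d: "derivable (sig_of T) (axs (pres_of T)) ms 0 (trans_of S H f) (trans_of S K f)"
      using rel by (simp add: translation_rel_def sig_of_eq_Some)
    moreover have "is_trm (sig_of T) ms 0 (trans_of S H f)" "is_trm (sig_of T) ms 0 (trans_of S K f)"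
      using presentation_derivable_is_trm[OF is_presentation_pres_of[of T]] d by auto
    ultimately have "H.T.den ms 0 (trans_of S H f) = H.T.den ms 0 (trans_of S K f)"
      by (simp add: H.T.derivable_pres_of)
    then show "AMap H f = AMap K f" by (simp add: H.den_trans_of[OF f] K.den_trans_of[OF f])
  qed
qed

text \<open>
  The translation \<open>\<tau>\<close> interprets the arrows of \<open>S\<close> into \<open>(0)\<close> in \<open>T\<close>. As \<open>\<tau>\<close> preserves the
  axioms of the internal language, which are all true equations, this interpretation extends to an
  algebraic translation.
\<close>

lemma full_pres_functor:
  assumes S: "is_alg_theory S" and T: "is_alg_theory T" and \<tau>: "is_translation (pres_of S) (pres_of T) \<tau>"
  shows "\<exists>H. algebraic_translation S T H \<and>
    AMap pres_functor (S, H, T) = translation_class (pres_of S) (pres_of T) \<tau>"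
proof -
  interpret S: second_order_theory S by unfold_locales (rule S)
  interpret T: second_order_theory T by unfold_locales (rule T)
  have \<tau>': "is_sig_translation (sig_of S) (sig_of T) \<tau>" using \<tau> by (simp add: is_translation_def)
  let ?J = "\<lambda>f. T.den (the (sig_of S f)) 0 (\<tau> f)"
  have tr: "T.den \<Theta> n (translate \<tau> t) = T.sem ?J \<Theta> n t" if "is_trm (sig_of S) \<Theta> n t" for \<Theta> n t
    by (rule T.sem_translate[OF T.interprets_sig_of \<tau>' _ that]) simp
  interpret interpretation_between S T ?J
  proof
    show "T.interprets ?J (sig_of S)"
      by (rule T.interprets_translation[OF T.interprets_sig_of \<tau>']) simp
    fix \<Theta> n s t assume st: "is_trm (sig_of S) \<Theta> n s" "is_trm (sig_of S) \<Theta> n t" "S.den \<Theta> n s = S.den \<Theta> n t"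
    then have "derivable (sig_of T) (axs (pres_of T)) \<Theta> n (translate \<tau> s) (translate \<tau> t)"
      using \<tau> by (auto simp: is_translation_def pres_of_def[of S])
    then show "T.sem ?J \<Theta> n s = T.sem ?J \<Theta> n t"
      using T.derivable_pres_of[OF is_trm_translate[OF st(1) \<tau>'] is_trm_translate[OF st(2) \<tau>']] st
      by (simp add: tr)
  qed
  interpret K: algebraic_translation S T K
    by (rule algebraic_translationI[OF S T is_alg_translation_K])
  have "(trans_of S K, \<tau>) \<in> translation_rel (pres_of S) (pres_of T)"
  proof (rule translation_relI[OF K.is_translation_trans_of \<tau>])
    fix f ms assume "sig (pres_of S) f = Some ms"
    then have f: "f \<in> Hom S ms [0]" "sig_of S f = Some ms" by (auto simp: sig_of_eq_Some)
    then have trm: "is_trm (sig_of T) ms 0 (trans_of S K f)" "is_trm (sig_of T) ms 0 (\<tau> f)"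
      using K.is_sig_translation_trans_of \<tau>' by (auto simp: is_sig_translation_def)
    show "derivable (sig (pres_of T)) (axs (pres_of T)) ms 0 (trans_of S K f) (\<tau> f)"
      using T.derivable_pres_of[OF trm] f
      by (simp add: K.den_trans_of[OF f(1)] AMap_K_operator[OF f(1)])
  qed
  then show ?thesis
    using K.algebraic_translation_axioms
    by (intro exI[of _ K]) (simp add: AMap_pres_functor
        translation_class_eq_iff[OF K.is_translation_trans_of \<tau>])
qed

text \<open>
  The translation \<open>\<alpha>\<close> sends an arrow of the syntactic theory into \<open>(0)\<close> to a term that it is the class
  of, and \<open>\<beta>\<close> sends an operator to its class. Both preserve denotations, tautological on the side of
  the internal language and canonical on the side of \<open>P\<close>, and this shows that they are translations and
  mutually inverse.
\<close>

lemma ess_surj_pres_functor: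
  fixes P :: "'u presentation"
  assumes P: "is_presentation P"
  shows "\<exists>T. is_alg_theory T \<and> (\<exists>i. is_iso SOEP (pres_of T) P i)"
proof -
  interpret P: syntactic_theory P code by (rule syntactic[OF P])
  let ?T = "syn_theory code P" and ?E = "pres_of (syn_theory code P)"
  note pE = is_presentation_pres_of[of ?T]
  define \<alpha> where "\<alpha> = (\<lambda>f\<in>dom (sig_of ?T). SOME t. is_trm (sig P) (the (sig_of ?T f)) 0 t \<and>
    f = P.mk (the (sig_of ?T f)) [t] [0])"
  define \<beta> where "\<beta> = (\<lambda>\<omega>\<in>dom (sig P). op_trm (P.can \<omega>) (the (sig P \<omega>)))"
  have \<alpha>: "is_trm (sig P) ms 0 (\<alpha> f) \<and> f = P.mk ms [\<alpha> f] [0]" if f: "sig_of ?T f = Some ms" for f ms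
  proof -
    have "f \<in> Hom ?T ms [0]" using f by (simp add: sig_of_eq_Some)
    then obtain ts where "P.trms ms [0] ts" "f = P.mk ms ts [0]" by (rule P.homE)
    then have "\<exists>t. is_trm (sig P) ms 0 t \<and> f = P.mk ms [t] [0]" by (auto simp: list_all2_Cons1)
    from someI_ex[OF this] show ?thesis using f by (simp add: \<alpha>_def domI)
  qed
  have \<alpha>_den: "P.Syn.sem P.can ms 0 (\<alpha> f) = f" if f: "sig_of ?T f = Some ms" for f ms
    using \<alpha>[OF f] P.sem_can[of ms 0 "\<alpha> f"] by simp
  have \<alpha>s: "is_sig_translation (sig_of ?T) (sig P) \<alpha>"
    using \<alpha> by (simp add: is_sig_translation_def) (simp add: \<alpha>_def)
  have can: "P.can \<omega> \<in> Hom ?T ms [0]" if "sig P \<omega> = Some ms" for \<omega> ms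
    using P.interprets_can that by (simp add: P.Syn.interprets_def)
  have \<beta>: "\<beta> \<omega> = op_trm (P.can \<omega>) ms" if "sig P \<omega> = Some ms" for \<omega> ms
    using that by (simp add: \<beta>_def domI)
  have \<beta>s: "is_sig_translation (sig P) (sig_of ?T) \<beta>"
    using can by (simp add: is_sig_translation_def \<beta> is_trm_op_trm sig_of_eq_Some) (simp add: \<beta>_def)
  \<comment> \<open>\<open>\<alpha> f\<close> denotes \<open>f\<close>, so interpreting after \<open>\<alpha>\<close> is the tautological interpretation\<close>
  have den_\<alpha>: "P.Syn.sem P.can \<Theta> n (translate \<alpha> t) = P.Syn.den \<Theta> n t"
    if "is_trm (sig_of ?T) \<Theta> n t" for \<Theta> n t
    by (rule P.Syn.sem_translate[OF P.interprets_can \<alpha>s _ that]) (simp add: \<alpha>_den)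
  have den_\<beta>: "P.Syn.den \<Theta> n (translate \<beta> t) = P.Syn.sem P.can \<Theta> n t"
    if "is_trm (sig P) \<Theta> n t" for \<Theta> n t
    by (rule P.Syn.sem_translate[OF P.Syn.interprets_sig_of \<beta>s _ that])
      (simp add: \<beta> P.Syn.den_op_trm[OF can])
  have \<alpha>t: "is_translation ?E P \<alpha>"
    unfolding is_translation_def
  proof (intro conjI ballI, goal_cases)
    case (2 e)
    obtain \<Theta> n s t where e: "e = (\<Theta>, n, s, t)" by (cases e)
    then have st: "is_trm (sig_of ?T) \<Theta> n s" "is_trm (sig_of ?T) \<Theta> n t" "P.Syn.den \<Theta> n s = P.Syn.den \<Theta> n t"
      using 2 by (auto simp: pres_of_def)
    then show ?case
      using P.sem_can_eq_iff[OF is_trm_translate[OF st(1) \<alpha>s] is_trm_translate[OF st(2) \<alpha>s]] e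
      by (simp add: den_\<alpha>)
  qed (simp add: \<alpha>s)
  have \<beta>t: "is_translation P ?E \<beta>"
  proof (rule P.Syn.is_translation_pres_ofI[OF P \<beta>s])
    fix \<Theta> n s t assume ax: "(\<Theta>, n, s, t) \<in> axs P"
    then have trm: "is_trm (sig P) \<Theta> n s" "is_trm (sig P) \<Theta> n t"
      using P by (auto simp: is_presentation_def)
    then show "P.Syn.den \<Theta> n (translate \<beta> s) = P.Syn.den \<Theta> n (translate \<beta> t)"
      using P.sem_can_eq_iff[OF trm] derivable.axiom[OF ax, of "sig P"] by (simp add: den_\<beta>)
  qed
  note \<beta>\<alpha> = is_translation_comp[OF pE P pE \<alpha>t \<beta>t] and \<alpha>\<beta> = is_translation_comp[OF P pE P \<beta>t \<alpha>t]
  have "(comp_translation ?E \<beta> \<alpha>, id_translation ?E) \<in> translation_rel ?E ?E"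
  proof (rule translation_relI[OF \<beta>\<alpha> is_translation_id[OF pE]])
    fix f ms assume f: "sig ?E f = Some ms"
    then have f': "sig_of ?T f = Some ms" "f \<in> Hom ?T ms [0]" by (auto simp: sig_of_eq_Some)
    have "P.Syn.den ms 0 (translate \<beta> (\<alpha> f)) = P.Syn.den ms 0 (op_trm f ms)"
      using \<alpha>[OF f'(1)] by (simp add: den_\<beta> \<alpha>_den[OF f'(1)] P.Syn.den_op_trm[OF f'(2)])
    then show "derivable (sig ?E) (axs ?E) ms 0 (comp_translation ?E \<beta> \<alpha> f) (id_translation ?E f)"
      using P.Syn.derivable_pres_of[OF is_trm_translate[OF _ \<beta>s] is_trm_op_trm[of "sig_of ?T" f ms 0, OF f'(1)]] \<alpha>[OF f'(1)]
        id_translation_eq[OF f]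
      by (simp add: comp_translation_def domI[of "sig_of ?T", OF f'(1)])
  qed
  then have 1: "Comp SOEP (translation_class P ?E \<beta>) (translation_class ?E P \<alpha>) = Ide SOEP ?E"
    unfolding Comp_translation_class[OF pE P pE \<alpha>t \<beta>t] Ide_SOEP
    by (simp add: translation_class_eq_iff[OF \<beta>\<alpha> is_translation_id[OF pE]])
  have "(comp_translation P \<alpha> \<beta>, id_translation P) \<in> translation_rel P P"
  proof (rule translation_relI[OF \<alpha>\<beta> is_translation_id[OF P]])
    fix \<omega> ms assume \<omega>: "sig P \<omega> = Some ms"
    have trm: "is_trm (sig_of ?T) ms 0 (\<beta> \<omega>)" using \<beta>s \<omega> by (simp add: is_sig_translation_def)
    have "P.Syn.sem P.can ms 0 (translate \<alpha> (\<beta> \<omega>)) = P.Syn.den ms 0 (\<beta> \<omega>)"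
      by (rule den_\<alpha>[OF trm])
    also have "\<dots> = P.Syn.sem P.can ms 0 (op_trm \<omega> ms)"
      using \<omega> by (simp add: \<beta> P.Syn.den_op_trm[OF can] P.Syn.sem_op_trm can)
    finally show "derivable (sig P) (axs P) ms 0 (comp_translation P \<alpha> \<beta> \<omega>) (id_translation P \<omega>)"
      using P.sem_can_eq_iff[OF is_trm_translate[OF trm \<alpha>s] is_trm_op_trm[of "sig P" \<omega> ms 0, OF \<omega>]] \<omega>
      by (simp add: comp_translation_def domI id_translation_eq)
  qed
  then have 2: "Comp SOEP (translation_class ?E P \<alpha>) (translation_class P ?E \<beta>) = Ide SOEP P"
    unfolding Comp_translation_class[OF P pE P \<beta>t \<alpha>t] Ide_SOEP
    by (simp add: translation_class_eq_iff[OF \<alpha>\<beta> is_translation_id[OF P]])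
  have "is_iso SOEP ?E P (translation_class ?E P \<alpha>)"
    unfolding is_iso_def
    using 1 2 translation_class_hom[OF pE P \<alpha>t] translation_class_hom[OF P pE \<beta>t] by blast
  then show ?thesis using P.is_alg_theory_Syn by blast
qed

end

theorem theorem6p6:
  assumes "infinite (UNIV :: 'u set)"
  shows "equivalent_categories
    (SOAT :: ('u alg_theory, 'u theory_arrow) cat)
    (SOEP :: ('u presentation, 'u pres_arrow) cat)"
proof -
  obtain code :: "'u arity_arrow \<Rightarrow> 'u" where "inj code" using ex_inj_arity_arrow[OF assms] by blast
  then interpret coding code by unfold_locales
  have obj: "T \<in> Obj SOAT \<longleftrightarrow> is_alg_theory T" for T :: "'u alg_theory" by (simp add: SOAT_def)
  show ?thesis
  proof (rule equivalent_categories_if_full_faithful_ess_surj[OF is_functor_pres_functor])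
    fix S T :: "'u alg_theory" and g
    assume ST: "S \<in> Obj SOAT" "T \<in> Obj SOAT"
      and g: "g \<in> Hom SOEP (OMap pres_functor S) (OMap pres_functor T)"
    then obtain \<tau> where \<tau>: "is_translation (pres_of S) (pres_of T) \<tau>"
      "g = translation_class (pres_of S) (pres_of T) \<tau>"
      by (auto simp: obj OMap_pres_functor elim: Hom_SOEPE)
    then obtain H where H: "algebraic_translation S T H" "AMap pres_functor (S, H, T) = g"
      using full_pres_functor[of S T \<tau>] ST by (auto simp: obj)
    then have "(S, H, T) \<in> Hom SOAT S T"
      using ST by (auto simp: Hom_SOAT obj algebraic_translation_def algebraic_translation_axioms_def)
    then show "\<exists>f\<in>Hom SOAT S T. AMap pres_functor f = g" using H(2) by blast
  next
    fix S T and f f' :: "'u theory_arrow"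
    assume "f \<in> Hom SOAT S T" "f' \<in> Hom SOAT S T" "AMap pres_functor f = AMap pres_functor f'"
    then show "f = f'" by (elim Hom_SOATE) (auto dest: faithful_pres_functor)
  next
    fix P :: "'u presentation" assume "P \<in> Obj SOEP"
    then have "is_presentation P" by (simp add: SOEP_def)
    then obtain T i where "is_alg_theory T" "is_iso SOEP (pres_of T) P i"
      using ess_surj_pres_functor by blast
    then show "\<exists>T\<in>Obj SOAT. \<exists>i. is_iso SOEP (OMap pres_functor T) P i"
      by (intro bexI[of _ T] exI[of _ i]) (simp_all add: obj OMap_pres_functor)
  qed
qed

end
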